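(* Let $F$ be a field, and let $G$ be a graph that has an isolated vertex and whose independence complex $I(G)$ is sequentially Cohen-Macaulay over $F$. Let $k$ be the minimal facet cardinality of $I(G)$ (that is, the minimum size of an inclusion-maximal independent set of $G$). Then $I(G)$ is $r$-EKR for every positive integer $r$ with $r\leq\frac{k}{2}$.
   Context: Graphs are finite and simple. The independence complex $I(G)$ is the simplicial complex on vertex set $V(G)$ whose faces are the independent sets of $G$. A facet of a simplicial complex is a face maximal under inclusion; the dimension of a face $\sigma$ is $|\sigma|-1$. For a simplicial complex $\Delta$, $f_r(\Delta)$ is the number of faces of cardinality $r$. For a face $\sigma$, $\operatorname{link}_\Delta\sigma=\{\tau : \tau\cup\sigma \text{ is a face of }\Delta,\ \tau\cap\sigma=\emptyset\}$; for a vertex $v$, $\operatorname{link}_\Delta v=\operatorname{link}_\Delta\{v\}$. A family of sets is intersecting if every pair of its members has non-empty intersection; it is an $r$-family if every member has cardinality $r$. $\Delta$ is $r$-EKR if every intersecting $r$-family $\mathcal{A}$ of faces of $\Delta$ satisfies $|\mathcal{A}|\leq\max_{v\in V(\Delta)}f_{r-1}(\operatorname{link}_\Delta v)$. $\Delta$ is Cohen-Macaulay over $F$ if $\tilde{H}_i(\operatorname{link}_\Delta\sigma;F)=0$ for all faces $\sigma$ of $\Delta$ (including $\sigma=\emptyset$) and all $i<\dim(\operatorname{link}_\Delta\sigma)$. The pure $d$-skeleton of $\Delta$ is the subcomplex generated by all faces of dimension exactly $d$. $\Delta$ is sequentially Cohen-Macaulay over $F$ if its pure $d$-skeleton is Cohen-Macaulay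 over $F$ for all $d\le\dim\Delta$. *)

theory Defs
  imports Complex_Main
begin

definition simple_graph :: "'a set \<Rightarrow> 'a set set \<Rightarrow> bool" where
  "simple_graph V E \<longleftrightarrow> finite V \<and> (\<forall>e\<in>E. e \<subseteq> V \<and> card e = 2)"

definition isolated_vertex :: "'a set \<Rightarrow> 'a set set \<Rightarrow> 'a \<Rightarrow> bool" where
  "isolated_vertex V E v \<longleftrightarrow> v \<in> V \<and> (\<forall>e\<in>E. v \<notin> e)"

definition independence_complex :: "'a set \<Rightarrow> 'a set set \<Rightarrow> 'a set set" where
  "independence_complex V E = {S. S \<subseteq> V \<and> (\<forall>u\<in>S. \<forall>v\<in>S. {u, v} \<notin> E)}"

text \<open>A simplicial complex is represented by its set of faces. It contains the empty face
  unless it is the void complex \<open>{}\<close>.\<close>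

definition vertices :: "'a set set \<Rightarrow> 'a set" where
  "vertices K = \<Union>K"

definition face_dim :: "'a set \<Rightarrow> int" where
  "face_dim \<sigma> = int (card \<sigma>) - 1"

definition complex_dim :: "'a set set \<Rightarrow> int" where
  "complex_dim K = Max (face_dim ` K)"

definition facets :: "'a set set \<Rightarrow> 'a set set" where
  "facets K = {\<sigma> \<in> K. \<forall>\<tau>\<in>K. \<sigma> \<subseteq> \<tau> \<longrightarrow> \<tau> = \<sigma>}"

definition min_facet_card :: "'a set set \<Rightarrow> nat" where
  "min_facet_card K = Min (card ` facets K)"

text \<open>The index is the cardinality of the counted faces, not their dimension.\<close>

definition face_number :: "nat \<Rightarrow> 'a set set \<Rightarrow> nat" where
  "face_number r K = card {\<sigma> \<in> K. card \<sigma> = r}"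

definition link :: "'a set set \<Rightarrow> 'a set \<Rightarrow> 'a set set" where
  "link K \<sigma> = {\<tau>. \<tau> \<union> \<sigma> \<in> K \<and> \<tau> \<inter> \<sigma> = {}}"

definition pure_skeleton :: "int \<Rightarrow> 'a set set \<Rightarrow> 'a set set" where
  "pure_skeleton d K = {\<tau>. \<exists>\<sigma>\<in>K. face_dim \<sigma> = d \<and> \<tau> \<subseteq> \<sigma>}"

definition intersecting :: "'a set set \<Rightarrow> bool" where
  "intersecting A \<longleftrightarrow> (\<forall>\<sigma>\<in>A. \<forall>\<tau>\<in>A. \<sigma> \<inter> \<tau> \<noteq> {})"

definition EKR :: "nat \<Rightarrow> 'a set set \<Rightarrow> bool" where
  "EKR r K \<longleftrightarrow>
    (\<forall>A. A \<subseteq> K \<and> (\<forall>\<sigma>\<in>A. card \<sigma> = r) \<and> intersecting A \<longrightarrow>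
      card A \<le> Max ((\<lambda>v. face_number (r - 1) (link K {v})) ` vertices K))"

text \<open>Reduced simplicial homology over a field \<open>'f\<close>. Faces are oriented by a linear order of the
  vertices; one such order is fixed for each vertex type, and up to isomorphism the homology
  does not depend on it.\<close>

definition vertex_order :: "'a rel" where
  "vertex_order = (SOME r. linear_order r)"

lemma linear_order_vertex_order: "linear_order vertex_order"
proof -
  obtain r :: "'a rel" where "well_order r"
    using well_order_on by blast
  then have "linear_order r"
    by (simp add: well_order_on_def)
  then show ?thesis
    unfolding vertex_order_def by (rule someI)
qed

text \<open>A chain is given by its coefficients. Dimension \<open>-1\<close> is included (spanned by the empty
  face), and below it only the zero chain is left.\<close>

definition simplicial_chains :: "'a set set \<Rightarrow> int \<Rightarrow> ('a set \<Rightarrow> 'f::field) set" where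
  "simplicial_chains K i = {c. \<forall>\<sigma>. c \<sigma> \<noteq> 0 \<longrightarrow> \<sigma> \<in> K \<and> face_dim \<sigma> = i}"

text \<open>The usual boundary sends \<open>[v\<^sub>0, \<dots>, v\<^sub>p]\<close>, with \<open>v\<^sub>0 < \<dots> < v\<^sub>p\<close>, to the sum of
  \<open>(-1)\<^sup>j\<close> times the face omitting \<open>v\<^sub>j\<close>. Its coefficient at a face \<open>\<tau>\<close> collects the
  faces obtained by adding one vertex \<open>v\<close> to \<open>\<tau>\<close>, and the position of \<open>v\<close> there is
  the number of elements of \<open>\<tau>\<close> below \<open>v\<close>.\<close>

definition boundary_map :: "'a set set \<Rightarrow> ('a set \<Rightarrow> 'f::field) \<Rightarrow> 'a set \<Rightarrow> 'f" where
  "boundary_map K c \<tau> =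
    (\<Sum>v \<in> vertices K - \<tau>. (-1) ^ card {u \<in> \<tau>. (u, v) \<in> vertex_order} * c (insert v \<tau>))"

definition cycles :: "'a set set \<Rightarrow> int \<Rightarrow> ('a set \<Rightarrow> 'f::field) set" where
  "cycles K i = {c \<in> simplicial_chains K i. boundary_map K c = (\<lambda>_. 0)}"

definition boundaries :: "'a set set \<Rightarrow> int \<Rightarrow> ('a set \<Rightarrow> 'f::field) set" where
  "boundaries K i = boundary_map K ` simplicial_chains K (i + 1)"

definition homologous :: "'a set set \<Rightarrow> int \<Rightarrow> ('a set \<Rightarrow> 'f::field) rel" where
  "homologous K i =
    {(z, z'). z \<in> cycles K i \<and> z' \<in> cycles K i \<and> (\<lambda>\<sigma>. z \<sigma> - z' \<sigma>) \<in> boundaries K i}"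

definition reduced_homology :: "'a set set \<Rightarrow> int \<Rightarrow> ('a set \<Rightarrow> 'f::field) set set" where
  "reduced_homology K i = cycles K i // homologous K i"

text \<open>The class of zero in the quotient is the set of boundaries.\<close>

definition homology_vanishes :: "'f::field itself \<Rightarrow> 'a set set \<Rightarrow> int \<Rightarrow> bool" where
  "homology_vanishes F K i \<longleftrightarrow>
    (reduced_homology K i :: ('a set \<Rightarrow> 'f) set set) = {boundaries K i}"

definition cohen_macaulay :: "'f::field itself \<Rightarrow> 'a set set \<Rightarrow> bool" where
  "cohen_macaulay F K \<longleftrightarrow>
    (\<forall>\<sigma>\<in>K. \<forall>i < complex_dim (link K \<sigma>). homology_vanishes F (link K \<sigma>) i)"

definition sequentially_cohen_macaulay :: "'f::field itself \<Rightarrow> 'a set set \<Rightarrow> bool" where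
  "sequentially_cohen_macaulay F K \<longleftrightarrow>
    (\<forall>d \<le> complex_dim K. cohen_macaulay F (pure_skeleton d K))"

end

(* Algebraic shifting in the style of Kalai. Over the algebraic closure of the ground field, pass from
   the chains of the independence complex K and from the span of an intersecting r-family to their
   generic initial families: these are families of subsets of {0, ..., n - 1} of the right sizes, the
   first one is a shifted simplicial complex, and the second one is a shifted intersecting family in it,
   because the span of an intersecting family has zero exterior square. For a shifted complex whose
   faces all extend to cardinality 2r, the Erdos-Ko-Rado bound holds by induction on the number of
   vertices, and the number of r-faces through its first vertex is the rank of a generic boundary map,
   which the isolated vertex bounds by the number of (r-1)-faces in its link.

   The Cohen-Macaulay hypothesis enters only to show that the faces of the shifted complex extend to the
   minimal facet cardinality k. The vanishing homology of the links makes the boundary map with weights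
   xi exact in degrees below k minus the number of zeros of xi. For weights in general position this
   exactness passes to the joint kernels of the first few boundary maps, by an eigenvalue argument for
   pencils of anticommuting differentials. *)
theory Submission
  imports Defs "HOL-Library.Function_Algebras" "HOL-Algebra.Algebraic_Closure_Type"
begin

subsection \<open>Shifted intersecting families\<close>

text \<open>The pencil argument dictates the design. To carry exactness over to the joint kernel of
  the first \<open>p\<close> covectors, one needs it for every combination
  \<open>\<xi>_p + \<Sum> l_j \<xi>_j\<close> over \<open>j < p\<close>. The scalars
  \<open>l_j\<close> are roots of polynomials that depend on the covectors already chosen, so no
  generic choice can avoid bad values. What general position does guarantee, for all
  \<open>l_j\<close> at once, is that at most \<open>p\<close> weights of the combination vanish.
  Each vanishing weight costs one degree, as deleting a vertex does, so exactness survives in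
  degrees \<open>i\<close> with \<open>i + p < k\<close>. This suffices exactly: a face is extended
  by replacing it with the segment \<open>{..<p}\<close> and a remainder of \<open>k - p\<close>
  elements. The closure is taken because the pencil needs a root; it is also infinite, as the
  generic choice requires. Generic covectors are found inside this field by maximising ranks,
  without transcendental extensions: at a maximum, every contraction maps the kernel of the chosen
  one into its image, and this is precisely an adjacent exchange of shifting. The bound
  \<open>2 * r \<le> k\<close> enters through the vertex induction, which needs faces extending to
  cardinality \<open>2 * r\<close>.\<close>

definition shifted :: "nat set set \<Rightarrow> bool" where
  "shifted F \<longleftrightarrow> (\<forall>S\<in>F. \<forall>i. Suc i \<in> S \<and> i \<notin> S \<longrightarrow> insert i (S - {Suc i}) \<in> F)"

lemma shifted_step:
  assumes "shifted F" "S \<in> F" "Suc i \<in> S" "i \<notin> S"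
  shows "insert i (S - {Suc i}) \<in> F"
  using assms by (simp add: shifted_def)

text \<open>The exchange passes through \<open>Suc i\<close>. If \<open>Suc i\<close> is occupied,
  its vertex first drops to \<open>i\<close> and \<open>j\<close> then fills the gap; if it is free,
  \<open>j\<close> moves to \<open>Suc i\<close> and from there to \<open>i\<close>.\<close>

lemma shiftedD:
  assumes "shifted F" "S \<in> F" "j \<in> S" "i \<notin> S" "i < j"
  shows "insert i (S - {j}) \<in> F"
  using assms(2-5)
proof (induction "j - i" arbitrary: S i rule: less_induct)
  case less
  show ?case
  proof (cases "j = Suc i")
    case True
    then show ?thesis using shifted_step[OF assms(1)] less.prems by simp
  next
    case False
    then have lt: "Suc i < j" using less.prems by simp
    show ?thesis
    proof (cases "Suc i \<in> S")
      case True
      let ?S1 = "insert i (S - {Suc i})"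
      have "?S1 \<in> F" by (rule shifted_step[OF assms(1) less.prems(1) True less.prems(3)])
      then have "insert (Suc i) (?S1 - {j}) \<in> F"
        using less.hyps[of "Suc i" ?S1] lt less.prems by auto
      moreover have "insert (Suc i) (?S1 - {j}) = insert i (S - {j})"
        using True lt less.prems by auto
      ultimately show ?thesis by simp
    next
      case nS: False
      have "insert (Suc i) (S - {j}) \<in> F"
        using less.hyps[of "Suc i" S] lt nS less.prems by auto
      then have "insert i (insert (Suc i) (S - {j}) - {Suc i}) \<in> F"
        by (rule shifted_step[OF assms(1)]) (use less.prems lt in auto)
      moreover have "insert (Suc i) (S - {j}) - {Suc i} = S - {j}" using nS by auto
      ultimately show ?thesis by simp
    qed
  qed
qed

lemma card_split_vertex:
  assumes "finite F"
  shows "card F = card {S. m \<notin> S \<and> insert m S \<in> F} + card {S\<in>F. m \<notin> S}"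
proof -
  have "bij_betw (insert m) {S. m \<notin> S \<and> insert m S \<in> F} {S\<in>F. m \<in> S}"
    by (rule bij_betw_byWitness[where f'="\<lambda>S. S - {m}"]) (auto simp: insert_absorb)
  then have "card {S. m \<notin> S \<and> insert m S \<in> F} = card {S\<in>F. m \<in> S}"
    by (rule bij_betw_same_card)
  moreover have "card F = card {S\<in>F. m \<in> S} + card {S\<in>F. m \<notin> S}"
    by (subst card_Un_disjoint[symmetric]) (use assms in \<open>auto intro: arg_cong[where f=card]\<close>)
  ultimately show ?thesis by simp
qed

text \<open>Induction on the number of vertices, splitting off the last one. Shiftedness makes the link of the
  last vertex in the family intersecting: two disjoint members would leave room to move the last
  vertex of one of them to an unused position.\<close>

lemma shifted_EKR:
  assumes "D \<subseteq> Pow {..<n}" "\<And>S T. S \<in> D \<Longrightarrow> T \<subseteq> S \<Longrightarrow> T \<in> D" "shifted D"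
    and "\<And>S. S \<in> D \<Longrightarrow> card S \<le> 2 * r \<Longrightarrow> \<exists>T\<in>D. S \<subseteq> T \<and> card T = 2 * r"
    and "A \<subseteq> D" "\<And>S. S \<in> A \<Longrightarrow> card S = r" "shifted A" "intersecting A" "r \<ge> 1"
  shows "card A \<le> card {S\<in>D. card S = r \<and> 0 \<in> S}"
  using assms
proof (induction n arbitrary: D A r rule: less_induct)
  case (less n)
  note sub = less.prems(1) and down = less.prems(2) and shD = less.prems(3) and ext = less.prems(4)
    and AD = less.prems(5) and Ar = less.prems(6) and shA = less.prems(7) and int = less.prems(8)
    and r = less.prems(9)
  have finD: "finite D" using sub finite_subset by blast
  have finA: "finite A" using finD AD finite_subset by blast
  have fin: "finite S" if "S \<in> D" for S using sub that finite_subset by blast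
  show ?case
  proof (cases "A = {}")
    case True then show ?thesis by simp
  next
    case False
    then obtain S0 where S0: "S0 \<in> A" by blast
    obtain T0 where T0: "T0 \<in> D" "card T0 = 2 * r"
      using ext[of S0] S0 AD Ar by fastforce
    have T0n: "T0 \<subseteq> {..<n}" using T0 sub by auto
    then have n2r: "2 * r \<le> n" using T0 card_mono[of "{..<n}" T0] by simp
    consider "n = 2 * r" | "n > 2 * r" "r = 1" | "n > 2 * r" "r \<ge> 2" using n2r r by linarith
    then show ?thesis
    proof cases
      case 1
      have "T0 = {..<n}" using T0 T0n 1 by (intro card_subset_eq) auto
      then have D: "D = Pow {..<n}" using T0 down sub by blast
      \<comment> \<open>Here \<open>D\<close> is the full simplex on \<open>2 * r\<close> vertices.
        An intersecting family holds at most one set of each complementary pair, and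
        \<open>f\<close> selects the one through vertex 0.\<close>
      define f where "f S = (if 0 \<in> S then S else {..<n} - S)" for S
      have "inj_on f A"
      proof (rule inj_onI)
        fix S S' assume S: "S \<in> A" "S' \<in> A" "f S = f S'"
        have "S \<inter> S' \<noteq> {}" using int S by (auto simp: intersecting_def)
        moreover have "S \<subseteq> {..<n}" "S' \<subseteq> {..<n}" using S AD D by auto
        ultimately show "S = S'" using S(3) unfolding f_def by (auto split: if_splits)
      qed
      moreover have "f ` A \<subseteq> {S\<in>D. card S = r \<and> 0 \<in> S}"
      proof
        fix W assume "W \<in> f ` A"
        then obtain S where S: "S \<in> A" "W = f S" by auto
        have "S \<subseteq> {..<n}" using S AD D by auto
        then have "card ({..<n} - S) = n - r" using Ar[OF S(1)]
          by (subst card_Diff_subset) (auto intro: finite_subset)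
        then show "W \<in> {S\<in>D. card S = r \<and> 0 \<in> S}"
          using S Ar[OF S(1)] 1 r D \<open>S \<subseteq> {..<n}\<close> by (auto simp: f_def)
      qed
      ultimately show ?thesis using finD by (intro card_inj_on_le) auto
    next
      case 2
      have "\<exists>a. S = {a}" if "S \<in> A" for S using Ar[OF that] 2 card_1_singletonE by metis
      note single = this
      obtain a where a: "S0 = {a}" using single[OF S0] by blast
      have "S = S0" if S: "S \<in> A" for S
      proof -
        obtain b where b: "S = {b}" using single[OF S] by blast
        have "S \<inter> S0 \<noteq> {}" using int S S0 by (auto simp: intersecting_def)
        then show ?thesis using a b by auto
      qed
      then have "A = {S0}" using S0 by blast
      have "0 \<in> S0"
      proof (rule ccontr)
        assume "0 \<notin> S0"
        then have "insert 0 (S0 - {a}) \<in> A" using shiftedD[OF shA S0, of a 0] a by auto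
        then show False using \<open>A = {S0}\<close> a \<open>0 \<notin> S0\<close> by auto
      qed
      then have "A \<subseteq> {S\<in>D. card S = r \<and> 0 \<in> S}" using \<open>A = {S0}\<close> AD Ar by auto
      then show ?thesis using finD by (intro card_mono) auto
    next
      case 3
      define m where "m = n - 1"
      have m: "m < n" "m > 0" "{..<n} = insert m {..<m}" using 3 by (auto simp: m_def)
      define Dl where "Dl = {S. m \<notin> S \<and> insert m S \<in> D}"
      define Dd where "Dd = {S\<in>D. m \<notin> S}"
      define Al where "Al = {S. m \<notin> S \<and> insert m S \<in> A}"
      define Ad where "Ad = {S\<in>A. m \<notin> S}"
      have shift_link: "shifted {S. m \<notin> S \<and> insert m S \<in> F}" if "shifted F" "F \<subseteq> D" for F
        unfolding shifted_def
      proof (intro ballI allI impI)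
        fix S i assume S: "S \<in> {S. m \<notin> S \<and> insert m S \<in> F}" "Suc i \<in> S \<and> i \<notin> S"
        have "S \<subseteq> {..<m}" using S sub that(2) m by auto
        then have im: "i \<noteq> m" "Suc i \<noteq> m" using S by auto
        have "insert i (insert m S - {Suc i}) \<in> F"
          by (rule shifted_step[OF that(1)]) (use S im in auto)
        moreover have "insert i (insert m S - {Suc i}) = insert m (insert i (S - {Suc i}))"
          using im by auto
        ultimately show "insert i (S - {Suc i}) \<in> {S. m \<notin> S \<and> insert m S \<in> F}"
          using S im by auto
      qed
      have shift_del: "shifted {S\<in>F. m \<notin> S}" if "shifted F" "F \<subseteq> D" for F
        unfolding shifted_def
      proof (intro ballI allI impI)
        fix S i assume S: "S \<in> {S\<in>F. m \<notin> S}" "Suc i \<in> S \<and> i \<notin> S"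
        have "S \<subseteq> {..<m}" using S sub that(2) m by auto
        then have "i \<noteq> m" using S by auto
        moreover have "insert i (S - {Suc i}) \<in> F"
          by (rule shifted_step[OF that(1)]) (use S in auto)
        ultimately show "insert i (S - {Suc i}) \<in> {S\<in>F. m \<notin> S}" using S by simp
      qed
      have cardl: "card S = r - 1" if "S \<in> Al" for S
      proof -
        have mS: "insert m S \<in> A" "m \<notin> S" using that by (auto simp: Al_def)
        have "card (insert m S) = r" by (rule Ar[OF mS(1)])
        moreover have "finite (insert m S)" by (rule fin) (use mS(1) AD in auto)
        ultimately show ?thesis using mS(2) by simp
      qed
      have "card Al \<le> card {S\<in>Dl. card S = r - 1 \<and> 0 \<in> S}"
      proof (rule less.IH[of m])
        show "m < n" by fact
        show "Dl \<subseteq> Pow {..<m}" using sub m by (auto simp: Dl_def)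
        show "T \<in> Dl" if "S \<in> Dl" "T \<subseteq> S" for S T
          using that down[of "insert m S" "insert m T"] by (auto simp: Dl_def)
        show "shifted Dl" unfolding Dl_def by (rule shift_link[OF shD]) auto
        show "\<exists>T\<in>Dl. S \<subseteq> T \<and> card T = 2 * (r - 1)" if S: "S \<in> Dl" "card S \<le> 2 * (r - 1)" for S
        proof -
          have S': "insert m S \<in> D" "m \<notin> S" using S by (auto simp: Dl_def)
          have "finite S" using fin[OF S'(1)] by simp
          then have "card (insert m S) \<le> 2 * r" using S S' 3 by simp
          then obtain T where T: "T \<in> D" "insert m S \<subseteq> T" "card T = 2 * r"
            using ext S' by blast
          \<comment> \<open>Passing to the link costs one vertex while the required cardinality
            drops by two, so one element is to spare and \<open>T'\<close> is cut out.\<close>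
          have "card (T - {m}) = 2 * r - 1" using T fin by (simp add: card_Diff_singleton)
          then have "2 * (r - 1) \<le> card (T - {m})" by simp
          moreover have "S \<subseteq> T - {m}" "finite (T - {m})" using T S' fin[OF T(1)] by auto
          ultimately obtain T' where "S \<subseteq> T'" "T' \<subseteq> T - {m}" "card T' = 2 * (r - 1)"
            using exists_subset_between[of S "2*(r-1)" "T - {m}"] S(2) by fastforce
          moreover have "insert m T' \<in> D" by (rule down[OF T(1)]) (use \<open>T' \<subseteq> T - {m}\<close> T(2) in auto)
          ultimately show ?thesis unfolding Dl_def by blast
        qed
        show "Al \<subseteq> Dl" using AD by (auto simp: Al_def Dl_def)
        show "card S = r - 1" if "S \<in> Al" for S by (rule cardl[OF that])
        show "shifted Al" unfolding Al_def by (rule shift_link[OF shA AD])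
        show "1 \<le> r - 1" using 3 by simp
        show "intersecting Al"
          unfolding intersecting_def
        proof (intro ballI notI)
          fix S T assume ST: "S \<in> Al" "T \<in> Al" "S \<inter> T = {}"
          have "card (S \<union> T) \<le> 2 * (r - 1)" using card_Un_le[of S T] cardl[OF ST(1)] cardl[OF ST(2)] by simp
          then have "card (S \<union> T) < card {..<m}" using 3 by (auto simp: m_def)
          moreover have "finite (insert m S)" "finite (insert m T)"
            by (rule fin; use ST AD in \<open>auto simp: Al_def\<close>)+
          ultimately obtain i where i: "i < m" "i \<notin> S \<union> T"
            by (metis card_mono finite_Un finite_insert lessThan_iff linorder_not_le subsetI)
          have SA: "insert m S \<in> A" "insert m T \<in> A" "m \<notin> S" "m \<notin> T" using ST by (auto simp: Al_def)
          have "insert i (insert m S - {m}) \<in> A"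
            using shiftedD[OF shA SA(1), of m i] i by auto
          then have "insert i (insert m S - {m}) \<inter> insert m T \<noteq> {}"
            using int SA unfolding intersecting_def by blast
          then show False using ST i SA by auto
        qed
      qed
      moreover have "card Ad \<le> card {S\<in>Dd. card S = r \<and> 0 \<in> S}"
      proof (rule less.IH[of m])
        show "m < n" by fact
        show "Dd \<subseteq> Pow {..<m}" using sub m by (auto simp: Dd_def)
        show "T \<in> Dd" if "S \<in> Dd" "T \<subseteq> S" for S T
          using that down[of S T] by (auto simp: Dd_def)
        show "shifted Dd" unfolding Dd_def by (rule shift_del[OF shD]) auto
        show "\<exists>T\<in>Dd. S \<subseteq> T \<and> card T = 2 * r" if S: "S \<in> Dd" "card S \<le> 2 * r" for S
        proof -
          obtain T where T: "T \<in> D" "S \<subseteq> T" "card T = 2 * r"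
            using ext S by (auto simp: Dd_def)
          show ?thesis
          proof (cases "m \<in> T")
            case False then show ?thesis using T by (auto simp: Dd_def)
          next
            case True
            \<comment> \<open>Strict because \<open>n > 2 * r\<close>, which is why
              \<open>n = 2 * r\<close> is a separate case: a free position is needed to replace
              \<open>m\<close>, so that the extension stays in the deletion.\<close>
            have "card T < card {..<n}" using T 3 by simp
            then obtain i where i: "i < n" "i \<notin> T"
              using fin[OF T(1)] by (metis card_mono lessThan_iff linorder_not_le subsetI)
            then have "i \<noteq> m" using True by auto
            then have "i < m" using i(1) by (simp add: m_def)
            have "insert i (T - {m}) \<in> D" using shiftedD[OF shD T(1) True] i \<open>i < m\<close> by auto
            moreover have "card (insert i (T - {m})) = 2 * r"
              using i T fin[OF T(1)] True 3 by (simp add: card_Diff_singleton)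
            moreover have "S \<subseteq> insert i (T - {m})" using S T by (auto simp: Dd_def)
            ultimately show ?thesis using \<open>i < m\<close> by (auto simp: Dd_def intro!: bexI[of _ "insert i (T - {m})"])
          qed
        qed
        show "Ad \<subseteq> Dd" using AD by (auto simp: Ad_def Dd_def)
        show "card S = r" if "S \<in> Ad" for S using Ar that by (auto simp: Ad_def)
        show "shifted Ad" unfolding Ad_def by (rule shift_del[OF shA AD])
        show "1 \<le> r" by fact
        show "intersecting Ad" using int by (auto simp: intersecting_def Ad_def)
      qed
      moreover have "card A = card Al + card Ad"
        unfolding Al_def Ad_def by (rule card_split_vertex[OF finA])
      moreover have "card {S\<in>D. card S = r \<and> 0 \<in> S} =
          card {S\<in>Dl. card S = r - 1 \<and> 0 \<in> S} + card {S\<in>Dd. card S = r \<and> 0 \<in> S}"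
      proof -
        have "{S. m \<notin> S \<and> insert m S \<in> {S\<in>D. card S = r \<and> 0 \<in> S}} = {S\<in>Dl. card S = r - 1 \<and> 0 \<in> S}"
          (is "?W = ?Y")
        proof (rule Set.set_eqI)
          fix S
          show "S \<in> ?W \<longleftrightarrow> S \<in> ?Y"
          proof (cases "m \<notin> S \<and> insert m S \<in> D")
            case True
            then have "finite S" using fin by force
            then have "card (insert m S) = Suc (card S)" using True by simp
            then show ?thesis using True m(2) r by (auto simp: Dl_def)
          next
            case False then show ?thesis by (auto simp: Dl_def)
          qed
        qed
        moreover have "{S\<in>{S\<in>D. card S = r \<and> 0 \<in> S}. m \<notin> S} = {S\<in>Dd. card S = r \<and> 0 \<in> S}"
          by (auto simp: Dd_def)
        ultimately show ?thesis
          using card_split_vertex[of "{S\<in>D. card S = r \<and> 0 \<in> S}" m] finD by simp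
      qed
      ultimately show ?thesis by linarith
    qed
  qed
qed

subsection \<open>Linear algebra\<close>

context vector_space
begin

lemma functionals: "vector_space_pair scale ((*) :: 'a \<Rightarrow> 'a \<Rightarrow> 'a)"
  by unfold_locales (auto simp: algebra_simps)

lemma endomorphisms: "vector_space_pair scale scale"
  by unfold_locales

lemma separating_functional:
  assumes "subspace S" "y \<notin> S"
  shows "\<exists>\<phi>. Vector_Spaces.linear scale (*) \<phi> \<and> (\<forall>x\<in>S. \<phi> x = 0) \<and> \<phi> y = 1"
proof -
  interpret p: vector_space_pair scale "(*) :: 'a \<Rightarrow> 'a \<Rightarrow> 'a" by (rule functionals)
  obtain B where B: "B \<subseteq> S" "independent B" "S \<subseteq> span B" using basis_exists[of S] by metis
  have "span B \<subseteq> S" using B assms(1) by (simp add: span_minimal)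
  then have "independent (insert y B)" using B assms(2) by (intro independent_insertI) auto
  then obtain \<phi> where \<phi>: "Vector_Spaces.linear scale (*) \<phi>"
    "\<forall>x\<in>insert y B. \<phi> x = (if x = y then 1 else 0)"
    using p.linear_independent_extend[of "insert y B" "\<lambda>x. if x = y then 1 else 0"] by blast
  have yB: "y \<notin> B" using B assms by auto
  show ?thesis
  proof (intro exI[of _ \<phi>] conjI ballI)
    show "Vector_Spaces.linear scale (*) \<phi>" by fact
    show "\<phi> y = 1" using \<phi> by simp
    fix x assume "x \<in> S"
    then have "x \<in> span B" using B by auto
    then show "\<phi> x = 0"
      by (rule p.linear_eq_0_on_span[OF \<phi>(1), rotated]) (use \<phi>(2) yB in auto)
  qed
qed

text \<open>Compose \<open>r\<close> with a linear right inverse \<open>g\<close> of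
  \<open>f\<close> on the image of \<open>V\<close>: the error \<open>g (f y) - y\<close> lies in
  the kernel, where \<open>r\<close> vanishes. In the pencil argument this propagates
  functionals.\<close>

lemma functional_factors:
  assumes f: "Vector_Spaces.linear scale scale f" and V: "subspace V"
    and r: "Vector_Spaces.linear scale (*) r" and 0: "\<And>y. y \<in> V \<Longrightarrow> f y = 0 \<Longrightarrow> r y = 0"
  shows "\<exists>r'. Vector_Spaces.linear scale (*) r' \<and> (\<forall>y\<in>V. r' (f y) = r y)"
proof -
  interpret p: vector_space_pair scale scale by (rule endomorphisms)
  interpret f: Vector_Spaces.linear scale scale f by fact
  interpret r: Vector_Spaces.linear scale "(*)" r by fact
  obtain g where g: "range g \<subseteq> V" "Vector_Spaces.linear scale scale g" "\<forall>v\<in>f ` V. f (g v) = v"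
    using p.linear_exists_right_inverse_on[OF f V] by blast
  show ?thesis
  proof (intro exI[of _ "r \<circ> g"] conjI ballI)
    show "Vector_Spaces.linear scale (*) (r \<circ> g)"
      using g(2) r by (rule Vector_Spaces.linear_compose)
    fix y assume y: "y \<in> V"
    have "g (f y) - y \<in> V" using g(1) y V by (intro subspace_diff) auto
    moreover have "f (g (f y) - y) = 0" using g(3) y by (simp add: f.diff)
    ultimately have "r (g (f y) - y) = 0" by (rule 0)
    then show "(r \<circ> g) (f y) = r y" by (simp add: r.diff)
  qed
qed

text \<open>The vertex type may be infinite, so the ambient function space need not have finite
  dimension. Dimension facts are therefore stated relative to a finite spanning set
  \<open>B\<close>.\<close>

lemma finite_basis:
  assumes "V \<subseteq> span B" "finite B"
  obtains C where "C \<subseteq> V" "independent C" "V \<subseteq> span C" "finite C" "card C = dim V"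
proof -
  obtain C where C: "C \<subseteq> V" "independent C" "V \<subseteq> span C" "card C = dim V"
    using basis_exists[of V] by metis
  moreover have "finite C" using independent_span_bound[OF assms(2) C(2)] C(1) assms(1) by auto
  ultimately show ?thesis using that by blast
qed

lemma card_le_dim:
  assumes "V \<subseteq> span B" "finite B" "A \<subseteq> V" "independent A"
  shows "card A \<le> dim V"
  using finite_basis[OF assms(1,2)] independent_span_bound[of _ A] assms(3,4) by (metis subset_trans)

lemma dim_mono_fin:
  assumes "V \<subseteq> span B" "finite B" "U \<subseteq> V"
  shows "dim U \<le> dim V"
  using basis_exists[of U] card_le_dim[OF assms(1,2)] assms(3) by (metis subset_trans)

lemma dim_eq_0_fin:
  assumes "V \<subseteq> span B" "finite B" "dim V = 0"
  shows "V \<subseteq> {0}"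
proof -
  obtain C where "V \<subseteq> span C" "finite C" "card C = dim V"
    by (rule finite_basis[OF assms(1,2)])
  then show ?thesis using assms(3) by auto
qed

lemma rank_nullity:
  assumes f: "Vector_Spaces.linear scale scale f" and V: "subspace V" "V \<subseteq> span B" "finite B"
  shows "dim V = dim (f ` V) + dim (V \<inter> {x. f x = 0})"
proof -
  interpret p: vector_space_pair scale scale by (rule endomorphisms)
  interpret f: Vector_Spaces.linear scale scale f by fact
  let ?K = "V \<inter> {x. f x = 0}"
  obtain C where C: "C \<subseteq> ?K" "independent C" "?K \<subseteq> span C" "card C = dim ?K"
    using basis_exists[of ?K] by metis
  obtain D where D: "C \<subseteq> D" "D \<subseteq> V" "independent D" "V \<subseteq> span D"
    using maximal_independent_subset_extend[of C V] C by blast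
  have finD: "finite D" using independent_span_bound[OF V(3) D(3)] D(2) V(2) by auto
  have dV: "dim V = card D" using dim_unique[OF D(2,4,3)] by simp
  \<comment> \<open>\<open>q\<close> projects onto the span of \<open>C\<close> along
    \<open>D - C\<close>; a vector in both spans is fixed and killed by it, hence zero. This makes
    \<open>f\<close> injective on the complement of its kernel.\<close>
  obtain q where q: "Vector_Spaces.linear scale scale q" "\<forall>x\<in>D. q x = (if x \<in> C then x else 0)"
    using p.linear_independent_extend[OF D(3), of "\<lambda>x. if x \<in> C then x else 0"] by blast
  interpret q: Vector_Spaces.linear scale scale q by fact
  have spV: "span (D - C) \<subseteq> V" using D(2) V(1) by (intro span_minimal) auto
  have inj: "inj_on f (span (D - C))"
  proof (subst p.linear_inj_on_iff_eq_0[OF f subspace_span], intro ballI impI)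
    fix x assume x: "x \<in> span (D - C)" "f x = 0"
    have "q x = 0" by (rule p.linear_eq_0_on_span[OF q(1) _ x(1)]) (use q(2) in auto)
    moreover have xC: "x \<in> span C" using x spV C(3) by auto
    have "q x = id x"
      by (rule p.linear_eq_on[OF q(1) linear_id xC]) (use q(2) D(1) in auto)
    ultimately show "x = 0" by simp
  qed
  have ind: "independent (f ` (D - C))"
    by (rule p.linear_independent_injective_image[OF f independent_mono[OF D(3)] inj]) auto
  have "f ` V \<subseteq> span (f ` (D - C))"
  proof -
    have "f ` V \<subseteq> f ` span D" using D(4) by auto
    also have "\<dots> = span (f ` D)" by (simp add: f.span_image)
    also have "\<dots> \<subseteq> span (f ` (D - C))"
    proof (rule span_minimal)
      show "f ` D \<subseteq> span (f ` (D - C))"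
      proof
        fix z assume "z \<in> f ` D"
        then obtain x where x: "x \<in> D" "z = f x" by auto
        show "z \<in> span (f ` (D - C))"
        proof (cases "x \<in> C")
          case True
          then have "z = 0" using x C(1) by auto
          then show ?thesis by (simp add: span_zero)
        next
          case False then show ?thesis using x by (auto intro: span_base)
        qed
      qed
    qed simp
    finally show ?thesis .
  qed
  then have "dim (f ` V) = card (f ` (D - C))"
    by (rule dim_unique[OF _ _ ind refl, rotated]) (use D(2) in auto)
  also have "\<dots> = card (D - C)"
    by (rule card_image) (rule inj_on_subset[OF inj], auto intro: span_base)
  also have "\<dots> = card D - card C" using D(1) finD by (meson card_Diff_subset finite_subset)
  finally show ?thesis using dV C(4) D(1) finD card_mono[OF finD D(1)] by simp
qed

text \<open>Eigenvectors for distinct eigenvalues are independent, so at most \<open>card B\<close>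
  eigenvalues have an eigenvector in \<open>V\<close>. The operator may lead out of
  \<open>V\<close>, as it does in \<open>independent_perturbation\<close>.\<close>

lemma finite_eigenvalues:
  assumes T: "Vector_Spaces.linear scale scale T" and V: "V \<subseteq> span B" "finite B"
  shows "finite {l. \<exists>x\<in>V. x \<noteq> 0 \<and> T x = scale l x}" (is "finite ?L")
proof -
  interpret T: Vector_Spaces.linear scale scale T by fact
  obtain x where x: "\<And>l. l \<in> ?L \<Longrightarrow> x l \<in> V \<and> x l \<noteq> 0 \<and> T (x l) = scale l (x l)"
    using bchoice[of ?L "\<lambda>l x. x \<in> V \<and> x \<noteq> 0 \<and> T x = scale l x"] by auto
  have zero: "\<forall>l\<in>L. c l = 0"
    if "finite L" "L \<subseteq> ?L" "(\<Sum>l\<in>L. scale (c l) (x l)) = 0" for L c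
    using that
  proof (induction L arbitrary: c)
    case (insert m L)
    have s: "scale (c m) (x m) + (\<Sum>l\<in>L. scale (c l) (x l)) = 0"
      using insert by simp
    have "T (scale (c m) (x m) + (\<Sum>l\<in>L. scale (c l) (x l))) = 0" using s by simp
    then have "scale (c m) (scale m (x m)) + (\<Sum>l\<in>L. scale (c l) (scale l (x l))) = 0"
      using x insert.prems(1) by (simp add: T.add T.scale T.sum subset_iff)
    moreover have "scale m (scale (c m) (x m) + (\<Sum>l\<in>L. scale (c l) (x l))) = 0" using s by simp
    \<comment> \<open>Applying \<open>T\<close> to the relation and subtracting \<open>m\<close>
      times the relation removes the term of \<open>m\<close>.\<close>
    ultimately have "(\<Sum>l\<in>L. scale (c l) (scale l (x l))) - scale m (\<Sum>l\<in>L. scale (c l) (x l)) = 0"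
      by (simp add: scale_right_distrib mult.commute[of m] eq_neg_iff_add_eq_0[symmetric])
    then have "(\<Sum>l\<in>L. scale (c l * (l - m)) (x l)) = 0"
      by (simp add: scale_sum_right sum_subtractf[symmetric] algebra_simps)
    then have "\<forall>l\<in>L. c l * (l - m) = 0"
      using insert.IH[of "\<lambda>l. c l * (l - m)"] insert.prems(1) by simp
    then have "\<forall>l\<in>L. c l = 0" using insert.hyps by auto
    moreover from this have "c m = 0" using s x insert.prems(1) by simp
    ultimately show ?case by simp
  qed simp
  have inj: "inj_on x ?L"
  proof (rule inj_onI)
    fix l m assume lm: "l \<in> ?L" "m \<in> ?L" "x l = x m"
    have "scale l (x l) = scale m (x l)" using x[OF lm(1)] x[OF lm(2)] lm(3) by metis
    moreover have "x l \<noteq> 0" using x[OF lm(1)] by blast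
    ultimately show "l = m" using scale_cancel_right[of l "x l" m] by blast
  qed
  have bound: "card L \<le> card B" if L: "finite L" "L \<subseteq> ?L" for L
  proof -
    have injL: "inj_on x L" using inj L(2) by (rule inj_on_subset)
    have "independent (x ` L)"
    proof (rule independent_if_scalars_zero)
      fix f v assume "(\<Sum>v\<in>x ` L. scale (f v) v) = 0" "v \<in> x ` L"
      then show "f v = 0" using zero[OF L, of "f \<circ> x"] by (auto simp: sum.reindex[OF injL])
    qed (use L in simp)
    moreover have "x ` L \<subseteq> span B"
    proof
      fix z assume "z \<in> x ` L"
      then obtain l where l: "l \<in> L" "z = x l" by blast
      show "z \<in> span B" using x[of l] l L(2) V(1) by blast
    qed
    ultimately have "card (x ` L) \<le> card B" using independent_span_bound[OF V(2)] by blast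
    then show ?thesis using card_image[OF injL] by simp
  qed
  show ?thesis
  proof (rule ccontr)
    assume inf: "infinite ?L"
    from infinite_arbitrarily_large[OF inf, of "Suc (card B)"]
    obtain L where L: "finite L" "card L = Suc (card B)" "L \<subseteq> ?L"
      by (elim exE conjE)
    then show False using bound[OF L(1,3)] by simp
  qed
qed

text \<open>If \<open>T\<close> extends \<open>b\<close>, a dependency among the vectors \<open>a + t b(a)\<close> makes \<open>-1/t\<close>
  an eigenvalue of \<open>T\<close>.\<close>

lemma independent_perturbation:
  assumes "independent A" "finite A"
  shows "\<exists>E. finite E \<and> (\<forall>t. t \<notin> E \<longrightarrow>
    independent ((\<lambda>a. a + scale t (b a)) ` A) \<and> card ((\<lambda>a. a + scale t (b a)) ` A) = card A)"
proof -
  interpret p: vector_space_pair scale scale by (rule endomorphisms)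
  obtain T where T: "Vector_Spaces.linear scale scale T" "\<forall>a\<in>A. T a = b a"
    using p.linear_independent_extend[OF assms(1)] by blast
  interpret T: Vector_Spaces.linear scale scale T by fact
  define E where "E = (\<lambda>l. - (1 / l)) ` {l. \<exists>x\<in>span A. x \<noteq> 0 \<and> T x = scale l x}"
  have "finite E" unfolding E_def by (intro finite_imageI finite_eigenvalues[OF T(1) _ assms(2)]) auto
  moreover have "independent ((\<lambda>a. a + scale t (b a)) ` A) \<and> card ((\<lambda>a. a + scale t (b a)) ` A) = card A"
    if t: "t \<notin> E" for t
  proof -
    define g where "g x = x + scale t (T x)" for x
    have g: "Vector_Spaces.linear scale scale g"
      unfolding g_def by unfold_locales (auto simp: T.add T.scale algebra_simps mult.commute)
    have inj: "inj_on g (span A)"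
    proof (subst p.linear_inj_on_iff_eq_0[OF g subspace_span], intro ballI impI)
      fix x assume x: "x \<in> span A" "g x = 0"
      show "x = 0"
      proof (rule ccontr)
        assume "x \<noteq> 0"
        then have "t \<noteq> 0" using x by (auto simp: g_def)
        have "scale t (T x) = - x" using x(2) by (simp add: g_def eq_neg_iff_add_eq_0 add.commute)
        then have "scale (1 / t) (scale t (T x)) = scale (1 / t) (- x)" by simp
        then have "T x = scale (- (1 / t)) x" using \<open>t \<noteq> 0\<close> by simp
        then have "- (1 / t) \<in> {l. \<exists>x\<in>span A. x \<noteq> 0 \<and> T x = scale l x}" using x(1) \<open>x \<noteq> 0\<close> by auto
        then have "- (1 / - (1 / t)) \<in> E" unfolding E_def by (rule imageI)
        then show False using t by simp
      qed
    qed
    have "(\<lambda>a. a + scale t (b a)) ` A = g ` A" using T(2) by (auto simp: g_def)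
    moreover have "inj_on g A" using inj by (rule inj_on_subset) (auto intro: span_base)
    ultimately show ?thesis
      using p.linear_independent_injective_image[OF g assms(1) inj] card_image by metis
  qed
  ultimately show ?thesis by blast
qed

text \<open>A parameter \<open>\<xi>\<close> maximising the total rank on \<open>\<V>\<close> has this infinitesimal property: a vector \<open>y\<close>
  violating it would increase the rank of \<open>\<iota> (\<xi> + t \<eta>)\<close> for almost all \<open>t\<close>.\<close>

lemma generic_parameter:
  fixes \<iota> :: "('v \<Rightarrow> 'a) \<Rightarrow> 'b \<Rightarrow> 'b"
  assumes lin: "\<And>\<xi>. Vector_Spaces.linear scale scale (\<iota> \<xi>)"
    and add: "\<And>\<xi> \<eta> t x. \<iota> (\<lambda>v. \<xi> v + t * \<eta> v) x = \<iota> \<xi> x + scale t (\<iota> \<eta> x)"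
    and fin: "finite \<V>" and sub: "\<And>V. V \<in> \<V> \<Longrightarrow> subspace V"
    and fd: "\<And>V. V \<in> \<V> \<Longrightarrow> V \<subseteq> span B" and finB: "finite B" and inf: "infinite (UNIV :: 'a set)"
  shows "\<exists>\<xi>. \<forall>V\<in>\<V>. \<forall>\<eta>. \<forall>y\<in>V. \<iota> \<xi> y = 0 \<longrightarrow> \<iota> \<eta> y \<in> \<iota> \<xi> ` V"
proof -
  interpret p: vector_space_pair scale scale by (rule endomorphisms)
  have span_img: "\<iota> \<xi> ` V \<subseteq> span (\<iota> \<xi> ` B)" if "V \<in> \<V>" for \<xi> V
    using fd[OF that] p.linear_span_image[OF lin, of \<xi> B] by auto
  have sub_img: "subspace (\<iota> \<xi> ` V)" if "V \<in> \<V>" for \<xi> V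
    by (rule p.linear_subspace_image[OF lin sub[OF that]])
  define \<rho> where "\<rho> \<xi> = (\<Sum>V\<in>\<V>. dim (\<iota> \<xi> ` V))" for \<xi>
  have "\<rho> \<xi> \<le> (\<Sum>V\<in>\<V>. dim V)" for \<xi>
    unfolding \<rho>_def
  proof (rule sum_mono)
    fix V assume V: "V \<in> \<V>"
    show "dim (\<iota> \<xi> ` V) \<le> dim V" using rank_nullity[OF lin[of \<xi>] sub[OF V] fd[OF V] finB] by simp
  qed
  then have "\<exists>\<xi>. \<forall>\<eta>. \<rho> \<eta> \<le> \<rho> \<xi>"
    using ex_has_greatest_nat[of "\<lambda>_. True" _ \<rho> "Suc (\<Sum>V\<in>\<V>. dim V)"] by (auto simp: less_Suc_eq_le)
  then obtain \<xi> where max: "\<And>\<eta>. \<rho> \<eta> \<le> \<rho> \<xi>" by blast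
  \<comment> \<open>Lift a basis of the image under \<open>\<iota> \<xi>\<close> to
    \<open>V\<close>. The perturbed parameter sends the lifts to perturbed basis vectors, which stay
    independent for almost all \<open>t\<close>.\<close>
  have le: "\<exists>E. finite E \<and> (\<forall>t. t \<notin> E \<longrightarrow> dim (\<iota> \<xi> ` V) \<le> dim (\<iota> (\<lambda>v. \<xi> v + t * \<eta> v) ` V))"
    if V: "V \<in> \<V>" for V \<eta>
  proof -
    obtain A where A: "A \<subseteq> \<iota> \<xi> ` V" "independent A" "finite A" "card A = dim (\<iota> \<xi> ` V)"
      using finite_basis[OF span_img[OF V]] finB by (metis finite_imageI)
    obtain g where g: "\<And>a. a \<in> A \<Longrightarrow> g a \<in> V \<and> \<iota> \<xi> (g a) = a"
      using A(1) by (metis (mono_tags, lifting) f_inv_into_f inv_into_into subsetD)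
    obtain E where E: "finite E" "\<And>t. t \<notin> E \<Longrightarrow> independent ((\<lambda>a. a + scale t (\<iota> \<eta> (g a))) ` A) \<and>
        card ((\<lambda>a. a + scale t (\<iota> \<eta> (g a))) ` A) = card A"
      using independent_perturbation[OF A(2,3), of "\<lambda>a. \<iota> \<eta> (g a)"] by blast
    have "dim (\<iota> \<xi> ` V) \<le> dim (\<iota> (\<lambda>v. \<xi> v + t * \<eta> v) ` V)" if "t \<notin> E" for t
    proof -
      have "(\<lambda>a. a + scale t (\<iota> \<eta> (g a))) ` A \<subseteq> \<iota> (\<lambda>v. \<xi> v + t * \<eta> v) ` V"
        using g by (force simp: add)
      then show ?thesis
        using card_le_dim[OF span_img[OF V] finite_imageI[OF finB]] E(2)[OF that] A(4) by metis
    qed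
    then show ?thesis using E(1) by blast
  qed
  have less: "\<exists>E. finite E \<and> (\<forall>t. t \<notin> E \<longrightarrow> dim (\<iota> \<xi> ` V) < dim (\<iota> (\<lambda>v. \<xi> v + t * \<eta> v) ` V))"
    if V: "V \<in> \<V>" and y: "y \<in> V" "\<iota> \<xi> y = 0" "\<iota> \<eta> y \<notin> \<iota> \<xi> ` V" for V \<eta> y
  proof -
    obtain A where A: "A \<subseteq> \<iota> \<xi> ` V" "independent A" "finite A" "card A = dim (\<iota> \<xi> ` V)"
      using finite_basis[OF span_img[OF V]] finB by (metis finite_imageI)
    obtain g where g: "\<And>a. a \<in> A \<Longrightarrow> g a \<in> V \<and> \<iota> \<xi> (g a) = a"
      using A(1) by (metis (mono_tags, lifting) f_inv_into_f inv_into_into subsetD)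
    let ?z = "\<iota> \<eta> y"
    have zA: "?z \<notin> A" using A(1) y(3) by auto
    have "?z \<notin> span A" using span_minimal[OF A(1) sub_img[OF V]] y(3) by auto
    then have ind: "independent (insert ?z A)" using A(2) by (rule independent_insertI)
    \<comment> \<open>The additional vector \<open>?z\<close> needs no perturbation: since
      \<open>\<iota> \<xi> y = 0\<close>, the parameter \<open>\<xi> + t \<eta>\<close> sends
      \<open>y / t\<close> exactly to \<open>?z\<close>.\<close>
    define b where "b a = (if a = ?z then 0 else \<iota> \<eta> (g a))" for a
    obtain E where E: "finite E" "\<And>t. t \<notin> E \<Longrightarrow> independent ((\<lambda>a. a + scale t (b a)) ` insert ?z A) \<and>
        card ((\<lambda>a. a + scale t (b a)) ` insert ?z A) = card (insert ?z A)"
      using independent_perturbation[OF ind, of b] A(3) by auto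
    have "dim (\<iota> \<xi> ` V) < dim (\<iota> (\<lambda>v. \<xi> v + t * \<eta> v) ` V)" if t: "t \<notin> insert 0 E" for t
    proof -
      have "?z = \<iota> (\<lambda>v. \<xi> v + t * \<eta> v) (scale (1 / t) y)"
        using t y(2) p.linear_scale[OF lin] by (simp add: add)
      moreover have "scale (1 / t) y \<in> V" using y(1) sub[OF V] by (rule subspace_scale[rotated])
      ultimately have "(\<lambda>a. a + scale t (b a)) ` insert ?z A \<subseteq> \<iota> (\<lambda>v. \<xi> v + t * \<eta> v) ` V"
        using g zA by (force simp: add b_def)
      then have "card ((\<lambda>a. a + scale t (b a)) ` insert ?z A) \<le> dim (\<iota> (\<lambda>v. \<xi> v + t * \<eta> v) ` V)"
        by (rule card_le_dim[OF span_img[OF V] finite_imageI[OF finB]]) (use E(2) t in blast)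
      then have "card (insert ?z A) \<le> dim (\<iota> (\<lambda>v. \<xi> v + t * \<eta> v) ` V)"
        using E(2)[of t] t by auto
      then show ?thesis using zA A(3,4) by simp
    qed
    then show ?thesis using E(1) by (intro exI[of _ "insert 0 E"]) simp
  qed
  show ?thesis
  proof (rule ccontr)
    assume "\<not> ?thesis"
    then obtain V \<eta> y where V: "V \<in> \<V>" "y \<in> V" "\<iota> \<xi> y = 0" "\<iota> \<eta> y \<notin> \<iota> \<xi> ` V" by blast
    obtain E0 where E0: "finite E0"
      "\<And>t. t \<notin> E0 \<Longrightarrow> dim (\<iota> \<xi> ` V) < dim (\<iota> (\<lambda>v. \<xi> v + t * \<eta> v) ` V)"
      using less[OF V] by blast
    obtain E where E: "\<And>U. U \<in> \<V> \<Longrightarrow> finite (E U)"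
      "\<And>U t. U \<in> \<V> \<Longrightarrow> t \<notin> E U \<Longrightarrow> dim (\<iota> \<xi> ` U) \<le> dim (\<iota> (\<lambda>v. \<xi> v + t * \<eta> v) ` U)"
      using le[of _ \<eta>] by metis
    have "finite (E0 \<union> (\<Union>U\<in>\<V>. E U))" using E0 E fin by auto
    then obtain t where t: "t \<notin> E0 \<union> (\<Union>U\<in>\<V>. E U)" using ex_new_if_finite[OF inf] by blast
    have "\<rho> \<xi> < \<rho> (\<lambda>v. \<xi> v + t * \<eta> v)"
      unfolding \<rho>_def
    proof (rule sum_strict_mono_ex1[OF fin])
      show "\<forall>U\<in>\<V>. dim (\<iota> \<xi> ` U) \<le> dim (\<iota> (\<lambda>v. \<xi> v + t * \<eta> v) ` U)" using E(2) t by blast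
      show "\<exists>U\<in>\<V>. dim (\<iota> \<xi> ` U) < dim (\<iota> (\<lambda>v. \<xi> v + t * \<eta> v) ` U)" using E0(2) t V(1) by blast
    qed
    then show False using max[of "\<lambda>v. \<xi> v + t * \<eta> v"] by simp
  qed
qed

end

subsection \<open>Pencils of differentials\<close>

definition scl :: "'g::field \<Rightarrow> ('b \<Rightarrow> 'g) \<Rightarrow> 'b \<Rightarrow> 'g" where
  "scl c f = (\<lambda>x. c * f x)"

lemma scl_apply [simp]: "scl c f x = c * f x"
  by (simp add: scl_def)

interpretation fs: vector_space "scl :: 'g::field \<Rightarrow> ('b \<Rightarrow> 'g) \<Rightarrow> 'b \<Rightarrow> 'g"
  by unfold_locales (auto simp: fun_eq_iff algebra_simps)

lemma sum_fun_apply: "(\<Sum>i\<in>A. f i) x = (\<Sum>i\<in>A. f i x)"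
  by (induction A rule: infinite_finite_induct) auto

lemma finite_support_in_span:
  assumes "finite I" "\<And>x. x \<notin> I \<Longrightarrow> f x = 0"
  shows "f \<in> fs.span ((\<lambda>i. \<lambda>x. if x = i then 1 else 0) ` I)"
proof -
  have "f = (\<Sum>i\<in>I. scl (f i) (\<lambda>x. if x = i then 1 else 0))"
  proof
    fix x
    have "(\<Sum>i\<in>I. scl (f i) (\<lambda>x. if x = i then 1 else 0)) x = (\<Sum>i\<in>I. if x = i then f i else 0)"
      by (induction I rule: infinite_finite_induct) auto
    then show "f x = (\<Sum>i\<in>I. scl (f i) (\<lambda>x. if x = i then 1 else 0)) x"
      using assms by (simp add: sum.delta')
  qed
  also have "\<dots> \<in> fs.span ((\<lambda>i. \<lambda>x. if x = i then 1 else 0) ` I)"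
    by (intro fs.span_sum fs.span_scale fs.span_base) auto
  finally show ?thesis .
qed

text \<open>\<open>poly_act r p\<close> is \<open>p\<close> applied to the sequence \<open>r\<close>, with multiplication by the
  variable acting as the shift.\<close>

definition poly_act :: "(nat \<Rightarrow> 'y \<Rightarrow> 'g::field) \<Rightarrow> 'g poly \<Rightarrow> 'y \<Rightarrow> 'g" where
  "poly_act r p y = (\<Sum>j\<le>Polynomial.degree p. Polynomial.coeff p j * r j y)"

lemma poly_act_bound: "Polynomial.degree p \<le> m \<Longrightarrow> poly_act r p y = (\<Sum>j\<le>m. Polynomial.coeff p j * r j y)"
  unfolding poly_act_def by (rule sum.mono_neutral_left) (auto simp: coeff_eq_0)

lemma poly_act_root_factor:
  fixes q :: "'g::field poly"
  shows "poly_act r ([:- l, 1:] * q) y = poly_act (\<lambda>j. r (Suc j)) q y - l * poly_act r q y"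
proof -
  let ?m = "Suc (Polynomial.degree q)"
  have "Polynomial.degree ([:- l, 1:] * q) \<le> ?m" using degree_mult_le[of "[:- l, 1:]" q] by simp
  then have "poly_act r ([:- l, 1:] * q) y = (\<Sum>j\<le>?m. Polynomial.coeff ([:- l, 1:] * q) j * r j y)"
    by (rule poly_act_bound)
  also have "\<dots> = (\<Sum>j\<le>?m. Polynomial.coeff (pCons 0 q) j * r j y) - l * (\<Sum>j\<le>?m. Polynomial.coeff q j * r j y)"
    by (simp add: sum_distrib_left sum_subtractf[symmetric] algebra_simps del: sum.atMost_Suc)
  also have "(\<Sum>j\<le>?m. Polynomial.coeff q j * r j y) = poly_act r q y"
    by (rule poly_act_bound[symmetric]) simp
  also have "(\<Sum>j\<le>?m. Polynomial.coeff (pCons 0 q) j * r j y) = poly_act (\<lambda>j. r (Suc j)) q y"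
    by (simp add: poly_act_def sum.atMost_Suc_shift del: sum.atMost_Suc)
  finally show ?thesis .
qed

lemma poly_act_linear:
  assumes "\<And>j. Vector_Spaces.linear scl (*) (r j)"
  shows "Vector_Spaces.linear scl (*) (poly_act r p)"
proof -
  interpret vector_space_pair "scl :: 'a \<Rightarrow> ('b \<Rightarrow> 'a) \<Rightarrow> 'b \<Rightarrow> 'a" "(*)" by (rule fs.functionals)
  show ?thesis unfolding poly_act_def
    using linear_compose_sum[of "{..degree p}" "\<lambda>j y. Polynomial.coeff p j * r j y"]
      linear_compose_scale_right[OF assms] by simp
qed

text \<open>The restrictions to \<open>B\<close> of the functionals \<open>r 0\<close>, ...,
  \<open>r (card B)\<close> are one more than the dimension of the functions on \<open>B\<close>.
  The coefficients of a linear relation between them form the polynomial.\<close>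

lemma annihilating_polynomial:
  fixes r :: "nat \<Rightarrow> ('b \<Rightarrow> 'g::field) \<Rightarrow> 'g"
  assumes r: "\<And>j. Vector_Spaces.linear scl (*) (r j)" and H: "H \<subseteq> fs.span B" "finite B"
  shows "\<exists>p. p \<noteq> 0 \<and> (\<forall>y\<in>H. poly_act r p y = 0)"
proof -
  let ?m = "card B"
  define w where "w j = (\<lambda>b. if b \<in> B then r j b else 0)" for j
  have span: "w ` {..?m} \<subseteq> fs.span ((\<lambda>i. \<lambda>x. if x = i then 1 else 0) ` B)"
  proof
    fix v assume "v \<in> w ` {..?m}"
    then obtain j where "v = w j" by blast
    then show "v \<in> fs.span ((\<lambda>i. \<lambda>x. if x = i then 1 else 0) ` B)"
      using finite_support_in_span[OF H(2), of v] by (simp add: w_def)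
  qed
  obtain p where p: "p \<noteq> 0" "\<forall>b\<in>B. poly_act r p b = 0"
  \<comment> \<open>Linear dependence is a property of sets and does not see repetitions, so a
    coincidence \<open>w i = w j\<close> is treated apart, with the polynomial
    \<open>X^j - X^i\<close>.\<close>
  proof (cases "inj_on w {..?m}")
    case False
    then obtain i j where ij: "i \<le> ?m" "j \<le> ?m" "i < j" "w i = w j"
      by (metis (full_types) atMost_iff inj_onI linorder_neqE_nat)
    let ?p = "Polynomial.monom 1 j - Polynomial.monom (1::'g) i"
    have "Polynomial.coeff ?p j = 1" using ij by simp
    then have "?p \<noteq> 0" by (metis coeff_0 zero_neq_one)
    moreover have "poly_act r ?p b = 0" if "b \<in> B" for b
    proof -
      have "Polynomial.degree ?p \<le> ?m" using ij by (intro degree_diff_le) (auto intro: order_trans[OF degree_monom_le])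
      then have "poly_act r ?p b = (\<Sum>k\<le>?m. Polynomial.coeff ?p k * r k b)" by (rule poly_act_bound)
      also have "\<dots> = (\<Sum>k\<le>?m. (if k = j then r k b else 0) - (if k = i then r k b else 0))"
        by (rule sum.cong) auto
      also have "\<dots> = r j b - r i b" using ij by (simp add: sum_subtractf)
      also have "\<dots> = 0" using fun_cong[OF ij(4), of b] that by (simp add: w_def)
      finally show ?thesis .
    qed
    ultimately show ?thesis using that by blast
  next
    case True
    have "fs.dependent (w ` {..?m})"
    proof (rule ccontr)
      assume "\<not> fs.dependent (w ` {..?m})"
      then have "card (w ` {..?m}) \<le> card ((\<lambda>i. \<lambda>x. if x = i then 1 else 0 :: 'g) ` B)"
        using fs.independent_span_bound[OF _ _ span] H(2) by blast
      also have "\<dots> \<le> card B" using H(2) by (rule card_image_le)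
      finally show False using card_image[OF True] by simp
    qed
    then obtain u where u: "\<exists>v\<in>w ` {..?m}. u v \<noteq> 0" "(\<Sum>v\<in>w ` {..?m}. scl (u v) v) = 0"
      by (subst (asm) fs.dependent_finite) auto
    define p where "p = (\<Sum>j\<le>?m. Polynomial.monom (u (w j)) j)"
    have cp: "Polynomial.coeff p j = (if j \<le> ?m then u (w j) else 0)" for j
      by (simp add: p_def coeff_sum)
    have "p \<noteq> 0" using u(1) cp by (metis (no_types, lifting) atMost_iff coeff_0 imageE)
    moreover have "poly_act r p b = 0" if "b \<in> B" for b
    proof -
      have "Polynomial.degree p \<le> ?m" by (rule degree_le) (simp add: cp)
      then have "poly_act r p b = (\<Sum>k\<le>?m. Polynomial.coeff p k * r k b)" by (rule poly_act_bound)
      also have "\<dots> = (\<Sum>k\<le>?m. scl (u (w k)) (w k) b)" using that by (intro sum.cong) (auto simp: cp w_def)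
      also have "\<dots> = (\<Sum>v\<in>w ` {..?m}. scl (u v) v) b"
        by (subst sum.reindex[OF True]) (simp add: sum_fun_apply)
      also have "\<dots> = 0" using u(2) by simp
      finally show ?thesis .
    qed
    ultimately show ?thesis using that by blast
  qed
  interpret p: vector_space_pair "scl :: 'g \<Rightarrow> ('b \<Rightarrow> 'g) \<Rightarrow> 'b \<Rightarrow> 'g" "(*)" by (rule fs.functionals)
  have "poly_act r p y = 0" if "y \<in> H" for y
    by (rule p.linear_eq_0_on_span[OF poly_act_linear[OF r], of B]) (use p that H(1) in auto)
  then show ?thesis using p(1) by blast
qed

text \<open>The two-dimensional span of the anticommuting differentials \<open>a\<close> and \<open>b\<close> acts like a Kronecker
  pencil. A functional \<open>\<phi>\<close> vanishing on \<open>b a P\<close> is propagated to functionals \<open>r\<^sub>j\<close> with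
  \<open>r\<^sub>j\<^sub>+\<^sub>1 \<circ> a = r\<^sub>j \<circ> b\<close>; a polynomial relation of minimal degree among them on the joint kernel
  has a root \<open>l\<close>, and exactness of \<open>b - l a\<close> splits off the corresponding factor.\<close>

lemma pencil_exact:
  fixes a b :: "('b \<Rightarrow> 'g::alg_closed_field) \<Rightarrow> 'b \<Rightarrow> 'g"
  assumes a: "Vector_Spaces.linear scl scl a" and b: "Vector_Spaces.linear scl scl b"
    and sP: "fs.subspace P" and sQ: "fs.subspace Q" and sR: "fs.subspace R"
    and PQ: "a ` P \<subseteq> Q" "b ` P \<subseteq> Q" and QR: "a ` Q \<subseteq> R" "b ` Q \<subseteq> R"
    and aa: "\<And>x. a (a x) = 0" and bb: "\<And>x. b (b x) = 0" and ab: "\<And>x. a (b x) = - b (a x)"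
    and exa: "\<And>y. y \<in> Q \<Longrightarrow> a y = 0 \<Longrightarrow> y \<in> a ` P"
    and exb: "\<And>l y. y \<in> R \<Longrightarrow> b y - scl l (a y) = 0 \<Longrightarrow> \<exists>w\<in>Q. y = b w - scl l (a w)"
    and fin: "R \<subseteq> fs.span B" "finite B"
    and y: "y \<in> R" "a y = 0" "b y = 0"
  shows "\<exists>w\<in>P. y = b (a w)"
proof (rule ccontr)
  assume contra: "\<not> ?thesis"
  interpret p: vector_space_pair "scl :: 'g \<Rightarrow> ('b \<Rightarrow> 'g) \<Rightarrow> 'b \<Rightarrow> 'g" "scl :: 'g \<Rightarrow> ('b \<Rightarrow> 'g) \<Rightarrow> 'b \<Rightarrow> 'g"
    by (rule fs.endomorphisms)
  interpret a: Vector_Spaces.linear scl scl a by fact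
  interpret b: Vector_Spaces.linear scl scl b by fact
  have "fs.subspace (b ` a ` P)" by (intro p.linear_subspace_image a b sP)
  moreover have "y \<notin> b ` a ` P" using contra by auto
  ultimately obtain \<phi> where \<phi>: "Vector_Spaces.linear scl (*) \<phi>" "\<forall>x \<in> b ` a ` P. \<phi> x = 0" "\<phi> y = 1"
    using fs.separating_functional by metis
  \<comment> \<open>Vanishing on \<open>b (a P)\<close> is the invariant that lets the propagation
    continue: by exactness of \<open>a\<close>, it makes \<open>r \<circ> b\<close> vanish on the
    kernel of \<open>a\<close> in \<open>Q\<close>.\<close>
  define good where "good r \<longleftrightarrow> Vector_Spaces.linear scl (*) r \<and> (\<forall>w\<in>P. r (b (a w)) = 0)" for r
  have step: "\<exists>r'. good r' \<and> (\<forall>q\<in>Q. r' (a q) = r (b q))" if r: "good r" for r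
  proof -
    have lr: "Vector_Spaces.linear scl (*) r" using r by (simp add: good_def)
    interpret r: Vector_Spaces.linear scl "(*)" r by (rule lr)
    have "Vector_Spaces.linear scl (*) (r \<circ> b)" using b lr by (rule Vector_Spaces.linear_compose)
    moreover have "(r \<circ> b) q = 0" if "q \<in> Q" "a q = 0" for q
      using exa[OF that] r by (auto simp: good_def)
    ultimately have "\<exists>r'. Vector_Spaces.linear scl (*) r' \<and> (\<forall>q\<in>Q. r' (a q) = (r \<circ> b) q)"
      by (rule fs.functional_factors[OF a sQ])
    then obtain r' where r': "Vector_Spaces.linear scl (*) r'" "\<And>q. q \<in> Q \<Longrightarrow> r' (a q) = (r \<circ> b) q"
      by blast
    have "r' (b (a w)) = 0" if "w \<in> P" for w
    proof -
      have "b (a w) = a (- b w)" using ab[of w] by (simp add: a.neg)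
      moreover have "- b w \<in> Q" using PQ that sQ by (auto intro: fs.subspace_neg)
      ultimately have "r' (b (a w)) = r (b (- b w))" using r'(2) by simp
      also have "\<dots> = 0" using bb r.zero by (simp add: b.neg)
      finally show ?thesis .
    qed
    then show ?thesis using r' by (auto simp: good_def)
  qed
  have "\<exists>r. \<forall>n. good (r n) \<and> (\<forall>q\<in>Q. r (Suc n) (a q) = r n (b q)) \<and> (n = 0 \<longrightarrow> r n = \<phi>)"
  proof -
    define r where "r = rec_nat \<phi> (\<lambda>_ r. SOME r'. good r' \<and> (\<forall>q\<in>Q. r' (a q) = r (b q)))"
    have "good \<phi>" using \<phi> by (auto simp: good_def)
    have s: "good (r (Suc n)) \<and> (\<forall>q\<in>Q. r (Suc n) (a q) = r n (b q))" if "good (r n)" for n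
      using someI_ex[OF step[OF that]] by (simp add: r_def)
    have "good (r n)" for n
      by (induction n) (use \<open>good \<phi>\<close> s in \<open>auto simp: r_def\<close>)
    then show ?thesis using s by (intro exI[of _ r]) (auto simp: r_def)
  qed
  then obtain r where r: "\<And>n. good (r n)" "\<And>n q. q \<in> Q \<Longrightarrow> r (Suc n) (a q) = r n (b q)" "r 0 = \<phi>"
    by blast
  have lr: "Vector_Spaces.linear scl (*) (r n)" for n using r(1) by (simp add: good_def)
  define H where "H = {y \<in> R. a y = 0 \<and> b y = 0}"
  have HB: "H \<subseteq> fs.span B" using fin by (auto simp: H_def)
  obtain p0 where p0: "p0 \<noteq> 0 \<and> (\<forall>y\<in>H. poly_act r p0 y = 0)"
    using annihilating_polynomial[of r H B, OF lr HB fin(2)] by (elim exE)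
  obtain p where p: "p \<noteq> 0 \<and> (\<forall>y\<in>H. poly_act r p y = 0)"
    and min: "\<forall>q. q \<noteq> 0 \<and> (\<forall>y\<in>H. poly_act r q y = 0) \<longrightarrow> Polynomial.degree p \<le> Polynomial.degree q"
    using ex_has_least_nat[of "\<lambda>p. p \<noteq> 0 \<and> (\<forall>y\<in>H. poly_act r p y = 0)" p0 Polynomial.degree, OF p0] by metis
  have yH: "y \<in> H" using y by (simp add: H_def)
  show False
  proof (cases "Polynomial.degree p = 0")
    \<comment> \<open>A constant relation \<open>c\<close> would give
      \<open>c * \<phi> y = 0\<close>, although \<open>c\<close> is non-zero and
      \<open>\<phi> y = 1\<close>.\<close>
    case True
    then obtain c where c: "p = [:c:]" using degree_eq_zeroE by blast
    then show False using p yH r(3) \<phi>(3) by (auto simp: poly_act_def)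
  next
    case False
    then obtain l where "poly p l = 0" using alg_closed_imp_poly_has_root[of p] by auto
    then obtain q where q: "p = [:- l, 1:] * q" using poly_eq_0_iff_dvd[of p l] by (auto elim: dvdE)
    then have "q \<noteq> 0" using p by auto
    then have "Polynomial.degree q < Polynomial.degree p" using q degree_mult_eq[of "[:- l, 1:]" q] by simp
    moreover
    have "poly_act r q x = 0" if x: "x \<in> H" for x
    proof -
      have xR: "x \<in> R" "a x = 0" "b x = 0" using x by (auto simp: H_def)
      then obtain w where w: "w \<in> Q" "x = b w - scl l (a w)" using exb[of x l] by auto
      \<comment> \<open>Since \<open>a\<close> kills both \<open>x\<close> and \<open>a w\<close>,
        it kills \<open>b w\<close>; anticommutation then places \<open>a w\<close> in
        \<open>H\<close>, where the relation \<open>p\<close> may be evaluated.\<close>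
      have "b (a w) = 0"
      proof -
        have "b w = x + scl l (a w)" using w(2) by simp
        then have "a (b w) = 0" using xR aa by (simp add: a.add a.scale)
        then show ?thesis using ab[of w] neg_equal_0_iff_equal by metis
      qed
      then have "a w \<in> H" using QR w(1) aa by (auto simp: H_def)
      then have 0: "poly_act (\<lambda>j. r (Suc j)) q (a w) - l * poly_act r q (a w) = 0"
        using p unfolding q poly_act_root_factor by blast
      interpret pq: Vector_Spaces.linear scl "(*)" "poly_act r q" by (rule poly_act_linear[OF lr])
      \<comment> \<open>By \<open>r (Suc n) (a w) = r n (b w)\<close>, the value of \<open>q\<close>
        at \<open>x\<close> is the value of \<open>(X - l) * q = p\<close> at \<open>a w\<close>,
        that is, zero. So \<open>q\<close> is a relation of smaller degree.\<close>
      have "poly_act r q x = poly_act r q (b w) - l * poly_act r q (a w)"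
        unfolding w(2) by (simp add: pq.diff pq.scale)
      also have "poly_act r q (b w) = poly_act (\<lambda>j. r (Suc j)) q (a w)"
        unfolding poly_act_def using r(2)[OF w(1)] by simp
      finally show ?thesis using 0 by simp
    qed
    then have "\<forall>x\<in>H. poly_act r q x = 0" by (rule ballI)
    then have "Polynomial.degree p \<le> Polynomial.degree q" using \<open>q \<noteq> 0\<close> by (intro min[rule_format] conjI)
    ultimately show False by simp
  qed
qed

subsection \<open>Contractions of alternating chains\<close>

text \<open>Because of the intersection with the finite set \<open>W\<close>, inserting a vertex of
  \<open>W\<close> changes the exponent by at most one even for infinite \<open>\<tau>\<close>. The
  identities below thus hold for all functions and not just for chains.\<close>

definition inv_sign :: "'a set \<Rightarrow> 'a \<Rightarrow> 'a set \<Rightarrow> 'g::field" where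
  "inv_sign W v \<tau> = (-1) ^ card {u \<in> \<tau> \<inter> W. (u, v) \<in> vertex_order}"

text \<open>This is the interior product with the covector \<open>\<xi>\<close> on the exterior
  algebra over \<open>W\<close>. With all weights equal to 1 it is the simplicial boundary.\<close>

definition ctr :: "'a set \<Rightarrow> ('a \<Rightarrow> 'g::field) \<Rightarrow> ('a set \<Rightarrow> 'g) \<Rightarrow> 'a set \<Rightarrow> 'g" where
  "ctr W \<xi> y \<tau> = (\<Sum>v \<in> W - \<tau>. \<xi> v * inv_sign W v \<tau> * y (insert v \<tau>))"

lemma vertex_order_total: "u \<noteq> v \<Longrightarrow> (u, v) \<in> vertex_order \<longleftrightarrow> (v, u) \<notin> vertex_order"
  using linear_order_vertex_order
  by (auto simp: linear_order_on_def partial_order_on_def total_on_def antisym_def)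

lemma vertex_order_cases: "u \<noteq> v \<Longrightarrow> (u, v) \<in> vertex_order \<or> (v, u) \<in> vertex_order"
  using vertex_order_total by metis

lemma vertex_order_antisym: "(u, v) \<in> vertex_order \<Longrightarrow> (v, u) \<in> vertex_order \<Longrightarrow> u = v"
  using vertex_order_total by metis

lemma inv_sign_mult_self [simp]: "inv_sign W v \<tau> * inv_sign W v \<tau> = 1"
  by (simp add: inv_sign_def power_add[symmetric] mult_2[symmetric] power_mult)

lemma inv_sign_nonzero [simp]: "inv_sign W v \<tau> \<noteq> 0"
  by (simp add: inv_sign_def)

lemma inv_sign_insert:
  assumes "finite W" "u \<in> W" "u \<notin> \<tau>"
  shows "inv_sign W v (insert u \<tau>) = (if (u, v) \<in> vertex_order then - inv_sign W v \<tau> else inv_sign W v \<tau>)"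
proof -
  have "{w \<in> insert u \<tau> \<inter> W. (w, v) \<in> vertex_order} =
    (if (u, v) \<in> vertex_order then insert u {w \<in> \<tau> \<inter> W. (w, v) \<in> vertex_order}
     else {w \<in> \<tau> \<inter> W. (w, v) \<in> vertex_order})"
    using assms by auto
  then show ?thesis using assms by (simp add: inv_sign_def)
qed

lemma ctr_linear: "Vector_Spaces.linear scl scl (ctr W \<xi>)"
  by unfold_locales
    (auto simp: fun_eq_iff ctr_def algebra_simps sum.distrib sum_distrib_left)

lemma ctr_0 [simp]: "ctr W \<xi> 0 = 0"
  by (simp add: fun_eq_iff ctr_def)

lemma ctr_add: "ctr W \<xi> (y + z) = ctr W \<xi> y + ctr W \<xi> z"
  by (simp add: fun_eq_iff ctr_def algebra_simps sum.distrib)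

lemma ctr_diff: "ctr W \<xi> (y - z) = ctr W \<xi> y - ctr W \<xi> z"
  by (simp add: fun_eq_iff ctr_def algebra_simps sum_subtractf)

lemma ctr_minus: "ctr W \<xi> (- y) = - ctr W \<xi> y"
  by (simp add: fun_eq_iff ctr_def sum_negf)

lemma ctr_param_add: "ctr W (\<lambda>v. \<xi> v + t * \<eta> v) y = ctr W \<xi> y + scl t (ctr W \<eta> y)"
  by (simp add: fun_eq_iff ctr_def algebra_simps sum.distrib sum_distrib_left)

lemma ctr_param_sum: "ctr W (\<lambda>v. \<Sum>j\<in>J. c j * \<xi> j v) y = (\<Sum>j\<in>J. scl (c j) (ctr W (\<xi> j) y))"
  by (simp add: fun_eq_iff ctr_def sum_fun_apply sum_distrib_right sum_distrib_left mult.assoc)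
    (subst sum.swap, simp)

lemma ctr_param_cong: "(\<And>v. v \<in> W \<Longrightarrow> \<xi> v = \<eta> v) \<Longrightarrow> ctr W \<xi> y = ctr W \<eta> y"
  by (auto simp: fun_eq_iff ctr_def intro!: sum.cong)

definition ord_pairs :: "'a set \<Rightarrow> 'a set \<Rightarrow> ('a \<times> 'a) set" where
  "ord_pairs W \<tau> = {(v, w). v \<in> W - \<tau> \<and> w \<in> W - \<tau> \<and> v \<noteq> w}"

definition two_sign :: "'a set \<Rightarrow> 'a set \<Rightarrow> 'a \<Rightarrow> 'a \<Rightarrow> 'g::field" where
  "two_sign W \<tau> v w = inv_sign W v \<tau> * inv_sign W w (insert v \<tau>)"

lemma two_sign_swap:
  assumes "finite W" "(v, w) \<in> ord_pairs W \<tau>"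
  shows "two_sign W \<tau> w v = - two_sign W \<tau> v w"
  using assms vertex_order_total[of v w]
  by (auto simp: two_sign_def ord_pairs_def inv_sign_insert)

lemma ctr_ctr:
  assumes "finite W"
  shows "ctr W \<xi> (ctr W \<eta> y) \<tau> =
    (\<Sum>(v, w)\<in>ord_pairs W \<tau>. \<xi> v * \<eta> w * (two_sign W \<tau> v w * y (insert v (insert w \<tau>))))"
proof -
  have "ctr W \<xi> (ctr W \<eta> y) \<tau> = (\<Sum>v\<in>W - \<tau>. \<Sum>w\<in>W - insert v \<tau>.
      \<xi> v * \<eta> w * (two_sign W \<tau> v w * y (insert v (insert w \<tau>))))"
    by (simp add: ctr_def two_sign_def sum_distrib_left insert_commute mult_ac)
  also have "\<dots> = (\<Sum>(v, w)\<in>(SIGMA v:W - \<tau>. W - insert v \<tau>).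
      \<xi> v * \<eta> w * (two_sign W \<tau> v w * y (insert v (insert w \<tau>))))"
    using assms by (subst sum.Sigma) auto
  also have "(SIGMA v:W - \<tau>. W - insert v \<tau>) = ord_pairs W \<tau>"
    by (auto simp: ord_pairs_def)
  finally show ?thesis .
qed

lemma swap_ord_pairs: "bij_betw prod.swap (ord_pairs W \<tau>) (ord_pairs W \<tau>)"
  by (rule bij_betw_byWitness[where f'=prod.swap]) (auto simp: ord_pairs_def)

lemma ctr_anticommute:
  assumes "finite W"
  shows "ctr W \<xi> (ctr W \<eta> y) = - ctr W \<eta> (ctr W \<xi> y)"
proof
  fix \<tau>
  have "ctr W \<xi> (ctr W \<eta> y) \<tau> =
    (\<Sum>(v, w)\<in>ord_pairs W \<tau>. \<xi> w * \<eta> v * (two_sign W \<tau> w v * y (insert w (insert v \<tau>))))"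
    unfolding ctr_ctr[OF assms]
    by (subst sum.reindex_bij_betw[OF swap_ord_pairs, symmetric]) (simp add: case_prod_beta)
  also have "\<dots> = (\<Sum>(v, w)\<in>ord_pairs W \<tau>. - (\<eta> v * \<xi> w * (two_sign W \<tau> v w * y (insert v (insert w \<tau>)))))"
  proof (rule sum.cong[OF refl], clarify)
    fix v w assume "(v, w) \<in> ord_pairs W \<tau>"
    then show "\<xi> w * \<eta> v * (two_sign W \<tau> w v * y (insert w (insert v \<tau>))) =
        - (\<eta> v * \<xi> w * (two_sign W \<tau> v w * y (insert v (insert w \<tau>))))"
      using two_sign_swap[OF assms, of v w \<tau>, where 'b='b] by (simp add: insert_commute)
  qed
  also have "\<dots> = (- ctr W \<eta> (ctr W \<xi> y)) \<tau>"
    by (simp add: ctr_ctr[OF assms] sum_negf case_prod_beta)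
  finally show "ctr W \<xi> (ctr W \<eta> y) \<tau> = (- ctr W \<eta> (ctr W \<xi> y)) \<tau>" .
qed

text \<open>Anticommutation only shows that twice the square is zero, which says nothing in
  characteristic 2. The ordered pairs are therefore split by the vertex order and cancelled one
  against the other.\<close>

lemma ctr_square:
  assumes "finite W"
  shows "ctr W \<xi> (ctr W \<xi> y) = 0"
proof
  fix \<tau>
  let ?f = "\<lambda>(v, w). \<xi> v * \<xi> w * (two_sign W \<tau> v w * y (insert v (insert w \<tau>)))"
  let ?P = "{(v, w) \<in> ord_pairs W \<tau>. (v, w) \<in> vertex_order}"
  let ?Q = "{(v, w) \<in> ord_pairs W \<tau>. (w, v) \<in> vertex_order}"
  have fin: "finite (ord_pairs W \<tau>)"
    by (rule finite_subset[of _ "W \<times> W"]) (auto simp: ord_pairs_def assms)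
  have "ord_pairs W \<tau> = ?P \<union> ?Q" "?P \<inter> ?Q = {}"
    using vertex_order_cases vertex_order_antisym by (fastforce simp: ord_pairs_def)+
  then have "sum ?f (ord_pairs W \<tau>) = sum ?f ?P + sum ?f ?Q"
    using fin by (metis (no_types, lifting) finite_Un sum.union_disjoint)
  also have "sum ?f ?Q = (\<Sum>p\<in>?P. ?f (prod.swap p))"
    by (rule sum.reindex_bij_betw[symmetric], rule bij_betw_byWitness[where f'=prod.swap])
      (auto simp: ord_pairs_def)
  also have "\<dots> = (\<Sum>p\<in>?P. - ?f p)"
  proof (rule sum.cong[OF refl])
    fix p assume p: "p \<in> ?P"
    obtain v w where vw: "p = (v, w)" by (cases p)
    then have "(v, w) \<in> ord_pairs W \<tau>" using p by auto
    then show "?f (prod.swap p) = - ?f p" unfolding vw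
      using two_sign_swap[OF assms, of v w \<tau>, where 'b='b] by (simp add: insert_commute)
  qed
  also have "\<dots> = - sum ?f ?P" by (rule sum_negf)
  also have "sum ?f ?P + - sum ?f ?P = 0" by (rule right_minus)
  finally show "ctr W \<xi> (ctr W \<xi> y) \<tau> = 0 \<tau>" by (simp only: ctr_ctr[OF assms] zero_fun_apply)
qed

section \<open>Exterior products and the Leibniz rule\<close>

definition inversions :: "'a set \<Rightarrow> 'a set \<Rightarrow> 'a set \<Rightarrow> nat" where
  "inversions W \<sigma> \<tau> = card {(u, w). u \<in> \<sigma> \<inter> W \<and> w \<in> \<tau> \<inter> W \<and> (w, u) \<in> vertex_order}"

text \<open>The exterior product of functions on sets; the parity of \<open>inversions\<close> is
  the sign of the shuffle that sorts \<open>\<sigma>\<close> followed by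
  \<open>\<rho> - \<sigma>\<close>.\<close>

definition wdg :: "'a set \<Rightarrow> ('a set \<Rightarrow> 'g::field) \<Rightarrow> ('a set \<Rightarrow> 'g) \<Rightarrow> 'a set \<Rightarrow> 'g" where
  "wdg W y z \<rho> = (\<Sum>\<sigma>\<in>Pow \<rho>. (-1) ^ inversions W \<sigma> (\<rho> - \<sigma>) * y \<sigma> * z (\<rho> - \<sigma>))"

text \<open>The sign of the Leibniz rule, as an operator, so that the rule can be stated for
  inhomogeneous \<open>y\<close>.\<close>

definition grading :: "'a set \<Rightarrow> ('a set \<Rightarrow> 'g::field) \<Rightarrow> 'a set \<Rightarrow> 'g" where
  "grading W y \<sigma> = (-1) ^ card (\<sigma> \<inter> W) * y \<sigma>"

lemma inversions_insert_left:
  assumes "finite W" "v \<in> W" "v \<notin> \<sigma>"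
  shows "(-1 :: 'g::field) ^ inversions W (insert v \<sigma>) \<tau> = (-1) ^ inversions W \<sigma> \<tau> * inv_sign W v \<tau>"
proof -
  let ?I = "{(u, w). u \<in> \<sigma> \<inter> W \<and> w \<in> \<tau> \<inter> W \<and> (w, u) \<in> vertex_order}"
  have "{(u, w). u \<in> insert v \<sigma> \<inter> W \<and> w \<in> \<tau> \<inter> W \<and> (w, u) \<in> vertex_order} =
    ?I \<union> Pair v ` {u \<in> \<tau> \<inter> W. (u, v) \<in> vertex_order}"
    using assms by auto
  moreover have fin: "finite ?I"
    by (rule finite_subset[of _ "W \<times> W"]) (auto simp: assms)
  moreover have "card (Pair v ` {u \<in> \<tau> \<inter> W. (u, v) \<in> vertex_order}) = card {u \<in> \<tau> \<inter> W. (u, v) \<in> vertex_order}"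
    by (rule card_image) (simp add: inj_on_def)
  moreover have "card (?I \<union> Pair v ` {u \<in> \<tau> \<inter> W. (u, v) \<in> vertex_order}) =
      card ?I + card (Pair v ` {u \<in> \<tau> \<inter> W. (u, v) \<in> vertex_order})"
    by (rule card_Un_disjoint) (use fin assms in auto)
  ultimately have "inversions W (insert v \<sigma>) \<tau> =
      inversions W \<sigma> \<tau> + card {u \<in> \<tau> \<inter> W. (u, v) \<in> vertex_order}"
    by (simp add: inversions_def)
  then show ?thesis by (simp add: power_add inv_sign_def)
qed

text \<open>The new inversions come from the elements of \<open>\<sigma>\<close> above
  \<open>v\<close>, that is, from all of \<open>\<sigma> \<inter> W\<close> except those counted by
  \<open>inv_sign\<close>. Modulo 2 this difference is a sum, whence the second sign.\<close>

lemma inversions_insert_right: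
  assumes "finite W" "v \<in> W" "v \<notin> \<sigma>" "v \<notin> \<tau>"
  shows "(-1 :: 'g::field) ^ inversions W \<sigma> (insert v \<tau>) =
    (-1) ^ inversions W \<sigma> \<tau> * inv_sign W v \<sigma> * (-1) ^ card (\<sigma> \<inter> W)"
proof -
  let ?I = "{(u, w). u \<in> \<sigma> \<inter> W \<and> w \<in> \<tau> \<inter> W \<and> (w, u) \<in> vertex_order}"
  let ?A = "{u \<in> \<sigma> \<inter> W. (v, u) \<in> vertex_order}"
  let ?B = "{u \<in> \<sigma> \<inter> W. (u, v) \<in> vertex_order}"
  have "{(u, w). u \<in> \<sigma> \<inter> W \<and> w \<in> insert v \<tau> \<inter> W \<and> (w, u) \<in> vertex_order} =
    ?I \<union> (\<lambda>u. (u, v)) ` ?A"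
    using assms by auto
  moreover have fin: "finite ?I"
    by (rule finite_subset[of _ "W \<times> W"]) (auto simp: assms)
  moreover have "card ((\<lambda>u. (u, v)) ` ?A) = card ?A"
    by (rule card_image) (simp add: inj_on_def)
  moreover have "card (?I \<union> (\<lambda>u. (u, v)) ` ?A) = card ?I + card ((\<lambda>u. (u, v)) ` ?A)"
    by (rule card_Un_disjoint) (use fin assms in auto)
  ultimately have "inversions W \<sigma> (insert v \<tau>) = inversions W \<sigma> \<tau> + card ?A"
    by (simp add: inversions_def)
  moreover have "card (\<sigma> \<inter> W) = card ?A + card ?B"
  proof -
    have "\<sigma> \<inter> W = ?A \<union> ?B"
      using vertex_order_cases[of v] assms(3) by (auto; metis)
    moreover have "?A \<inter> ?B = {}" using vertex_order_antisym[of v] assms(3) by auto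
    ultimately show ?thesis using assms(1) by (metis (no_types, lifting) card_Un_disjoint finite_Int finite_Un)
  qed
  moreover have "(-1 :: 'g) ^ card ?B * (-1) ^ card ?B = 1"
    by (simp add: power_add[symmetric] mult_2[symmetric] power_mult)
  ultimately show ?thesis by (simp add: power_add inv_sign_def mult.assoc mult.left_commute)
qed

lemma inv_sign_Un:
  assumes "finite W" "\<sigma> \<inter> \<tau> = {}"
  shows "inv_sign W v (\<sigma> \<union> \<tau>) = inv_sign W v \<sigma> * inv_sign W v \<tau>"
proof -
  have "{u \<in> (\<sigma> \<union> \<tau>) \<inter> W. (u, v) \<in> vertex_order} =
      {u \<in> \<sigma> \<inter> W. (u, v) \<in> vertex_order} \<union> {u \<in> \<tau> \<inter> W. (u, v) \<in> vertex_order}" by auto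
  moreover have "card ({u \<in> \<sigma> \<inter> W. (u, v) \<in> vertex_order} \<union> {u \<in> \<tau> \<inter> W. (u, v) \<in> vertex_order}) =
      card {u \<in> \<sigma> \<inter> W. (u, v) \<in> vertex_order} + card {u \<in> \<tau> \<inter> W. (u, v) \<in> vertex_order}"
    by (rule card_Un_disjoint) (use assms in auto)
  ultimately show ?thesis by (simp add: inv_sign_def power_add)
qed

text \<open>The contributions of a vertex \<open>v\<close> of \<open>\<rho>\<close> to the two terms on the right cancel.\<close>

lemma ctr_wdg:
  fixes \<xi> :: "'a \<Rightarrow> 'g::field"
  assumes W: "finite W"
  shows "ctr W \<xi> (wdg W y z) = wdg W (ctr W \<xi> y) z + wdg W (grading W y) (ctr W \<xi> z)"
proof
  fix \<rho>
  show "ctr W \<xi> (wdg W y z) \<rho> = (wdg W (ctr W \<xi> y) z + wdg W (grading W y) (ctr W \<xi> z)) \<rho>"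
  proof (cases "finite \<rho>")
    \<comment> \<open>For infinite \<open>\<rho>\<close> the index set \<open>Pow \<rho>\<close> is
      infinite and every such sum is 0 by convention.\<close>
    case False
    then have "wdg W p q \<rho> = (0 :: 'g)" "wdg W p q (insert v \<rho>) = (0 :: 'g)" for p q and v :: 'a
      by (auto simp: wdg_def)
    then show ?thesis unfolding plus_fun_apply ctr_def[of W \<xi> "wdg W y z"] by simp
  next
    case fin: True
    define s :: "'a set \<Rightarrow> 'g" where "s \<sigma> = (-1) ^ inversions W \<sigma> (\<rho> - \<sigma>)" for \<sigma>
    define A where "A \<sigma> v = s \<sigma> * (\<xi> v * inv_sign W v \<sigma> * y (insert v \<sigma>)) * z (\<rho> - \<sigma>)" for \<sigma> v
    define C where "C \<sigma> v = s \<sigma> * ((-1) ^ card (\<sigma> \<inter> W) * y \<sigma>) *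
      (\<xi> v * inv_sign W v (\<rho> - \<sigma>) * z (insert v (\<rho> - \<sigma>)))" for \<sigma> v
    have L: "\<xi> v * inv_sign W v \<rho> * wdg W y z (insert v \<rho>) = (\<Sum>\<sigma>\<in>Pow \<rho>. A \<sigma> v + C \<sigma> v)"
      if v: "v \<in> W - \<rho>" for v
    proof -
      let ?t = "\<lambda>\<sigma>. \<xi> v * inv_sign W v \<rho> *
        ((-1) ^ inversions W \<sigma> (insert v \<rho> - \<sigma>) * y \<sigma> * z (insert v \<rho> - \<sigma>))"
      have "\<xi> v * inv_sign W v \<rho> * wdg W y z (insert v \<rho>) = sum ?t (Pow (insert v \<rho>))"
        by (simp add: wdg_def sum_distrib_left)
      also have "\<dots> = sum ?t (Pow \<rho>) + sum ?t (insert v ` Pow \<rho>)"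
        unfolding Pow_insert by (rule sum.union_disjoint) (use fin v in auto)
      also have "sum ?t (insert v ` Pow \<rho>) = (\<Sum>\<sigma>\<in>Pow \<rho>. ?t (insert v \<sigma>))"
        by (rule sum.reindex_cong[OF _ refl refl]) (use v in \<open>auto simp: inj_on_def\<close>)
      also have "\<dots> = (\<Sum>\<sigma>\<in>Pow \<rho>. A \<sigma> v)"
      proof (rule sum.cong[OF refl])
        fix \<sigma> assume "\<sigma> \<in> Pow \<rho>"
        then have \<sigma>: "\<sigma> \<subseteq> \<rho>" "v \<notin> \<sigma>" using v by auto
        have d: "insert v \<rho> - insert v \<sigma> = \<rho> - \<sigma>" using v by auto
        have "inv_sign W v \<rho> = (inv_sign W v \<sigma> * inv_sign W v (\<rho> - \<sigma>) :: 'g)"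
          using inv_sign_Un[OF W, of \<sigma> "\<rho> - \<sigma>" v] \<sigma> by (simp add: Un_absorb1)
        then have "?t (insert v \<sigma>) = (inv_sign W v (\<rho> - \<sigma>) * inv_sign W v (\<rho> - \<sigma>)) * A \<sigma> v"
          unfolding d A_def s_def using inversions_insert_left[OF W _ \<sigma>(2), of "\<rho> - \<sigma>", where 'g='g] v
          by (simp add: mult_ac del: inv_sign_mult_self)
        then show "?t (insert v \<sigma>) = A \<sigma> v" by simp
      qed
      also have "sum ?t (Pow \<rho>) = (\<Sum>\<sigma>\<in>Pow \<rho>. C \<sigma> v)"
      proof (rule sum.cong[OF refl])
        fix \<sigma> assume "\<sigma> \<in> Pow \<rho>"
        then have \<sigma>: "\<sigma> \<subseteq> \<rho>" "v \<notin> \<sigma>" "v \<notin> \<rho> - \<sigma>" using v by auto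
        have d: "insert v \<rho> - \<sigma> = insert v (\<rho> - \<sigma>)" using \<sigma> by auto
        have "inv_sign W v \<rho> = (inv_sign W v \<sigma> * inv_sign W v (\<rho> - \<sigma>) :: 'g)"
          using inv_sign_Un[OF W, of \<sigma> "\<rho> - \<sigma>" v] \<sigma> by (simp add: Un_absorb1)
        then have "?t \<sigma> = (inv_sign W v \<sigma> * inv_sign W v \<sigma>) * C \<sigma> v"
          unfolding d C_def s_def using inversions_insert_right[OF W _ \<sigma>(2,3), where 'g='g] v
          by (simp add: mult_ac del: inv_sign_mult_self)
        then show "?t \<sigma> = C \<sigma> v" by simp
      qed
      finally show ?thesis by (simp add: sum.distrib add.commute)
    qed
    have "ctr W \<xi> (wdg W y z) \<rho> = (\<Sum>v\<in>W - \<rho>. \<Sum>\<sigma>\<in>Pow \<rho>. A \<sigma> v + C \<sigma> v)"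
      unfolding ctr_def by (rule sum.cong[OF refl L])
    also have "\<dots> = (\<Sum>\<sigma>\<in>Pow \<rho>. \<Sum>v\<in>W - \<rho>. A \<sigma> v + C \<sigma> v)" by (rule sum.swap)
    also have "\<dots> = (\<Sum>\<sigma>\<in>Pow \<rho>. \<Sum>v\<in>W - \<rho>. A \<sigma> v) + (\<Sum>\<sigma>\<in>Pow \<rho>. \<Sum>v\<in>W - \<rho>. C \<sigma> v)"
      by (simp add: sum.distrib)
    finally have lhs: "ctr W \<xi> (wdg W y z) \<rho> =
      (\<Sum>\<sigma>\<in>Pow \<rho>. \<Sum>v\<in>W - \<rho>. A \<sigma> v) + (\<Sum>\<sigma>\<in>Pow \<rho>. \<Sum>v\<in>W - \<rho>. C \<sigma> v)" .
    have "wdg W (ctr W \<xi> y) z \<rho> = (\<Sum>\<sigma>\<in>Pow \<rho>. \<Sum>v\<in>W - \<sigma>. A \<sigma> v)"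
      by (simp add: wdg_def ctr_def A_def s_def sum_distrib_left sum_distrib_right)
    also have "\<dots> = (\<Sum>\<sigma>\<in>Pow \<rho>. (\<Sum>v\<in>W - \<rho>. A \<sigma> v) + (\<Sum>v\<in>W \<inter> (\<rho> - \<sigma>). A \<sigma> v))"
    proof (rule sum.cong[OF refl])
      fix \<sigma> assume "\<sigma> \<in> Pow \<rho>"
      then have "W - \<sigma> = (W - \<rho>) \<union> (W \<inter> (\<rho> - \<sigma>))" by auto
      then show "(\<Sum>v\<in>W - \<sigma>. A \<sigma> v) = (\<Sum>v\<in>W - \<rho>. A \<sigma> v) + (\<Sum>v\<in>W \<inter> (\<rho> - \<sigma>). A \<sigma> v)"
        using W by (simp only:) (rule sum.union_disjoint, auto)
    qed
    finally have rhs1: "wdg W (ctr W \<xi> y) z \<rho> =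
        (\<Sum>\<sigma>\<in>Pow \<rho>. \<Sum>v\<in>W - \<rho>. A \<sigma> v) + (\<Sum>\<sigma>\<in>Pow \<rho>. \<Sum>v\<in>W \<inter> (\<rho> - \<sigma>). A \<sigma> v)"
      by (simp add: sum.distrib)
    have "wdg W (grading W y) (ctr W \<xi> z) \<rho> = (\<Sum>\<sigma>\<in>Pow \<rho>. \<Sum>v\<in>W - (\<rho> - \<sigma>). C \<sigma> v)"
      by (simp add: wdg_def ctr_def grading_def C_def s_def sum_distrib_left sum_distrib_right)
    also have "\<dots> = (\<Sum>\<sigma>\<in>Pow \<rho>. (\<Sum>v\<in>W - \<rho>. C \<sigma> v) + (\<Sum>v\<in>W \<inter> \<sigma>. C \<sigma> v))"
    proof (rule sum.cong[OF refl])
      fix \<sigma> assume "\<sigma> \<in> Pow \<rho>"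
      then have "W - (\<rho> - \<sigma>) = (W - \<rho>) \<union> (W \<inter> \<sigma>)" "(W - \<rho>) \<inter> (W \<inter> \<sigma>) = {}" by auto
      then show "(\<Sum>v\<in>W - (\<rho> - \<sigma>). C \<sigma> v) = (\<Sum>v\<in>W - \<rho>. C \<sigma> v) + (\<Sum>v\<in>W \<inter> \<sigma>. C \<sigma> v)"
        using W by (simp only:) (rule sum.union_disjoint, auto)
    qed
    finally have rhs2: "wdg W (grading W y) (ctr W \<xi> z) \<rho> =
        (\<Sum>\<sigma>\<in>Pow \<rho>. \<Sum>v\<in>W - \<rho>. C \<sigma> v) + (\<Sum>\<sigma>\<in>Pow \<rho>. \<Sum>v\<in>W \<inter> \<sigma>. C \<sigma> v)"
      by (simp add: sum.distrib)
    have "(\<Sum>\<sigma>\<in>Pow \<rho>. \<Sum>v\<in>W \<inter> \<sigma>. C \<sigma> v) = (\<Sum>(\<sigma>, v)\<in>(SIGMA \<sigma>:Pow \<rho>. W \<inter> \<sigma>). C \<sigma> v)"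
      by (rule sum.Sigma) (use W fin in auto)
    also have "\<dots> = (\<Sum>(\<sigma>, v)\<in>(SIGMA \<sigma>:Pow \<rho>. W \<inter> (\<rho> - \<sigma>)). C (insert v \<sigma>) v)"
      by (rule sum.reindex_bij_witness[where j="\<lambda>(\<sigma>, v). (\<sigma> - {v}, v)" and i="\<lambda>(\<sigma>, v). (insert v \<sigma>, v)"])
        (auto simp: insert_absorb)
    also have "\<dots> = (\<Sum>(\<sigma>, v)\<in>(SIGMA \<sigma>:Pow \<rho>. W \<inter> (\<rho> - \<sigma>)). - A \<sigma> v)"
    proof (rule sum.cong[OF refl], clarify)
      fix \<sigma> v assume v: "\<sigma> \<subseteq> \<rho>" "v \<in> W" "v \<in> \<rho>" "v \<notin> \<sigma>"
      let ?t = "\<rho> - insert v \<sigma>"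
      have d: "\<rho> - \<sigma> = insert v ?t" "v \<notin> ?t" using v by auto
      have "insert v \<sigma> \<inter> W = insert v (\<sigma> \<inter> W)" using v by auto
      then have c: "card (insert v \<sigma> \<inter> W) = Suc (card (\<sigma> \<inter> W))" using v W by simp
      have "A \<sigma> v = (inv_sign W v \<sigma> * inv_sign W v \<sigma>) *
          ((-1) ^ inversions W \<sigma> ?t * (-1) ^ card (\<sigma> \<inter> W) * \<xi> v * y (insert v \<sigma>) * z (\<rho> - \<sigma>))"
        unfolding A_def s_def d(1) inversions_insert_right[OF W v(2,4) d(2)]
        by (simp add: mult_ac del: inv_sign_mult_self)
      moreover have "C (insert v \<sigma>) v = - (inv_sign W v ?t * inv_sign W v ?t) *
          ((-1) ^ inversions W \<sigma> ?t * (-1) ^ card (\<sigma> \<inter> W) * \<xi> v * y (insert v \<sigma>) * z (\<rho> - \<sigma>))"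
        unfolding C_def s_def d(1)[symmetric] inversions_insert_left[OF W v(2,4)] c
        by (simp add: mult_ac del: inv_sign_mult_self)
      ultimately show "C (insert v \<sigma>) v = - A \<sigma> v" by simp
    qed
    also have "\<dots> = - (\<Sum>(\<sigma>, v)\<in>(SIGMA \<sigma>:Pow \<rho>. W \<inter> (\<rho> - \<sigma>)). A \<sigma> v)"
      by (simp add: sum_negf case_prod_beta)
    also have "(\<Sum>(\<sigma>, v)\<in>(SIGMA \<sigma>:Pow \<rho>. W \<inter> (\<rho> - \<sigma>)). A \<sigma> v) =
        (\<Sum>\<sigma>\<in>Pow \<rho>. \<Sum>v\<in>W \<inter> (\<rho> - \<sigma>). A \<sigma> v)"
      by (rule sum.Sigma[symmetric]) (use W fin in auto)
    finally show ?thesis using lhs rhs1 rhs2 by simp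
  qed
qed

subsection \<open>Algebraic shifting\<close>

text \<open>As a simp rule, \<open>scl_apply\<close> would also rewrite the unapplied \<open>scl\<close> inside \<open>fs.subspace\<close>
  and \<open>fs.dim\<close>.\<close>

declare scl_apply [simp del]

lemma subspace_ctr_image: "fs.subspace V \<Longrightarrow> fs.subspace (ctr W \<xi> ` V)"
  by (rule vector_space_pair.linear_subspace_image[OF fs.endomorphisms ctr_linear])

lemma subspace_ctr_kernel: "fs.subspace V \<Longrightarrow> fs.subspace (V \<inter> {y. ctr W \<xi> y = 0})"
  by (rule fs.subspace_inter, assumption,
      rule vector_space_pair.linear_subspace_kernel[OF fs.endomorphisms ctr_linear])

definition supp_on :: "'b set \<Rightarrow> ('b \<Rightarrow> 'g::field) set" where
  "supp_on K = {y. \<forall>\<sigma>. y \<sigma> \<noteq> 0 \<longrightarrow> \<sigma> \<in> K}"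

lemma supp_onI: "(\<And>\<sigma>. y \<sigma> \<noteq> 0 \<Longrightarrow> \<sigma> \<in> K) \<Longrightarrow> y \<in> supp_on K"
  by (simp add: supp_on_def)

lemma subspace_supp_on: "fs.subspace (supp_on K)"
  by (auto simp: fs.subspace_def supp_on_def scl_apply) (metis add_0)

lemma supp_on_mono: "K \<subseteq> L \<Longrightarrow> supp_on K \<subseteq> supp_on L"
  by (auto simp: supp_on_def)

definition indicators :: "'b set \<Rightarrow> ('b \<Rightarrow> 'g::field) set" where
  "indicators K = (\<lambda>i. \<lambda>x. if x = i then 1 else 0) ` K"

lemma supp_on_span: "finite K \<Longrightarrow> supp_on K \<subseteq> fs.span (indicators K)"
  using finite_support_in_span[of K] by (auto simp: supp_on_def indicators_def)

lemma finite_indicators: "finite K \<Longrightarrow> finite (indicators K)"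
  by (simp add: indicators_def)

lemma ctr_supp_on:
  assumes "y \<in> supp_on A" "\<And>v \<tau>. v \<in> W \<Longrightarrow> v \<notin> \<tau> \<Longrightarrow> insert v \<tau> \<in> A \<Longrightarrow> \<tau> \<in> B"
  shows "ctr W \<xi> y \<in> supp_on B"
proof (rule supp_onI)
  fix \<tau> assume "ctr W \<xi> y \<tau> \<noteq> 0"
  then obtain v where "v \<in> W - \<tau>" "y (insert v \<tau>) \<noteq> 0"
    unfolding ctr_def by (metis (no_types, lifting) mult_eq_0_iff sum.not_neutral_contains_not_neutral)
  then show "\<tau> \<in> B" using assms by (auto simp: supp_on_def)
qed

text \<open>The lexicographic generic initial family of \<open>V\<close> with respect to the covectors \<open>\<xi>s\<close>, which are
  numbered from \<open>k\<close> on.\<close>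

fun shift_family :: "'a set \<Rightarrow> nat \<Rightarrow> ('a \<Rightarrow> 'g::field) list \<Rightarrow> ('a set \<Rightarrow> 'g) set \<Rightarrow> nat set set" where
  "shift_family W k [] V = (if \<exists>y\<in>V. y {} \<noteq> 0 then {{}} else {})"
| "shift_family W k (\<xi> # \<xi>s) V =
    insert k ` shift_family W (Suc k) \<xi>s (ctr W \<xi> ` V) \<union>
    shift_family W (Suc k) \<xi>s (V \<inter> {y. ctr W \<xi> y = 0})"

lemma shift_family_bounds: "S \<in> shift_family W k \<xi>s V \<Longrightarrow> S \<subseteq> {k..<k + length \<xi>s}"
proof (induction \<xi>s arbitrary: k V S)
  case (Cons \<xi> \<xi>s)
  then show ?case
  proof (simp only: shift_family.simps Un_iff, elim disjE imageE)
    fix T assume "S = insert k T" "T \<in> shift_family W (Suc k) \<xi>s (ctr W \<xi> ` V)"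
    moreover from this have "T \<subseteq> {Suc k..<Suc k + length \<xi>s}" by (intro Cons.IH)
    ultimately show ?thesis by auto
  next
    assume "S \<in> shift_family W (Suc k) \<xi>s (V \<inter> {y. ctr W \<xi> y = 0})"
    then have "S \<subseteq> {Suc k..<Suc k + length \<xi>s}" by (rule Cons.IH)
    then show ?thesis by auto
  qed
qed (auto split: if_splits)

lemma finite_shift_family: "finite (shift_family W k \<xi>s V)"
  by (rule finite_subset[of _ "Pow {k..<k + length \<xi>s}"]) (use shift_family_bounds in blast, simp)

lemma shift_family_Suc_notin: "S \<in> shift_family W (Suc k) \<xi>s V \<Longrightarrow> k \<notin> S"
  using shift_family_bounds by force

lemma shift_family_mono: "V \<subseteq> V' \<Longrightarrow> shift_family W k \<xi>s V \<subseteq> shift_family W k \<xi>s V'"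
proof (induction \<xi>s arbitrary: k V V')
  case (Cons \<xi> \<xi>s)
  have "ctr W \<xi> ` V \<subseteq> ctr W \<xi> ` V'" "V \<inter> {y. ctr W \<xi> y = 0} \<subseteq> V' \<inter> {y. ctr W \<xi> y = 0}"
    using Cons.prems by auto
  then show ?case unfolding shift_family.simps
    using Cons.IH by (meson Un_mono image_mono)
qed auto

text \<open>Rank-nullity for each covector matches the two branches of the recursion. The ambient
  space \<open>\<Omega>\<close> is intersected with the kernel of each covector used, which contains
  both branches since contractions square to zero. When the covectors are exhausted, only the
  coefficient at \<open>{}\<close> is left, so the dimension is 0 or 1.\<close>

lemma shift_family_card:
  assumes W: "finite W" and "fs.subspace V" "V \<subseteq> \<Omega>" "\<Omega> \<subseteq> fs.span B" "finite B"
    and "\<And>\<xi> y. y \<in> \<Omega> \<Longrightarrow> ctr W \<xi> y \<in> \<Omega>"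
    and "\<And>y \<sigma>. y \<in> \<Omega> \<Longrightarrow> \<forall>\<xi>\<in>set \<xi>s. ctr W \<xi> y = 0 \<Longrightarrow> \<sigma> \<noteq> {} \<Longrightarrow> y \<sigma> = 0"
  shows "card (shift_family W k \<xi>s V) = fs.dim V"
  using assms(2-)
proof (induction \<xi>s arbitrary: k V \<Omega>)
  case Nil
  have sup: "y \<sigma> = 0" if "y \<in> V" "\<sigma> \<noteq> {}" for y \<sigma>
    using Nil.prems(6)[of y \<sigma>] Nil.prems(2) that by auto
  show ?case
  proof (cases "\<exists>y\<in>V. y {} \<noteq> 0")
    case True
    then obtain y where y: "y \<in> V" "y {} \<noteq> 0" by blast
    have "z \<in> fs.span {y}" if "z \<in> V" for z
    proof -
      have "z = scl (z {} / y {}) y"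
      proof
        fix \<sigma> show "z \<sigma> = scl (z {} / y {}) y \<sigma>"
          using sup[OF that, of \<sigma>] sup[OF y(1), of \<sigma>] y(2) by (cases "\<sigma> = {}") (simp_all add: scl_apply)
      qed
      then show ?thesis by (metis fs.span_base fs.span_scale singletonI)
    qed
    moreover have "y \<noteq> 0" using y(2) by auto
    ultimately have "fs.dim V = card {y}"
      using y(1) by (intro fs.dim_unique[of "{y}"]) auto
    then show ?thesis using True by simp
  next
    case False
    have "V \<subseteq> {0}"
    proof
      fix y assume "y \<in> V"
      then have "y \<sigma> = 0" for \<sigma> using sup False by (cases "\<sigma> = {}") auto
      then show "y \<in> {0}" by (auto simp: fun_eq_iff)
    qed
    then have "fs.dim V = 0" using fs.dim_unique[of "{}" V 0] fs.independent_empty by simp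
    then show ?thesis using False by simp
  qed
next
  case (Cons \<xi> \<xi>s)
  let ?\<Omega> = "\<Omega> \<inter> {y. ctr W \<xi> y = 0}"
  let ?I = "ctr W \<xi> ` V" and ?K = "V \<inter> {y. ctr W \<xi> y = 0}"
  have closed: "ctr W \<eta> y \<in> ?\<Omega>" if "y \<in> ?\<Omega>" for \<eta> y
    using that Cons.prems(5) ctr_anticommute[OF W, of \<xi> \<eta> y] by auto
  have ker: "y \<sigma> = 0" if "y \<in> ?\<Omega>" "\<forall>\<xi>\<in>set \<xi>s. ctr W \<xi> y = 0" "\<sigma> \<noteq> {}" for y \<sigma>
  proof (rule Cons.prems(6)[OF _ _ that(3)])
    show "y \<in> \<Omega>" using that(1) by blast
    show "\<forall>\<zeta>\<in>set (\<xi> # \<xi>s). ctr W \<zeta> y = 0"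
      using that(1,2) by (simp only: list.set ball_simps Int_iff mem_Collect_eq simp_thms)
  qed
  have B: "?\<Omega> \<subseteq> fs.span B" using Cons.prems(3) by (rule le_infI1)
  have "card (shift_family W (Suc k) \<xi>s ?I) = fs.dim ?I"
  proof (rule Cons.IH[where V="?I" and \<Omega>="?\<Omega>", OF subspace_ctr_image[OF Cons.prems(1)] _ B Cons.prems(4)])
    show "?I \<subseteq> ?\<Omega>"
    proof (intro image_subsetI IntI)
      fix y assume "y \<in> V"
      then show "ctr W \<xi> y \<in> \<Omega>" using Cons.prems(2) by (intro Cons.prems(5)) blast
      show "ctr W \<xi> y \<in> {y. ctr W \<xi> y = 0}" by (simp only: mem_Collect_eq ctr_square[OF W])
    qed
  qed (fact closed, fact ker)
  moreover have "card (shift_family W (Suc k) \<xi>s ?K) = fs.dim ?K"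
  proof (rule Cons.IH[where V="?K" and \<Omega>="?\<Omega>", OF subspace_ctr_kernel[OF Cons.prems(1)] _ B Cons.prems(4)])
    show "?K \<subseteq> ?\<Omega>" using Cons.prems(2) by blast
  qed (fact closed, fact ker)
  moreover have "fs.dim V = fs.dim ?I + fs.dim ?K"
    by (rule fs.rank_nullity[OF ctr_linear Cons.prems(1) order_trans[OF Cons.prems(2,3)] Cons.prems(4)])
  moreover have "card (shift_family W k (\<xi> # \<xi>s) V) =
      card (insert k ` shift_family W (Suc k) \<xi>s ?I) + card (shift_family W (Suc k) \<xi>s ?K)"
    unfolding shift_family.simps
    by (rule card_Un_disjoint) (auto intro: finite_shift_family dest: shift_family_Suc_notin)
  moreover have "card (insert k ` shift_family W (Suc k) \<xi>s ?I) = card (shift_family W (Suc k) \<xi>s ?I)"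
    by (rule card_image) (auto simp: inj_on_def dest!: shift_family_Suc_notin)
  ultimately show ?case by simp
qed

section \<open>Degrees, subsets and intersections in shifted families\<close>

definition homogeneous :: "'a set \<Rightarrow> nat \<Rightarrow> ('a set \<Rightarrow> 'g::field) set \<Rightarrow> bool" where
  "homogeneous W i V \<longleftrightarrow> V \<subseteq> supp_on {\<sigma>. \<sigma> \<subseteq> W \<and> card \<sigma> = i}"

lemma homogeneous_ctr:
  assumes "finite W" "homogeneous W (Suc i) V"
  shows "homogeneous W i (ctr W \<xi> ` V)"
  unfolding homogeneous_def
proof (intro image_subsetI)
  fix y assume "y \<in> V"
  then have "y \<in> supp_on {\<sigma>. \<sigma> \<subseteq> W \<and> card \<sigma> = Suc i}"
    using assms(2) by (auto simp: homogeneous_def)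
  then show "ctr W \<xi> y \<in> supp_on {\<sigma>. \<sigma> \<subseteq> W \<and> card \<sigma> = i}"
  proof (rule ctr_supp_on)
    fix v \<tau> assume "v \<in> W" "v \<notin> \<tau>" "insert v \<tau> \<in> {\<sigma>. \<sigma> \<subseteq> W \<and> card \<sigma> = Suc i}"
    moreover from this have "finite \<tau>" using assms(1) finite_subset[of \<tau> W] by auto
    ultimately show "\<tau> \<in> {\<sigma>. \<sigma> \<subseteq> W \<and> card \<sigma> = i}" by auto
  qed
qed

lemma homogeneous_0_ctr:
  assumes "homogeneous W 0 V" "finite W"
  shows "ctr W \<xi> ` V \<subseteq> {0}"
proof
  fix z assume "z \<in> ctr W \<xi> ` V"
  then obtain y where y: "y \<in> V" "z = ctr W \<xi> y" by blast
  have "y \<in> supp_on {\<sigma>. \<sigma> \<subseteq> W \<and> card \<sigma> = 0}" using y(1) assms(1) by (auto simp: homogeneous_def)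
  then have "z \<in> supp_on {}" unfolding y(2)
    by (rule ctr_supp_on) (use assms(2) finite_subset in fastforce)
  then show "z \<in> {0}" by (auto simp: supp_on_def fun_eq_iff)
qed

lemma homogeneous_subset: "homogeneous W i V \<Longrightarrow> U \<subseteq> V \<Longrightarrow> homogeneous W i U"
  by (auto simp: homogeneous_def)

lemma shift_family_zero: "V \<subseteq> {0} \<Longrightarrow> shift_family W k \<xi>s V = {}"
proof (induction \<xi>s arbitrary: k V)
  case (Cons \<xi> \<xi>s)
  have "ctr W \<xi> ` V \<subseteq> ctr W \<xi> ` {0}" using Cons.prems by (rule image_mono)
  also have "\<dots> = {0}" by (simp only: image_insert image_empty ctr_0)
  finally have "shift_family W (Suc k) \<xi>s (ctr W \<xi> ` V) = {}" by (rule Cons.IH)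
  moreover have "V \<inter> {y. ctr W \<xi> y = 0} \<subseteq> {0}" using Cons.prems by (rule le_infI1)
  then have "shift_family W (Suc k) \<xi>s (V \<inter> {y. ctr W \<xi> y = 0}) = {}" by (rule Cons.IH)
  ultimately show ?case by (simp only: shift_family.simps image_empty Un_empty)
qed auto

lemma shift_family_degree:
  assumes "finite W" "homogeneous W i V" "S \<in> shift_family W k \<xi>s V"
  shows "card S = i"
  using assms(2,3)
proof (induction \<xi>s arbitrary: k V S i)
  case Nil
  then obtain y where y: "y \<in> V" "y {} \<noteq> 0" "S = {}" by (auto split: if_splits)
  then show ?case using Nil(1) by (fastforce simp: homogeneous_def supp_on_def)
next
  case (Cons \<xi> \<xi>s)
  from Cons.prems(2) consider T where "S = insert k T" "T \<in> shift_family W (Suc k) \<xi>s (ctr W \<xi> ` V)"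
    | "S \<in> shift_family W (Suc k) \<xi>s (V \<inter> {y. ctr W \<xi> y = 0})" by auto
  then show ?case
  proof cases
    case 1
    show ?thesis
    proof (cases i)
      case 0
      then have "ctr W \<xi> ` V \<subseteq> {0}" using Cons.prems(1) homogeneous_0_ctr assms(1) by blast
      then show ?thesis using 1 shift_family_zero by blast
    next
      case (Suc j)
      then have "card T = j"
        using Cons.IH[OF homogeneous_ctr[OF assms(1)]] Cons.prems(1) 1(2) by blast
      moreover have "finite T" using shift_family_bounds[OF 1(2)] by (rule finite_subset) simp
      ultimately show ?thesis using 1 Suc shift_family_Suc_notin[OF 1(2)] by simp
    qed
  next
    case 2
    then show ?thesis using Cons.IH homogeneous_subset[OF Cons.prems(1)] by blast
  qed
qed

text \<open>Removing the current index \<open>k\<close> moves from the image branch to the kernel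
  branch, which is allowed because contractions square to zero. For later indices, anticommutation
  passes the hypothesis on to images and kernels. Applied to consecutive chain spaces, this makes
  the shifted family a simplicial complex.\<close>

lemma shift_family_remove:
  assumes W: "finite W" and "\<And>\<xi>. ctr W \<xi> ` U \<subseteq> U'" "S \<in> shift_family W k \<xi>s U" "i \<in> S"
  shows "S - {i} \<in> shift_family W k \<xi>s U'"
  using assms(2-)
proof (induction \<xi>s arbitrary: k U U' S)
  case (Cons \<xi> \<xi>s)
  from Cons.prems(2) consider T where "S = insert k T" "T \<in> shift_family W (Suc k) \<xi>s (ctr W \<xi> ` U)"
    | "S \<in> shift_family W (Suc k) \<xi>s (U \<inter> {y. ctr W \<xi> y = 0})" by auto
  then show ?case
  proof cases
    case 1
    have kT: "k \<notin> T" using shift_family_Suc_notin[OF 1(2)] .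
    show ?thesis
    proof (cases "i = k")
      case True
      have sub: "ctr W \<xi> ` U \<subseteq> U' \<inter> {y. ctr W \<xi> y = 0}"
      proof (intro image_subsetI IntI)
        fix y assume "y \<in> U"
        then show "ctr W \<xi> y \<in> U'" using Cons.prems(1) by (rule subsetD[rotated, OF imageI])
        show "ctr W \<xi> y \<in> {y. ctr W \<xi> y = 0}" by (simp only: mem_Collect_eq ctr_square[OF W])
      qed
      have "T \<in> shift_family W (Suc k) \<xi>s (U' \<inter> {y. ctr W \<xi> y = 0})"
        by (rule subsetD[OF shift_family_mono[OF sub] 1(2)])
      then show ?thesis using True 1(1) kT by simp
    next
      case False
      have "ctr W \<eta> ` ctr W \<xi> ` U \<subseteq> ctr W \<xi> ` U'" for \<eta>
      proof
        fix z assume "z \<in> ctr W \<eta> ` ctr W \<xi> ` U"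
        then obtain y where y: "y \<in> U" "z = ctr W \<eta> (ctr W \<xi> y)" by blast
        then have "z = ctr W \<xi> (- ctr W \<eta> y)"
          by (simp only: ctr_anticommute[OF W, of \<eta> \<xi> y] ctr_minus)
        moreover have "- ctr W \<eta> y = ctr W (\<lambda>v. - \<eta> v) y"
          by (simp add: fun_eq_iff ctr_def sum_negf)
        ultimately show "z \<in> ctr W \<xi> ` U'" using Cons.prems(1) y(1) by auto
      qed
      then have "T - {i} \<in> shift_family W (Suc k) \<xi>s (ctr W \<xi> ` U')"
        by (rule Cons.IH[OF _ 1(2)]) (use 1(1) Cons.prems(3) False in simp)
      moreover have "S - {i} = insert k (T - {i})" using 1(1) False by auto
      ultimately show ?thesis by simp
    qed
  next
    case 2
    have "ctr W \<eta> ` (U \<inter> {y. ctr W \<xi> y = 0}) \<subseteq> U' \<inter> {y. ctr W \<xi> y = 0}" for \<eta>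
      using Cons.prems(1) ctr_anticommute[OF W, of \<xi> \<eta>] by auto
    then have "S - {i} \<in> shift_family W (Suc k) \<xi>s (U' \<inter> {y. ctr W \<xi> y = 0})"
      by (rule Cons.IH[OF _ 2 Cons.prems(3)])
    then show ?thesis by simp
  qed
qed (auto split: if_splits)

lemma wdg_zero_left [simp]: "wdg W 0 z = 0"
  by (simp add: fun_eq_iff wdg_def)

lemma wdg_zero_right [simp]: "wdg W y 0 = 0"
  by (simp add: fun_eq_iff wdg_def)

lemma wdg_grading:
  assumes "finite W" "y \<in> supp_on {\<sigma>. \<sigma> \<subseteq> W \<and> card \<sigma> = i}"
  shows "wdg W (grading W y) z = scl ((-1) ^ i) (wdg W y z)"
proof -
  have "grading W y \<sigma> = (-1) ^ i * y \<sigma>" for \<sigma>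
    using assms by (cases "y \<sigma> = 0") (auto simp: grading_def supp_on_def Int_absorb2)
  then show ?thesis by (simp add: fun_eq_iff wdg_def sum_distrib_left mult_ac scl_apply)
qed

text \<open>The Leibniz rule propagates \<open>V \<and> V' = 0\<close> to the pairs of spaces whose sets do not yet meet.\<close>

lemma shift_family_meet:
  assumes W: "finite W" and "homogeneous W i V" "\<And>y z. y \<in> V \<Longrightarrow> z \<in> V' \<Longrightarrow> wdg W y z = 0"
    and "S \<in> shift_family W k \<xi>s V" "T \<in> shift_family W k \<xi>s V'"
  shows "S \<inter> T \<noteq> {}"
  using assms(2-)
proof (induction \<xi>s arbitrary: k V V' S T i)
  case Nil
  then obtain y z where "y \<in> V" "y {} \<noteq> 0" "z \<in> V'" "z {} \<noteq> 0" by (auto split: if_splits)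
  moreover from this have "wdg W y z {} = 0" using Nil by simp
  ultimately show ?case by (simp add: wdg_def)
next
  case (Cons \<xi> \<xi>s)
  let ?I = "\<lambda>V. ctr W \<xi> ` V" and ?K = "\<lambda>V. V \<inter> {y. ctr W \<xi> y = 0}"
  let ?F = "\<lambda>V. shift_family W (Suc k) \<xi>s V"
  have w1: "wdg W y z = 0" if yz: "y \<in> ?I V" "z \<in> ?K V'" for y z
  proof -
    obtain x where x: "x \<in> V" "y = ctr W \<xi> x" using yz by blast
    have "wdg W x z = 0" using Cons.prems(2) x yz by blast
    then show ?thesis using ctr_wdg[OF W, of \<xi> x z] yz x by simp
  qed
  have w2: "wdg W y z = 0" if yz: "y \<in> ?K V" "z \<in> ?I V'" for y z
  proof -
    obtain x where x: "x \<in> V'" "z = ctr W \<xi> x" using yz by blast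
    have "wdg W y x = 0" using Cons.prems(2) x yz by blast
    then have "wdg W (grading W y) z = 0" using ctr_wdg[OF W, of \<xi> y x] yz x by simp
    \<comment> \<open>Homogeneity turns the operator \<open>grading\<close> into a scalar sign,
      which can then be cancelled.\<close>
    moreover have ys: "y \<in> supp_on {\<sigma>. \<sigma> \<subseteq> W \<and> card \<sigma> = i}"
      using yz Cons.prems(1) by (auto simp: homogeneous_def)
    ultimately have "scl ((-1) ^ i) (wdg W y z) = 0" by (simp only: wdg_grading[OF W ys])
    then show ?thesis by (simp only: fs.scale_eq_0_iff) simp
  qed
  from Cons.prems(3) have "S \<in> insert k ` ?F (?I V) \<or> S \<in> ?F (?K V)" by simp
  then show ?case
  proof (elim disjE imageE)
    fix S' assume S: "S = insert k S'" "S' \<in> ?F (?I V)"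
    from Cons.prems(4) have "T \<in> insert k ` ?F (?I V') \<or> T \<in> ?F (?K V')" by simp
    then show ?thesis
    proof (elim disjE imageE)
      fix T' assume "T = insert k T'"
      then show ?thesis using S by auto
    next
      assume T: "T \<in> ?F (?K V')"
      have "S' \<inter> T \<noteq> {}"
      proof (cases i)
        case 0
        then have "homogeneous W 0 V" using Cons.prems(1) by simp
        then have "?I V \<subseteq> {0}" using W by (rule homogeneous_0_ctr)
        then show ?thesis using S(2) shift_family_zero by blast
      next
        case (Suc j)
        then have "homogeneous W (Suc j) V" using Cons.prems(1) by simp
        then have "homogeneous W j (?I V)" by (rule homogeneous_ctr[OF W])
        then show ?thesis using w1 S(2) T by (rule Cons.IH)
      qed
      then show ?thesis using S by auto
    qed
  next
    assume S: "S \<in> ?F (?K V)"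
    have hK: "homogeneous W i (?K V)" by (rule homogeneous_subset[OF Cons.prems(1)]) auto
    from Cons.prems(4) have "T \<in> insert k ` ?F (?I V') \<or> T \<in> ?F (?K V')" by simp
    then show ?thesis
    proof (elim disjE imageE)
      fix T' assume T: "T = insert k T'" "T' \<in> ?F (?I V')"
      have "S \<inter> T' \<noteq> {}" using hK w2 S T(2) by (rule Cons.IH)
      then show ?thesis using T by auto
    next
      assume T: "T \<in> ?F (?K V')"
      show ?thesis by (rule Cons.IH[OF hK _ S T]) (use Cons.prems(2) in blast)
    qed
  qed
qed

text \<open>Genericity is used only through this infinitesimal condition, imposed on the finitely many spaces
  that occur in the recursion.\<close>

fun generic_list :: "'a set \<Rightarrow> ('a set \<Rightarrow> 'g::field) set set \<Rightarrow> ('a \<Rightarrow> 'g) list \<Rightarrow> bool" where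
  "generic_list W \<V> [] \<longleftrightarrow> True"
| "generic_list W \<V> (\<xi> # \<xi>s) \<longleftrightarrow>
    (\<forall>V\<in>\<V>. \<forall>\<eta>. \<forall>y\<in>V. ctr W \<xi> y = 0 \<longrightarrow> ctr W \<eta> y \<in> ctr W \<xi> ` V) \<and>
    generic_list W ((\<lambda>V. ctr W \<xi> ` V) ` \<V> \<union> (\<lambda>V. V \<inter> {y. ctr W \<xi> y = 0}) ` \<V>) \<xi>s"

lemma generic_list_exists:
  fixes \<V> :: "('a set \<Rightarrow> 'g::field) set set"
  assumes W: "finite W" and inf: "infinite (UNIV :: 'g set)"
    and "finite \<V>" "\<And>V. V \<in> \<V> \<Longrightarrow> fs.subspace V" "\<And>V. V \<in> \<V> \<Longrightarrow> V \<subseteq> supp_on (Pow W)"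
  shows "\<exists>\<xi>s. length \<xi>s = n \<and> generic_list W \<V> \<xi>s"
  using assms(3-)
proof (induction n arbitrary: \<V>)
  case (Suc n)
  have fd: "V \<subseteq> fs.span (indicators (Pow W))" if "V \<in> \<V>" for V
    using Suc.prems(3)[OF that] supp_on_span[of "Pow W"] W by auto
  obtain \<xi> :: "'a \<Rightarrow> 'g" where \<xi>: "\<forall>V\<in>\<V>. \<forall>\<eta>. \<forall>y\<in>V. ctr W \<xi> y = 0 \<longrightarrow> ctr W \<eta> y \<in> ctr W \<xi> ` V"
    using fs.generic_parameter[of "ctr W" \<V> "indicators (Pow W)", OF ctr_linear ctr_param_add Suc.prems(1,2) fd
        finite_indicators inf] W by auto
  let ?\<V> = "(\<lambda>V. ctr W \<xi> ` V) ` \<V> \<union> (\<lambda>V. V \<inter> {y. ctr W \<xi> y = 0}) ` \<V>"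
  have "\<exists>\<xi>s. length \<xi>s = n \<and> generic_list W ?\<V> \<xi>s"
  proof (rule Suc.IH)
    show "finite ?\<V>" using Suc.prems(1) by simp
    show "fs.subspace V" if "V \<in> ?\<V>" for V
      using that Suc.prems(2) subspace_ctr_image subspace_ctr_kernel by blast
    show "V \<subseteq> supp_on (Pow W)" if "V \<in> ?\<V>" for V
    proof -
      have "ctr W \<xi> y \<in> supp_on (Pow W)" if "y \<in> supp_on (Pow W)" for y :: "'a set \<Rightarrow> 'g"
        by (rule ctr_supp_on[OF that]) auto
      then show ?thesis using that Suc.prems(3) by blast
    qed
  qed
  then obtain \<xi>s where "length \<xi>s = n" "generic_list W ?\<V> \<xi>s" by blast
  then show ?case using \<xi> by (intro exI[of _ "\<xi> # \<xi>s"]) simp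
qed simp

text \<open>Genericity matters at \<open>i = k\<close>: it puts the image under the second covector
  of the kernel of the first inside the image of the first, and this image is killed by the second.
  So the branch kernel-then-image is contained in the branch image-then-kernel, which trades
  \<open>Suc k\<close> for \<open>k\<close>.\<close>

lemma shift_family_shifted:
  assumes W: "finite W" and "generic_list W \<V> \<xi>s" "V \<in> \<V>"
    and "S \<in> shift_family W k \<xi>s V" "Suc i \<in> S" "i \<notin> S" "k \<le> i"
  shows "insert i (S - {Suc i}) \<in> shift_family W k \<xi>s V"
  using assms(2-)
proof (induction \<xi>s arbitrary: k V \<V> S)
  case (Cons \<xi> \<xi>s)
  let ?I = "ctr W \<xi> ` V" and ?K = "V \<inter> {y. ctr W \<xi> y = 0}"
  let ?\<V> = "(\<lambda>V. ctr W \<xi> ` V) ` \<V> \<union> (\<lambda>V. V \<inter> {y. ctr W \<xi> y = 0}) ` \<V>"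
  have gen: "generic_list W ?\<V> \<xi>s" using Cons.prems(1) by simp
  from Cons.prems(3) consider (a) T where "S = insert k T" "T \<in> shift_family W (Suc k) \<xi>s ?I"
    | (b) "S \<in> shift_family W (Suc k) \<xi>s ?K" by auto
  then show ?case
  proof cases
    case a
    have ik: "Suc k \<le> i" using Cons.prems(5,6) a(1) by (metis insertI1 le_neq_implies_less Suc_leI)
    have "insert i (T - {Suc i}) \<in> shift_family W (Suc k) \<xi>s ?I"
      by (rule Cons.IH[OF gen _ a(2)]) (use Cons.prems a ik in auto)
    moreover have "insert i (S - {Suc i}) = insert k (insert i (T - {Suc i}))"
      using a ik by auto
    ultimately show ?thesis by simp
  next
    case b
    show ?thesis
    proof (cases "i = k")
      case False
      then have "insert i (S - {Suc i}) \<in> shift_family W (Suc k) \<xi>s ?K"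
        using Cons.IH[OF gen _ b] Cons.prems by auto
      then show ?thesis by simp
    next
      case True
      obtain \<eta> \<eta>s where \<xi>s: "\<xi>s = \<eta> # \<eta>s"
        using b Cons.prems(4) by (cases \<xi>s) (auto split: if_splits)
      have "S \<notin> shift_family W (Suc (Suc k)) \<eta>s (?K \<inter> {y. ctr W \<eta> y = 0})"
        using shift_family_Suc_notin Cons.prems(4) True by blast
      then obtain T where T: "S = insert (Suc k) T" "T \<in> shift_family W (Suc (Suc k)) \<eta>s (ctr W \<eta> ` ?K)"
        using b \<xi>s by auto
      have g: "\<forall>V\<in>\<V>. \<forall>\<eta>. \<forall>y\<in>V. ctr W \<xi> y = 0 \<longrightarrow> ctr W \<eta> y \<in> ctr W \<xi> ` V"
        using Cons.prems(1) by simp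
      have sub: "ctr W \<eta> ` ?K \<subseteq> ?I \<inter> {y. ctr W \<eta> y = 0}"
      proof (intro image_subsetI IntI)
        fix y assume y: "y \<in> ?K"
        show "ctr W \<eta> y \<in> ?I" by (rule g[rule_format, OF Cons.prems(2)]) (use y in blast)+
        show "ctr W \<eta> y \<in> {y. ctr W \<eta> y = 0}" by (simp only: mem_Collect_eq ctr_square[OF W])
      qed
      have "T \<in> shift_family W (Suc (Suc k)) \<eta>s (?I \<inter> {y. ctr W \<eta> y = 0})"
        by (rule subsetD[OF shift_family_mono[OF sub] T(2)])
      then have "T \<in> shift_family W (Suc k) \<xi>s ?I" by (simp add: \<xi>s)
      moreover have "Suc k \<notin> T" using shift_family_Suc_notin[OF T(2)] .
      ultimately show ?thesis using T(1) True by simp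
    qed
  qed
qed (auto split: if_splits)

subsection \<open>Exactness of weighted chain complexes\<close>

lemma ctr_supp_on_weighted:
  assumes "y \<in> supp_on A" "\<And>v \<tau>. v \<in> W \<Longrightarrow> \<xi> v \<noteq> 0 \<Longrightarrow> v \<notin> \<tau> \<Longrightarrow> insert v \<tau> \<in> A \<Longrightarrow> \<tau> \<in> B"
  shows "ctr W \<xi> y \<in> supp_on B"
proof (rule supp_onI)
  fix \<tau> assume "ctr W \<xi> y \<tau> \<noteq> 0"
  then obtain v where "v \<in> W - \<tau>" "\<xi> v \<noteq> 0" "y (insert v \<tau>) \<noteq> 0"
    unfolding ctr_def by (metis (no_types, lifting) mult_eq_0_iff sum.not_neutral_contains_not_neutral)
  then show "\<tau> \<in> B" using assms by (auto simp: supp_on_def)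
qed

lemma ctr_eq_0I: "(\<And>v. v \<in> W \<Longrightarrow> v \<notin> \<tau> \<Longrightarrow> \<xi> v = 0 \<or> y (insert v \<tau>) = 0) \<Longrightarrow> ctr W \<xi> y \<tau> = 0"
  unfolding ctr_def by (rule sum.neutral) auto

text \<open>Meant for weights that vanish on \<open>T\<close> and \<open>Z\<close>: such vertices
  are never removed, so these faces span a subcomplex, with \<open>T\<close> the zeros inside the
  faces and \<open>Z\<close> the zeros outside.\<close>

definition strand :: "'a set set \<Rightarrow> 'a set \<Rightarrow> 'a set \<Rightarrow> nat \<Rightarrow> 'a set set" where
  "strand K T Z i = {\<sigma> \<in> K. T \<subseteq> \<sigma> \<and> \<sigma> \<inter> Z = {} \<and> card \<sigma> = i}"

definition ctr_exact :: "'a set \<Rightarrow> ('a \<Rightarrow> 'g::field) \<Rightarrow> 'a set set \<Rightarrow> 'a set set \<Rightarrow> bool" where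
  "ctr_exact W \<xi> A B \<longleftrightarrow> (\<forall>y\<in>supp_on A. ctr W \<xi> y = 0 \<longrightarrow> (\<exists>z\<in>supp_on B. ctr W \<xi> z = y))"

lemma zero_supp_on [simp]: "0 \<in> supp_on A"
  by (simp add: supp_on_def)

lemma supp_on_diff: "y \<in> supp_on A \<Longrightarrow> z \<in> supp_on A \<Longrightarrow> y - z \<in> supp_on A"
  using subspace_supp_on by (rule fs.subspace_diff)

text \<open>Deleting a vertex from a complex costs at most one degree of exactness; the induction treats all
  links simultaneously, because the long exact sequence of a deletion involves a link.\<close>

lemma strand_exact:
  fixes \<xi> :: "'a \<Rightarrow> 'g::field"
  assumes W: "finite W" "K \<subseteq> Pow W"
    and link: "\<And>T (\<xi> :: 'a \<Rightarrow> 'g) i. T \<subseteq> W \<Longrightarrow> i < k \<Longrightarrow> (\<And>v. v \<in> W \<Longrightarrow> \<xi> v = 0 \<longleftrightarrow> v \<in> T) \<Longrightarrow>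
      ctr_exact W \<xi> (strand K T {} i) (strand K T {} (Suc i))"
    and down: "\<And>\<sigma> \<tau>. \<sigma> \<in> K \<Longrightarrow> \<tau> \<subseteq> \<sigma> \<Longrightarrow> \<tau> \<in> K"
    and "finite Z" "Z \<subseteq> W" "T \<subseteq> W" "T \<inter> Z = {}" "\<And>v. v \<in> W \<Longrightarrow> \<xi> v = 0 \<longleftrightarrow> v \<in> T \<union> Z" "i + card Z < k"
  shows "ctr_exact W \<xi> (strand K T Z i) (strand K T Z (Suc i))"
  using assms(5-)
proof (induction Z arbitrary: T \<xi> i rule: finite_induct)
  case empty
  then show ?case using link by auto
next
  case (insert v Z)
  have v: "v \<in> W" "v \<notin> T" "v \<notin> Z" "\<xi> v = 0" using insert by auto
  \<comment> \<open>The auxiliary weight \<open>\<xi>'\<close> is non-zero at \<open>v\<close>, so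
    its zero set is smaller and the induction hypothesis applies. Chains avoiding \<open>v\<close>
    do not notice the change.\<close>
  define e :: "'a \<Rightarrow> 'g" where "e = (\<lambda>u. if u = v then 1 else 0)"
  define \<xi>' where "\<xi>' = (\<lambda>u. \<xi> u + 1 * e u)"
  have c': "ctr W \<xi>' y = ctr W \<xi> y + ctr W e y" for y
    unfolding \<xi>'_def ctr_param_add by (simp add: fun_eq_iff scl_apply)
  show ?case
    unfolding ctr_exact_def
  proof (intro ballI impI)
    fix y assume y: "y \<in> supp_on (strand K T (insert v Z) i)" "ctr W \<xi> y = 0"
    have yv: "y \<sigma> = 0" if "v \<in> \<sigma>" for \<sigma> using y(1) that by (auto simp: supp_on_def strand_def)
    have "ctr W e y = 0"
      by (rule ext, simp only: zero_fun_apply, rule ctr_eq_0I) (auto simp: e_def yv)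
    then have "ctr W \<xi>' y = 0" using y(2) c' by simp
    moreover have "y \<in> supp_on (strand K T Z i)"
      using y(1) by (auto simp: supp_on_def strand_def)
    moreover have "ctr_exact W \<xi>' (strand K T Z i) (strand K T Z (Suc i))"
    proof (rule insert.IH)
      show "\<xi>' u = 0 \<longleftrightarrow> u \<in> T \<union> Z" if "u \<in> W" for u
        using v(2-4) insert.prems(4)[OF that] by (cases "u = v") (simp_all add: \<xi>'_def e_def)
    qed (use insert.prems insert.hyps v in auto)
    ultimately obtain z where z: "z \<in> supp_on (strand K T Z (Suc i))" "ctr W \<xi>' z = y"
      unfolding ctr_exact_def by blast
    define z0 where "z0 = (\<lambda>\<sigma>. if v \<in> \<sigma> then 0 else z \<sigma>)"
    define z1 where "z1 = (\<lambda>\<sigma>. if v \<in> \<sigma> then z \<sigma> else 0)"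
    have zz: "z = z0 + z1" by (auto simp: z0_def z1_def fun_eq_iff)
    have e0: "ctr W e z0 = 0"
      by (rule ext, simp only: zero_fun_apply, rule ctr_eq_0I) (auto simp: e_def z0_def)
    have yz: "y = ctr W \<xi> z0 + ctr W \<xi> z1 + ctr W e z1"
      using z(2) unfolding zz c' ctr_add e0 by (simp add: algebra_simps)
    \<comment> \<open>Compare coefficients in \<open>yz\<close> at sets containing \<open>v\<close>:
      there \<open>y\<close>, the contraction of \<open>z0\<close> and the contraction by
      \<open>e\<close> all vanish.\<close>
    have z1': "ctr W \<xi> z1 = 0"
    proof
      fix \<tau>
      show "ctr W \<xi> z1 \<tau> = 0 \<tau>"
      proof (cases "v \<in> \<tau>")
        case True
        have "ctr W \<xi> z0 \<tau> = 0" by (rule ctr_eq_0I) (use True in \<open>auto simp: z0_def\<close>)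
        moreover have "ctr W e z1 \<tau> = 0" by (rule ctr_eq_0I) (use True in \<open>auto simp: e_def\<close>)
        moreover have "y \<tau> = 0" using yv True by simp
        ultimately show ?thesis using fun_cong[OF yz, of \<tau>] by simp
      next
        case False
        have "ctr W \<xi> z1 \<tau> = 0" by (rule ctr_eq_0I) (use False v in \<open>auto simp: z1_def\<close>)
        then show ?thesis by simp
      qed
    qed
    have "z1 \<in> supp_on (strand K (insert v T) Z (Suc i))"
      using z(1) by (auto simp: z1_def supp_on_def strand_def)
    \<comment> \<open>Here \<open>v\<close> moves from the avoided zeros to the contained ones. The
      degree is one higher, which the smaller \<open>Z\<close> pays for.\<close>
    moreover have "ctr_exact W \<xi> (strand K (insert v T) Z (Suc i)) (strand K (insert v T) Z (Suc (Suc i)))"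
      by (rule insert.IH) (use insert.prems insert.hyps v in auto)
    ultimately obtain w where w: "w \<in> supp_on (strand K (insert v T) Z (Suc (Suc i)))" "ctr W \<xi> w = z1"
      using z1' unfolding ctr_exact_def by blast
    have "z0 \<in> supp_on (strand K T (insert v Z) (Suc i))"
      using z(1) by (auto simp: z0_def supp_on_def strand_def)
    moreover have "ctr W e w \<in> supp_on (strand K T (insert v Z) (Suc i))"
    proof (rule ctr_supp_on_weighted[OF w(1)])
      fix u \<tau> assume u: "u \<in> W" "e u \<noteq> 0" "u \<notin> \<tau>" "insert u \<tau> \<in> strand K (insert v T) Z (Suc (Suc i))"
      then have [simp]: "u = v" by (auto simp: e_def split: if_splits)
      have "insert v \<tau> \<subseteq> W" using u(4) W(2) by (auto simp: strand_def)
      then have "finite (insert v \<tau>)" using W(1) by (rule finite_subset)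
      then have "finite \<tau>" by simp
      then have "card \<tau> = Suc i" using u(3,4) by (auto simp: strand_def)
      moreover have "\<tau> \<in> K" using u(4) down[of "insert v \<tau>" \<tau>] by (auto simp: strand_def)
      ultimately show "\<tau> \<in> strand K T (insert v Z) (Suc i)" using u(3,4) v by (auto simp: strand_def)
    qed
    \<comment> \<open>Dropping \<open>z1\<close> loses the term \<open>ctr W e z1\<close> of
      \<open>y\<close>; subtracting \<open>ctr W e w\<close> restores it by anticommutation, and the
      result avoids \<open>v\<close>.\<close>
    ultimately have "z0 - ctr W e w \<in> supp_on (strand K T (insert v Z) (Suc i))"
      by (rule supp_on_diff)
    moreover have "ctr W \<xi> (z0 - ctr W e w) = y"
    proof -
      have "ctr W \<xi> (ctr W e w) = - ctr W e z1" unfolding w(2)[symmetric] by (rule ctr_anticommute[OF W(1)])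
      moreover have "y = ctr W \<xi> z0 + ctr W e z1" using yz z1' by (simp only: add_0_right)
      ultimately show ?thesis by (simp only: ctr_diff diff_minus_eq_add)
    qed
    ultimately show "\<exists>z\<in>supp_on (strand K T (insert v Z) (Suc i)). ctr W \<xi> z = y" by blast
  qed
qed

text \<open>The zeros of \<open>\<xi>\<close> are never removed by the contraction, so that the chain complex splits into
  strands according to the intersection of a face with the zero set.\<close>

lemma zero_set_exact:
  fixes \<xi> :: "'a \<Rightarrow> 'g::field"
  assumes W: "finite W" "K \<subseteq> Pow W"
    and link: "\<And>T (\<xi> :: 'a \<Rightarrow> 'g) i. T \<subseteq> W \<Longrightarrow> i < k \<Longrightarrow> (\<And>v. v \<in> W \<Longrightarrow> \<xi> v = 0 \<longleftrightarrow> v \<in> T) \<Longrightarrow>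
      ctr_exact W \<xi> (strand K T {} i) (strand K T {} (Suc i))"
    and down: "\<And>\<sigma> \<tau>. \<sigma> \<in> K \<Longrightarrow> \<tau> \<subseteq> \<sigma> \<Longrightarrow> \<tau> \<in> K"
    and i: "i + card {v \<in> W. \<xi> v = 0} < k"
  shows "ctr_exact W \<xi> {\<sigma> \<in> K. card \<sigma> = i} {\<sigma> \<in> K. card \<sigma> = Suc i}"
  unfolding ctr_exact_def
proof (intro ballI impI)
  fix y assume y: "y \<in> supp_on {\<sigma> \<in> K. card \<sigma> = i}" "ctr W \<xi> y = 0"
  define Z where "Z = {v \<in> W. \<xi> v = 0}"
  have finZ: "finite Z" "Z \<subseteq> W" using W(1) by (auto simp: Z_def)
  have ins: "insert u \<tau> \<inter> Z = \<tau> \<inter> Z" if "\<xi> u \<noteq> 0" for u \<tau> using that by (auto simp: Z_def)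
  define yT where "yT T = (\<lambda>\<sigma>. if \<sigma> \<inter> Z = T then y \<sigma> else 0)" for T
  have "\<exists>z\<in>supp_on (strand K T (Z - T) (Suc i)). ctr W \<xi> z = yT T" if T: "T \<in> Pow Z" for T
  proof -
    have "ctr_exact W \<xi> (strand K T (Z - T) i) (strand K T (Z - T) (Suc i))"
    proof (rule strand_exact[OF W link down])
      have "card (Z - T) \<le> card Z" using finZ by (intro card_mono) auto
      then show "i + card (Z - T) < k" using i by (simp add: Z_def)
      show "\<xi> v = 0 \<longleftrightarrow> v \<in> T \<union> (Z - T)" if "v \<in> W" for v using T that by (auto simp: Z_def)
    qed (use finZ T in auto)
    moreover have "yT T \<in> supp_on (strand K T (Z - T) i)"
      using y(1) T by (auto simp: yT_def supp_on_def strand_def split: if_splits)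
    moreover have "ctr W \<xi> (yT T) = 0"
    proof
      fix \<tau>
      show "ctr W \<xi> (yT T) \<tau> = 0 \<tau>"
      proof (cases "\<tau> \<inter> Z = T")
        case True
        have "ctr W \<xi> (yT T) \<tau> = ctr W \<xi> y \<tau>"
          unfolding ctr_def
        proof (rule sum.cong[OF refl])
          fix u assume "u \<in> W - \<tau>"
          show "\<xi> u * inv_sign W u \<tau> * yT T (insert u \<tau>) = \<xi> u * inv_sign W u \<tau> * y (insert u \<tau>)"
            using ins[of u \<tau>] True by (cases "\<xi> u = 0") (auto simp: yT_def)
        qed
        then show ?thesis using y(2) by simp
      next
        case False
        have "ctr W \<xi> (yT T) \<tau> = 0"
          by (rule ctr_eq_0I) (use False ins in \<open>auto simp: yT_def\<close>)
        then show ?thesis by simp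
      qed
    qed
    ultimately show ?thesis unfolding ctr_exact_def by blast
  qed
  then obtain zT where zT: "\<And>T. T \<in> Pow Z \<Longrightarrow> zT T \<in> supp_on (strand K T (Z - T) (Suc i)) \<and> ctr W \<xi> (zT T) = yT T"
    by metis
  define z where "z = (\<lambda>\<sigma>. zT (\<sigma> \<inter> Z) \<sigma>)"
  have "z \<in> supp_on {\<sigma> \<in> K. card \<sigma> = Suc i}"
  proof (rule supp_onI)
    fix \<sigma> assume "z \<sigma> \<noteq> 0"
    then have "\<sigma> \<in> strand K (\<sigma> \<inter> Z) (Z - \<sigma> \<inter> Z) (Suc i)"
      using zT[of "\<sigma> \<inter> Z"] by (auto simp: z_def supp_on_def)
    then show "\<sigma> \<in> {\<sigma> \<in> K. card \<sigma> = Suc i}" by (auto simp: strand_def)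
  qed
  moreover have "ctr W \<xi> z = y"
  proof
    fix \<tau>
    have "ctr W \<xi> z \<tau> = ctr W \<xi> (zT (\<tau> \<inter> Z)) \<tau>"
      unfolding ctr_def
    proof (rule sum.cong[OF refl])
      fix u assume "u \<in> W - \<tau>"
      show "\<xi> u * inv_sign W u \<tau> * z (insert u \<tau>) = \<xi> u * inv_sign W u \<tau> * zT (\<tau> \<inter> Z) (insert u \<tau>)"
        using ins[of u \<tau>] by (cases "\<xi> u = 0") (auto simp: z_def)
    qed
    also have "\<dots> = y \<tau>" using zT[of "\<tau> \<inter> Z"] by (simp add: yT_def)
    finally show "ctr W \<xi> z \<tau> = y \<tau>" .
  qed
  ultimately show "\<exists>z\<in>supp_on {\<sigma> \<in> K. card \<sigma> = Suc i}. ctr W \<xi> z = y" by blast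
qed

text \<open>A cycle over the closure is expanded in a basis of the closure over the ground field.\<close>

lemma exact_extend_scalars:
  assumes A: "finite A" and ex: "ctr_exact W (\<lambda>_. 1 :: 'f::field) A B"
  shows "ctr_exact W (\<lambda>_. 1 :: 'f alg_closure) A B"
  unfolding ctr_exact_def
proof (intro ballI impI)
  fix y :: "'a set \<Rightarrow> 'f alg_closure"
  assume y: "y \<in> supp_on A" "ctr W (\<lambda>_. 1) y = 0"
  interpret e: vector_space "\<lambda>c x. to_ac c * x :: 'f alg_closure"
    by unfold_locales (auto simp: algebra_simps)
  define Bs where "Bs = e.extend_basis {}"
  have Bs: "e.independent Bs" "e.span Bs = UNIV"
    unfolding Bs_def using e.independent_extend_basis e.span_extend_basis e.independent_empty by blast+
  have rep_sum: "e.representation Bs (\<Sum>i\<in>I. f i) b = (\<Sum>i\<in>I. e.representation Bs (f i) b)" for I :: "'a set" and f b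
    using e.representation_sum[OF Bs(1), of I f] Bs(2) by (simp add: sum_fun_apply)
  have rep_scale: "e.representation Bs (to_ac s * x) b = s * e.representation Bs x b" for s x b
    using e.representation_scale[OF Bs(1), of x s] Bs(2) by simp
  have rep: "x = (\<Sum>b\<in>J. to_ac (e.representation Bs x b) * b)"
    if "finite J" "{b. e.representation Bs x b \<noteq> 0} \<subseteq> J" for x J
  proof -
    have "x = (\<Sum>b | e.representation Bs x b \<noteq> 0. to_ac (e.representation Bs x b) * b)"
      using e.sum_nonzero_representation_eq[OF Bs(1), of x] Bs(2) by simp
    also have "\<dots> = (\<Sum>b\<in>J. to_ac (e.representation Bs x b) * b)"
      by (rule sum.mono_neutral_left[OF that]) auto
    finally show ?thesis .
  qed
  have sgn: "(inv_sign W v \<tau> :: 'f alg_closure) = to_ac (inv_sign W v \<tau>)" for v \<tau>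
    by (simp add: inv_sign_def)
  define J where "J = (\<Union>\<sigma>\<in>A. {b. e.representation Bs (y \<sigma>) b \<noteq> 0})"
  have J: "finite J" using A e.finite_representation by (auto simp: J_def)
  define c where "c b = (\<lambda>\<sigma>. e.representation Bs (y \<sigma>) b)" for b
  have rep0: "e.representation Bs 0 b = 0" for b using rep_scale[of 0 0 b] by simp
  have "\<exists>d\<in>supp_on B. ctr W (\<lambda>_. 1) d = c b" for b
  proof -
    have "c b \<in> supp_on A"
    proof (rule supp_onI)
      fix \<sigma> assume "c b \<sigma> \<noteq> 0"
      then have "y \<sigma> \<noteq> 0" using rep0[of b] unfolding c_def by metis
      then show "\<sigma> \<in> A" using y(1) by (simp add: supp_on_def)
    qed
    moreover have "ctr W (\<lambda>_. 1) (c b) = 0"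
    proof
      fix \<tau>
      have "ctr W (\<lambda>_. 1) (c b) \<tau> = e.representation Bs (ctr W (\<lambda>_. 1) y \<tau>) b"
        by (simp add: ctr_def rep_sum sgn rep_scale c_def)
      then show "ctr W (\<lambda>_. 1) (c b) \<tau> = 0 \<tau>" using y(2) rep0 by simp
    qed
    ultimately show ?thesis using ex unfolding ctr_exact_def by blast
  qed
  then obtain d where d: "\<And>b. d b \<in> supp_on B" "\<And>b. ctr W (\<lambda>_. 1) (d b) = c b" by metis
  define z where "z = (\<lambda>\<sigma>. \<Sum>b\<in>J. to_ac (d b \<sigma>) * b)"
  have "z \<in> supp_on B"
  proof (rule supp_onI)
    fix \<sigma> assume "z \<sigma> \<noteq> 0"
    have "\<exists>b. d b \<sigma> \<noteq> 0"
    proof (rule ccontr)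
      assume "\<nexists>b. d b \<sigma> \<noteq> 0"
      then have "z \<sigma> = 0" by (simp add: z_def)
      then show False using \<open>z \<sigma> \<noteq> 0\<close> by contradiction
    qed
    then obtain b where "d b \<sigma> \<noteq> 0" by blast
    then show "\<sigma> \<in> B" using d(1) by (auto simp: supp_on_def)
  qed
  moreover have "ctr W (\<lambda>_. 1) z = y"
  proof
    fix \<tau>
    have "ctr W (\<lambda>_. 1) z \<tau> = (\<Sum>v\<in>W - \<tau>. \<Sum>b\<in>J. inv_sign W v \<tau> * (to_ac (d b (insert v \<tau>)) * b))"
      unfolding ctr_def z_def mult_1 by (rule sum.cong[OF refl]) (rule sum_distrib_left)
    also have "\<dots> = (\<Sum>b\<in>J. \<Sum>v\<in>W - \<tau>. inv_sign W v \<tau> * (to_ac (d b (insert v \<tau>)) * b))"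
      by (rule sum.swap)
    also have "\<dots> = (\<Sum>b\<in>J. to_ac (ctr W (\<lambda>_. 1) (d b) \<tau>) * b)"
      unfolding ctr_def to_ac_sum sum_distrib_right mult_1 to_ac_mult mult.assoc sgn ..
    also have "\<dots> = (\<Sum>b\<in>J. to_ac (e.representation Bs (y \<tau>) b) * b)"
      unfolding d(2) by (simp add: c_def)
    also have "\<dots> = y \<tau>"
    proof (cases "\<tau> \<in> A")
      case True
      show ?thesis by (rule rep[OF J, symmetric]) (use True in \<open>auto simp: J_def\<close>)
    next
      case False
      then have "y \<tau> = 0" using y(1) by (auto simp: supp_on_def)
      then show ?thesis using rep0 by simp
    qed
    finally show "ctr W (\<lambda>_. 1) z \<tau> = y \<tau>" .
  qed
  ultimately show "\<exists>z\<in>supp_on B. ctr W (\<lambda>_. 1) z = y" by blast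
qed

text \<open>Scaling the coefficient at \<open>\<sigma>\<close> by the product of the weights over
  \<open>\<sigma>\<close> is invertible on chains and carries contraction by \<open>w\<close> to
  contraction by the constant weight 1.\<close>

lemma exact_reweight:
  fixes w :: "'a \<Rightarrow> 'g::field"
  assumes W: "finite W" "A \<subseteq> Pow W" "B \<subseteq> Pow W" and ex: "ctr_exact W (\<lambda>_. 1 :: 'g) A B"
    and w: "\<And>v. v \<in> W \<Longrightarrow> w v \<noteq> 0"
  shows "ctr_exact W w A B"
  unfolding ctr_exact_def
proof (intro ballI impI)
  fix y assume y: "y \<in> supp_on A" "ctr W w y = 0"
  define m where "m \<sigma> = (\<Prod>v\<in>\<sigma>. w v)" for \<sigma>
  have key: "ctr W (\<lambda>_. 1) (\<lambda>\<sigma>. m \<sigma> * p \<sigma>) \<tau> = m \<tau> * ctr W w p \<tau>" if p: "p \<in> supp_on (Pow W)" for p \<tau>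
  proof (cases "finite \<tau>")
    case True
    then show ?thesis by (simp add: ctr_def sum_distrib_left m_def mult_ac)
  next
    case False
    then have "\<not> insert v \<tau> \<subseteq> W" for v
      using W(1) finite_subset[of "insert v \<tau>" W] by auto
    then have "p (insert v \<tau>) = 0" for v
      using p by (auto simp: supp_on_def)
    then show ?thesis by (simp add: ctr_def)
  qed
  have m0: "m \<sigma> \<noteq> 0" if "\<sigma> \<subseteq> W" for \<sigma>
  proof -
    have "finite \<sigma>" using that W(1) by (rule finite_subset)
    then show ?thesis using w that by (auto simp: m_def)
  qed
  have "(\<lambda>\<sigma>. m \<sigma> * y \<sigma>) \<in> supp_on A" using y(1) by (auto simp: supp_on_def)
  moreover have "ctr W (\<lambda>_. 1) (\<lambda>\<sigma>. m \<sigma> * y \<sigma>) = 0"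
    using key[of y] y supp_on_mono[OF W(2)] by (auto simp: fun_eq_iff)
  ultimately obtain z where z: "z \<in> supp_on B" "ctr W (\<lambda>_. 1) z = (\<lambda>\<sigma>. m \<sigma> * y \<sigma>)"
    using ex unfolding ctr_exact_def by blast
  define z' where "z' = (\<lambda>\<sigma>. z \<sigma> / m \<sigma>)"
  have z': "z' \<in> supp_on B" using z(1) by (auto simp: z'_def supp_on_def)
  have "z = (\<lambda>\<sigma>. m \<sigma> * z' \<sigma>)"
  proof
    fix \<sigma> show "z \<sigma> = m \<sigma> * z' \<sigma>"
      using m0[of \<sigma>] z(1) W(3) by (cases "z \<sigma> = 0") (auto simp: z'_def supp_on_def)
  qed
  then have eq: "m \<tau> * ctr W w z' \<tau> = m \<tau> * y \<tau>" for \<tau>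
    using key[of z' \<tau>] z' supp_on_mono[OF W(3)] fun_cong[OF z(2), of \<tau>] by auto
  have "ctr W w z' = y"
  proof
    fix \<tau>
    show "ctr W w z' \<tau> = y \<tau>"
    proof (cases "\<tau> \<subseteq> W")
      case True then show ?thesis using eq[of \<tau>] m0 by simp
    next
      case False
      then have "y \<tau> = 0" using y(1) W(2) by (auto simp: supp_on_def)
      moreover have "ctr W w z' \<tau> = 0"
        by (rule ctr_eq_0I) (use z' W(3) False in \<open>auto simp: supp_on_def\<close>)
      ultimately show ?thesis by simp
    qed
  qed
  then show "\<exists>z\<in>supp_on B. ctr W w z = y" using z' by blast
qed

text \<open>Deleting \<open>T\<close> from each face identifies the chains with those of the link.
  The sign at \<open>\<tau> \<union> T\<close> is the sign at \<open>\<tau>\<close> times a factor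
  depending on \<open>v\<close> alone, which the weights absorb.\<close>

lemma exact_link:
  fixes \<xi> :: "'a \<Rightarrow> 'g::field"
  assumes W: "finite W" "T \<subseteq> W"
    and ex: "\<And>w :: 'a \<Rightarrow> 'g. (\<And>v. v \<in> W \<Longrightarrow> w v \<noteq> 0) \<Longrightarrow>
      ctr_exact W w {\<tau>. \<tau> \<inter> T = {} \<and> \<tau> \<union> T \<in> A} {\<tau>. \<tau> \<inter> T = {} \<and> \<tau> \<union> T \<in> B}"
    and T: "\<And>\<sigma>. \<sigma> \<in> A \<Longrightarrow> T \<subseteq> \<sigma>" "\<And>\<sigma>. \<sigma> \<in> B \<Longrightarrow> T \<subseteq> \<sigma>"
    and \<xi>: "\<And>v. v \<in> W \<Longrightarrow> \<xi> v = 0 \<longleftrightarrow> v \<in> T"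
  shows "ctr_exact W \<xi> A B"
  unfolding ctr_exact_def
proof (intro ballI impI)
  fix y assume y: "y \<in> supp_on A" "ctr W \<xi> y = 0"
  \<comment> \<open>Chains of the link avoid \<open>T\<close>, so the value 1 on \<open>T\<close>
    has no effect on them; it makes \<open>w\<close> non-zero on all of \<open>W\<close>, as
    \<open>ex\<close> demands.\<close>
  define w where "w = (\<lambda>v. if v \<in> T then 1 else \<xi> v * inv_sign W v T)"
  define lk where "lk p = (\<lambda>\<tau>. if \<tau> \<inter> T = {} then p (\<tau> \<union> T) else 0)" for p :: "'a set \<Rightarrow> 'g"
  have key: "ctr W w (lk p) \<tau> = lk (ctr W \<xi> p) \<tau>" for p \<tau>
  proof (cases "\<tau> \<inter> T = {}")
    case True
    have "ctr W w (lk p) \<tau> = (\<Sum>v\<in>W - (\<tau> \<union> T). w v * inv_sign W v \<tau> * lk p (insert v \<tau>))"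
      unfolding ctr_def by (rule sum.mono_neutral_right) (use W in \<open>auto simp: lk_def\<close>)
    also have "\<dots> = ctr W \<xi> p (\<tau> \<union> T)"
      unfolding ctr_def
      by (rule sum.cong[OF refl]) (use True in \<open>auto simp: lk_def w_def inv_sign_Un[OF W(1) True]\<close>)
    finally show ?thesis using True by (simp add: lk_def)
  next
    case False
    then have "ctr W w (lk p) \<tau> = 0" by (intro ctr_eq_0I) (auto simp: lk_def)
    then show ?thesis using False by (simp add: lk_def)
  qed
  have "ctr_exact W w {\<tau>. \<tau> \<inter> T = {} \<and> \<tau> \<union> T \<in> A} {\<tau>. \<tau> \<inter> T = {} \<and> \<tau> \<union> T \<in> B}"
    by (rule ex) (use \<xi> in \<open>auto simp: w_def\<close>)
  moreover have "lk y \<in> supp_on {\<tau>. \<tau> \<inter> T = {} \<and> \<tau> \<union> T \<in> A}"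
    using y(1) by (auto simp: lk_def supp_on_def)
  moreover have "ctr W w (lk y) = 0"
  proof
    fix \<tau> show "ctr W w (lk y) \<tau> = 0 \<tau>" unfolding key y(2) by (simp add: lk_def)
  qed
  ultimately obtain z where z: "z \<in> supp_on {\<tau>. \<tau> \<inter> T = {} \<and> \<tau> \<union> T \<in> B}" "ctr W w z = lk y"
    unfolding ctr_exact_def by blast
  define z' where "z' = (\<lambda>\<sigma>. if T \<subseteq> \<sigma> then z (\<sigma> - T) else 0)"
  have "lk z' = z"
  proof
    fix \<tau> show "lk z' \<tau> = z \<tau>"
    proof (cases "\<tau> \<inter> T = {}")
      case True
      then have "\<tau> \<union> T - T = \<tau>" by auto
      then show ?thesis using True by (simp add: lk_def z'_def)
    next
      case False then show ?thesis using z(1) by (auto simp: lk_def supp_on_def)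
    qed
  qed
  have z': "z' \<in> supp_on B"
    proof (rule supp_onI)
    fix \<sigma> assume "z' \<sigma> \<noteq> 0"
    then have "T \<subseteq> \<sigma>" "z (\<sigma> - T) \<noteq> 0" by (auto simp: z'_def split: if_splits)
    then have "(\<sigma> - T) \<union> T \<in> B" "T \<subseteq> \<sigma>" using z(1) by (auto simp: supp_on_def)
    then show "\<sigma> \<in> B" by (simp add: Un_absorb2)
  qed
  have "ctr W \<xi> z' = y"
  proof
    fix \<sigma>
    show "ctr W \<xi> z' \<sigma> = y \<sigma>"
    proof (cases "T \<subseteq> \<sigma>")
      case True
      have "lk (ctr W \<xi> z') (\<sigma> - T) = lk y (\<sigma> - T)"
        using key[of z' "\<sigma> - T"] z(2) \<open>lk z' = z\<close> by simp
      moreover have "(\<sigma> - T) \<inter> T = {}" "\<sigma> - T \<union> T = \<sigma>" using True by auto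
      ultimately show ?thesis by (simp add: lk_def)
    next
      case False
      have "ctr W \<xi> z' \<sigma> = 0"
        by (rule ctr_eq_0I) (use False \<xi> in \<open>auto simp: z'_def\<close>)
      moreover have "y \<sigma> = 0" using y(1) T(1) False by (auto simp: supp_on_def)
      ultimately show ?thesis by simp
    qed
  qed
  then show "\<exists>z\<in>supp_on B. ctr W \<xi> z = y" using z' by blast
qed

subsection \<open>Iterated exactness\<close>

lemma dim_supp_on:
  assumes "finite K"
  shows "fs.dim (supp_on K :: ('b \<Rightarrow> 'g::field) set) = card K"
proof (rule fs.dim_unique)
  show "(indicators K :: ('b \<Rightarrow> 'g) set) \<subseteq> supp_on K" by (auto simp: indicators_def supp_on_def split: if_splits)
  show "(supp_on K :: ('b \<Rightarrow> 'g) set) \<subseteq> fs.span (indicators K)" by (rule supp_on_span[OF assms])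
  define \<delta> :: "'b \<Rightarrow> 'b \<Rightarrow> 'g" where "\<delta> i = (\<lambda>x. if x = i then 1 else 0)" for i
  have ind: "indicators K = \<delta> ` K" by (simp add: indicators_def \<delta>_def[abs_def])
  have inj: "inj_on \<delta> K"
    by (rule inj_onI) (metis \<delta>_def zero_neq_one)
  show "card (indicators K :: ('b \<Rightarrow> 'g) set) = card K"
    unfolding ind by (rule card_image[OF inj])
  show "fs.independent (indicators K :: ('b \<Rightarrow> 'g) set)"
  proof (rule fs.independent_if_scalars_zero[OF finite_indicators[OF assms]])
    fix f :: "('b \<Rightarrow> 'g) \<Rightarrow> 'g" and v :: "'b \<Rightarrow> 'g"
    assume s: "(\<Sum>x\<in>indicators K. scl (f x) x) = 0" and v: "v \<in> indicators K"
    then obtain i where i: "i \<in> K" "v = \<delta> i" unfolding ind by blast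
    have "(\<Sum>x\<in>indicators K. scl (f x) x) = (\<Sum>j\<in>K. scl (f (\<delta> j)) (\<delta> j))"
      unfolding ind by (subst sum.reindex[OF inj]) (simp only: comp_def)
    then have "0 = (\<Sum>j\<in>K. scl (f (\<delta> j)) (\<delta> j)) i" unfolding s by (metis zero_fun_apply)
    also have "\<dots> = (\<Sum>j\<in>K. if i = j then f (\<delta> j) else 0)"
      unfolding sum_fun_apply by (rule sum.cong) (auto simp: scl_apply \<delta>_def)
    also have "\<dots> = f v" using i assms by (simp add: sum.delta)
    finally show "f v = 0" by simp
  qed
qed

lemma ctr_point:
  assumes "finite W" "v \<in> W"
  shows "ctr W (\<lambda>u. if u = v then 1 else 0) y \<tau> = (if v \<in> \<tau> then 0 else inv_sign W v \<tau> * y (insert v \<tau>))"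
proof (cases "v \<in> \<tau>")
  case True
  then show ?thesis by (simp, intro ctr_eq_0I) auto
next
  case False
  have "ctr W (\<lambda>u. if u = v then 1 else 0) y \<tau> =
      (\<Sum>u\<in>W - \<tau>. if u = v then inv_sign W v \<tau> * y (insert v \<tau>) else 0)"
    unfolding ctr_def by (rule sum.cong) auto
  then show ?thesis using False assms by (simp add: sum.delta)
qed

section \<open>Joint kernels and covectors in general position\<close>

definition joint_kernel :: "'a set \<Rightarrow> ('a \<Rightarrow> 'g::field) list \<Rightarrow> ('a set \<Rightarrow> 'g) set \<Rightarrow> ('a set \<Rightarrow> 'g) set" where
  "joint_kernel W \<xi>s V = {y \<in> V. \<forall>\<xi>\<in>set \<xi>s. ctr W \<xi> y = 0}"

lemma joint_kernel_Nil [simp]: "joint_kernel W [] V = V"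
  by (simp add: joint_kernel_def)

lemma joint_kernel_Cons: "joint_kernel W (\<xi> # \<xi>s) V = joint_kernel W \<xi>s (V \<inter> {y. ctr W \<xi> y = 0})"
  unfolding joint_kernel_def list.set by blast

text \<open>Chains on \<open>points Z\<close> are vectors with coordinates in \<open>Z\<close>, and
  contracting them evaluates the covector. Including these spaces among the generic ones expresses
  general position of the covectors on every vertex set \<open>Z\<close>.\<close>

definition points :: "'a set \<Rightarrow> 'a set set" where
  "points Z = (\<lambda>v. {v}) ` Z"

text \<open>Each covector lowers the dimension by one until it is zero, hence the truncated
  subtraction. A generic covector killing a non-zero \<open>V\<close> would force every coordinate
  functional to kill it as well.\<close>

lemma dim_generic_joint_kernel:
  fixes V :: "('a set \<Rightarrow> 'g::field) set"
  assumes W: "finite W" and "generic_list W \<V> \<xi>s" "V \<in> \<V>" "fs.subspace V" "V \<subseteq> supp_on (points W)"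
    "p \<le> length \<xi>s"
  shows "fs.dim (joint_kernel W (take p \<xi>s) V) = fs.dim V - p"
  using assms(2-)
proof (induction \<xi>s arbitrary: \<V> V p)
  case (Cons \<xi> \<xi>s)
  let ?V' = "V \<inter> {y. ctr W \<xi> y = 0}"
  show ?case
  proof (cases p)
    case 0 then show ?thesis by simp
  next
    case (Suc q)
    have "finite (points W)" using W by (simp add: points_def)
    then have fd: "V \<subseteq> fs.span (indicators (points W))" "finite (indicators (points W) :: ('a set \<Rightarrow> 'g) set)"
      using Cons.prems(4) supp_on_span finite_indicators by blast+
    have rn: "fs.dim V = fs.dim (ctr W \<xi> ` V) + fs.dim ?V'"
      by (rule fs.rank_nullity[OF ctr_linear Cons.prems(3) fd])
    have img: "ctr W \<xi> ` V \<subseteq> supp_on {{}}"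
    proof (rule image_subsetI)
      fix y assume "y \<in> V"
      then have "y \<in> supp_on (points W)" using Cons.prems(4) by blast
      then show "ctr W \<xi> y \<in> supp_on {{}}" by (rule ctr_supp_on) (auto simp: points_def)
    qed
    have fd0: "(supp_on {{}} :: ('a set \<Rightarrow> 'g) set) \<subseteq> fs.span (indicators {{}})"
      "finite (indicators {{}} :: ('a set \<Rightarrow> 'g) set)"
      by (simp_all add: supp_on_span finite_indicators)
    have le1: "fs.dim (ctr W \<xi> ` V) \<le> 1"
      using fs.dim_mono_fin[OF fd0 img] dim_supp_on[of "{{}} :: 'a set set", where 'g='g] by simp
    have ge1: "fs.dim (ctr W \<xi> ` V) \<ge> 1" if "fs.dim V \<ge> 1"
    proof (rule ccontr)
      assume "\<not> ?thesis"
      then have d0: "fs.dim (ctr W \<xi> ` V) = 0" by simp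
      have i0: "ctr W \<xi> ` V \<subseteq> {0}"
        by (rule fs.dim_eq_0_fin[OF subset_trans[OF img fd0(1)] fd0(2) d0])
      have "\<exists>y\<in>V. y \<noteq> 0"
      proof (rule ccontr)
        assume "\<not> ?thesis"
        then have "V \<subseteq> fs.span {}" by auto
        then show False using fs.dim_le_card[of V "{}"] that by simp
      qed
      then obtain y where y: "y \<in> V" "y \<noteq> 0" by blast
      then obtain \<sigma> where \<sigma>: "y \<sigma> \<noteq> 0" by (auto simp: fun_eq_iff)
      then obtain v where v: "v \<in> W" "\<sigma> = {v}"
        using y(1) Cons.prems(4) by (auto simp: supp_on_def points_def)
      define e :: "'a \<Rightarrow> 'g" where "e = (\<lambda>u. if u = v then 1 else 0)"
      have g: "\<forall>V\<in>\<V>. \<forall>\<eta>. \<forall>y\<in>V. ctr W \<xi> y = 0 \<longrightarrow> ctr W \<eta> y \<in> ctr W \<xi> ` V"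
        using Cons.prems(1) by simp
      have "ctr W \<xi> y = 0" using i0 y(1) by blast
      then have "ctr W e y \<in> ctr W \<xi> ` V" by (rule g[rule_format, OF Cons.prems(2) y(1)])
      then have "ctr W e y = 0" using i0 by blast
      then have "ctr W e y {} = 0" by simp
      then show False using \<sigma> v ctr_point[OF W v(1), of y "{}"] by (simp add: e_def)
    qed
    have d': "fs.dim ?V' = fs.dim V - 1" using rn le1 ge1 by linarith
    have gen: "generic_list W ((\<lambda>V. ctr W \<xi> ` V) ` \<V> \<union> (\<lambda>V. V \<inter> {y. ctr W \<xi> y = 0}) ` \<V>) \<xi>s"
      using Cons.prems(1) by simp
    have "fs.dim (joint_kernel W (take q \<xi>s) ?V') = fs.dim ?V' - q"
    proof (rule Cons.IH[OF gen])
      show "?V' \<in> (\<lambda>V. ctr W \<xi> ` V) ` \<V> \<union> (\<lambda>V. V \<inter> {y. ctr W \<xi> y = 0}) ` \<V>"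
        using Cons.prems(2) by blast
      show "fs.subspace ?V'" by (rule subspace_ctr_kernel[OF Cons.prems(3)])
      show "?V' \<subseteq> supp_on (points W)" using Cons.prems(4) by (rule le_infI1)
      show "q \<le> length \<xi>s" using Cons.prems(5) Suc by simp
    qed
    then show ?thesis using d' Suc by (simp add: joint_kernel_Cons)
  qed
qed simp

text \<open>The leading coefficient is 1, and \<open>l\<close> collects, with opposite sign, the
  pencil parameters met while the covectors \<open>q\<close>, ..., \<open>p - 1\<close> are
  processed.\<close>

definition affine_comb :: "('a \<Rightarrow> 'g::field) list \<Rightarrow> nat \<Rightarrow> nat \<Rightarrow> (nat \<Rightarrow> 'g) \<Rightarrow> 'a \<Rightarrow> 'g" where
  "affine_comb \<xi>s q p l = (\<lambda>v. (\<xi>s ! p) v + (\<Sum>j\<in>{q..<p}. l j * (\<xi>s ! j) v))"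

lemma ctr_affine_comb:
  "ctr W (affine_comb \<xi>s q p l) y = ctr W (\<xi>s ! p) y + (\<Sum>j\<in>{q..<p}. scl (l j) (ctr W (\<xi>s ! j) y))"
proof -
  have "ctr W (affine_comb \<xi>s q p l) y =
      ctr W (\<xi>s ! p) y + scl 1 (ctr W (\<lambda>v. \<Sum>j\<in>{q..<p}. l j * (\<xi>s ! j) v) y)"
    unfolding affine_comb_def
    using ctr_param_add[of W "\<xi>s ! p" 1 "\<lambda>v. \<Sum>j\<in>{q..<p}. l j * (\<xi>s ! j) v" y] by simp
  then show ?thesis by (simp only: ctr_param_sum fs.scale_one)
qed

text \<open>Suppose the combination vanishes on \<open>p + 1\<close> vertices \<open>Z\<close>. Then
  covector \<open>p\<close> depends on the earlier ones over \<open>Z\<close> and cuts out nothing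
  new, whereas the joint kernels of the first \<open>p\<close> and \<open>p + 1\<close> covectors
  there have dimensions 1 and 0. The bound is uniform in \<open>l\<close>.\<close>

lemma card_zeros_affine_comb:
  fixes \<xi>s :: "('a \<Rightarrow> 'g::field) list"
  assumes W: "finite W" and gen: "generic_list W \<V> \<xi>s" "\<And>Z. Z \<subseteq> W \<Longrightarrow> supp_on (points Z) \<in> \<V>"
    and p: "p < length \<xi>s"
  shows "card {v \<in> W. affine_comb \<xi>s 0 p l v = 0} \<le> p"
proof (rule ccontr)
  assume "\<not> ?thesis"
  then have "Suc p \<le> card {v \<in> W. affine_comb \<xi>s 0 p l v = 0}" by simp
  then obtain Z where Z: "Z \<subseteq> {v \<in> W. affine_comb \<xi>s 0 p l v = 0}" "card Z = Suc p"
    by (rule obtain_subset_with_card_n)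
  have ZW: "Z \<subseteq> W" using Z(1) by auto
  let ?F = "supp_on (points Z) :: ('a set \<Rightarrow> 'g) set"
  have FW: "?F \<subseteq> supp_on (points W)" by (rule supp_on_mono) (use ZW in \<open>auto simp: points_def\<close>)
  have finZ: "finite Z" using ZW W finite_subset by blast
  have "card (points Z) = Suc p"
    unfolding points_def using Z(2) by (subst card_image) auto
  then have dF: "fs.dim ?F = Suc p" using dim_supp_on[of "points Z"] finZ by (simp add: points_def)
  have dk: "fs.dim (joint_kernel W (take q \<xi>s) ?F) = Suc p - q" if "q \<le> length \<xi>s" for q
    using dim_generic_joint_kernel[OF W gen(1) gen(2)[OF ZW] subspace_supp_on FW that] dF by simp
  have fd: "?F \<subseteq> fs.span (indicators (points Z))" "finite (indicators (points Z) :: ('a set \<Rightarrow> 'g) set)"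
    using finZ by (simp_all add: supp_on_span finite_indicators points_def)
  have sub: "joint_kernel W \<zeta>s ?F \<subseteq> ?F" for \<zeta>s by (auto simp: joint_kernel_def)
  have "joint_kernel W (take (Suc p) \<xi>s) ?F \<subseteq> {0}"
    by (rule fs.dim_eq_0_fin[OF subset_trans[OF sub fd(1)] fd(2)]) (use dk p in simp)
  moreover have "\<not> joint_kernel W (take p \<xi>s) ?F \<subseteq> {0}"
  proof
    assume "joint_kernel W (take p \<xi>s) ?F \<subseteq> {0}"
    then have "joint_kernel W (take p \<xi>s) ?F \<subseteq> fs.span {}" by simp
    then have "fs.dim (joint_kernel W (take p \<xi>s) ?F) \<le> card ({} :: ('a set \<Rightarrow> 'g) set)"
      by (rule fs.dim_le_card) simp
    then show False using dk[of p] p by simp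
  qed
  moreover have "joint_kernel W (take p \<xi>s) ?F \<subseteq> joint_kernel W (take (Suc p) \<xi>s) ?F"
  proof
    fix y assume y: "y \<in> joint_kernel W (take p \<xi>s) ?F"
    have k: "ctr W (\<xi>s ! j) y = 0" if "j < p" for j
    proof -
      have "take p \<xi>s ! j \<in> set (take p \<xi>s)" by (rule nth_mem) (use that p in simp)
      then show ?thesis using y that by (simp add: joint_kernel_def)
    qed
    have "ctr W (affine_comb \<xi>s 0 p l) y = 0"
    proof
      fix \<tau>
      have "ctr W (affine_comb \<xi>s 0 p l) y \<tau> = 0"
        by (rule ctr_eq_0I) (use y Z(1) in \<open>auto simp: joint_kernel_def supp_on_def points_def\<close>)
      then show "ctr W (affine_comb \<xi>s 0 p l) y \<tau> = 0 \<tau>" by simp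
    qed
    moreover have "(\<Sum>j\<in>{0..<p}. scl (l j) (ctr W (\<xi>s ! j) y)) = 0"
      by (rule sum.neutral) (use k in \<open>auto simp: fs.scale_zero_right\<close>)
    ultimately have "ctr W (\<xi>s ! p) y = 0" unfolding ctr_affine_comb by simp
    then have "\<forall>\<xi>\<in>set (take (Suc p) \<xi>s). ctr W \<xi> y = 0"
      using y p by (simp add: take_Suc_conv_app_nth joint_kernel_def)
    then show "y \<in> joint_kernel W (take (Suc p) \<xi>s) ?F"
      using y by (simp add: joint_kernel_def)
  qed
  ultimately show False by blast
qed

text \<open>Exactness is inherited by the joint kernels, one covector at a time. The range of degrees shrinks by
  the number of zeros that general position allows for the affine combination.\<close>

lemma iterated_exact:
  fixes \<xi>s :: "('a \<Rightarrow> 'g::alg_closed_field) list"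
  assumes W: "finite W" "K \<subseteq> Pow W"
    and down: "\<And>\<sigma> \<tau>. \<sigma> \<in> K \<Longrightarrow> \<tau> \<subseteq> \<sigma> \<Longrightarrow> \<tau> \<in> K"
    and zero_set: "\<And>(\<xi> :: 'a \<Rightarrow> 'g) i. i + card {v \<in> W. \<xi> v = 0} < k \<Longrightarrow>
      ctr_exact W \<xi> {\<sigma> \<in> K. card \<sigma> = i} {\<sigma> \<in> K. card \<sigma> = Suc i}"
    and zeros: "\<And>p l. p < k \<Longrightarrow> card {v \<in> W. affine_comb \<xi>s 0 p l v = 0} \<le> p"
    and N: "\<And>q i. N q i = {y \<in> supp_on {\<sigma> \<in> K. card \<sigma> = i}. \<forall>j<q. ctr W (\<xi>s ! j) y = 0}"
    and "q \<le> p" "i + p < k" "y \<in> N q i" "ctr W (affine_comb \<xi>s q p l) y = 0"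
  shows "\<exists>z\<in>N q (Suc i). ctr W (affine_comb \<xi>s q p l) z = y"
  using assms(7-)
proof (induction q arbitrary: p i l y)
  case 0
  have "card {v \<in> W. affine_comb \<xi>s 0 p l v = 0} \<le> p" using zeros 0 by simp
  then have "ctr_exact W (affine_comb \<xi>s 0 p l) {\<sigma> \<in> K. card \<sigma> = i} {\<sigma> \<in> K. card \<sigma> = Suc i}"
    using 0 by (intro zero_set) simp
  moreover have "y \<in> supp_on {\<sigma> \<in> K. card \<sigma> = i}" using 0(3) by (simp add: N)
  ultimately obtain z where "z \<in> supp_on {\<sigma> \<in> K. card \<sigma> = Suc i}" "ctr W (affine_comb \<xi>s 0 p l) z = y"
    using 0(4) unfolding ctr_exact_def by blast
  then show ?case by (auto simp: N)
next
  case (Suc q)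
  let ?a = "ctr W (\<xi>s ! q)" and ?b = "ctr W (affine_comb \<xi>s (Suc q) p l)"
  have sub: "fs.subspace (N q i)" for q i
  proof -
    have "N q i = supp_on {\<sigma> \<in> K. card \<sigma> = i} \<inter> (\<Inter>j\<in>{..<q}. {y. ctr W (\<xi>s ! j) y = 0})"
      unfolding N by auto
    also have "fs.subspace \<dots>"
      by (intro fs.subspace_inter subspace_supp_on fs.subspace_Inter ballI)
        (auto intro: vector_space_pair.linear_subspace_kernel[OF fs.endomorphisms ctr_linear])
    finally show ?thesis .
  qed
  have finK: "finite K" using W finite_subset[of K "Pow W"] by simp
  have maps: "ctr W \<eta> x \<in> N q i" if "x \<in> N q (Suc i)" for \<eta> x q i
  proof -
    have "ctr W \<eta> x \<in> supp_on {\<sigma> \<in> K. card \<sigma> = i}"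
    proof (rule ctr_supp_on)
      show "x \<in> supp_on {\<sigma> \<in> K. card \<sigma> = Suc i}" using that by (simp add: N)
      fix v \<tau> assume v: "v \<notin> \<tau>" "insert v \<tau> \<in> {\<sigma> \<in> K. card \<sigma> = Suc i}"
      then have "insert v \<tau> \<subseteq> W" using W(2) by auto
      then have "finite (insert v \<tau>)" using W(1) by (rule finite_subset)
      then show "\<tau> \<in> {\<sigma> \<in> K. card \<sigma> = i}" using v down[of "insert v \<tau>" \<tau>] by auto
    qed
    moreover have "ctr W (\<xi>s ! j) (ctr W \<eta> x) = 0" if "j < q" for j
    proof -
      have "ctr W (\<xi>s ! j) x = 0" using \<open>x \<in> N q (Suc i)\<close> that by (simp add: N)
      then show ?thesis using ctr_anticommute[OF W(1), of "\<xi>s ! j" \<eta> x] by simp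
    qed
    ultimately show ?thesis by (simp add: N)
  qed
  have "\<exists>w\<in>N q (Suc (Suc i)). y = ?b (?a w)"
  proof (rule pencil_exact[where P="N q (Suc (Suc i))" and Q="N q (Suc i)" and R="N q i",
        OF ctr_linear ctr_linear sub sub sub])
    show "?a ` N q (Suc (Suc i)) \<subseteq> N q (Suc i)" "?b ` N q (Suc (Suc i)) \<subseteq> N q (Suc i)"
      "?a ` N q (Suc i) \<subseteq> N q i" "?b ` N q (Suc i) \<subseteq> N q i" using maps by blast+
    show "?a (?a x) = 0" "?b (?b x) = 0" for x by (rule ctr_square[OF W(1)])+
    show "?a (?b x) = - ?b (?a x)" for x by (rule ctr_anticommute[OF W(1)])
    show "x \<in> ?a ` N q (Suc (Suc i))" if x: "x \<in> N q (Suc i)" "?a x = 0" for x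
    proof -
      \<comment> \<open>Exactness of \<open>?a\<close> is the induction hypothesis with
        \<open>p\<close> replaced by \<open>q\<close>: the degree rises by one, and
        \<open>q < p\<close> makes up for it.\<close>
      have q: "affine_comb \<xi>s q q l = \<xi>s ! q" by (simp add: affine_comb_def)
      have "\<exists>z\<in>N q (Suc (Suc i)). ctr W (affine_comb \<xi>s q q l) z = x"
        by (rule Suc.IH) (use Suc.prems x q in auto)
      then show ?thesis unfolding q by blast
    qed
    show "\<exists>w\<in>N q (Suc i). x = ?b w - scl c (?a w)"
      if x: "x \<in> N q i" "?b x - scl c (?a x) = 0" for c x
    proof -
      \<comment> \<open>Every member \<open>?b - c ?a\<close> of the pencil is again an affine
        combination starting at \<open>q\<close>. This is why the induction is over all coefficients
        \<open>l\<close>.\<close>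
      have eq: "ctr W (affine_comb \<xi>s q p (l(q := - c))) u = ?b u - scl c (?a u)" for u
      proof -
        have "{q..<p} = insert q {Suc q..<p}" using Suc.prems(1) by auto
        then have "ctr W (affine_comb \<xi>s q p (l(q := - c))) u = ctr W (\<xi>s ! p) u + (scl (- c) (?a u) +
            (\<Sum>j\<in>{Suc q..<p}. scl ((l(q := - c)) j) (ctr W (\<xi>s ! j) u)))"
          unfolding ctr_affine_comb by simp
        also have "(\<Sum>j\<in>{Suc q..<p}. scl ((l(q := - c)) j) (ctr W (\<xi>s ! j) u)) =
            (\<Sum>j\<in>{Suc q..<p}. scl (l j) (ctr W (\<xi>s ! j) u))" by (rule sum.cong) auto
        finally show ?thesis
          unfolding ctr_affine_comb fs.scale_minus_left
          by (simp only: diff_conv_add_uminus add.assoc add.left_commute add.commute)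
      qed
      have "\<exists>z\<in>N q (Suc i). ctr W (affine_comb \<xi>s q p (l(q := - c))) z = x"
      proof (rule Suc.IH)
        show "ctr W (affine_comb \<xi>s q p (l(q := - c))) x = 0" unfolding eq by (rule x(2))
      qed (use Suc.prems x(1) in auto)
      then show ?thesis unfolding eq by blast
    qed
    have "N q i \<subseteq> supp_on K" by (auto simp: N supp_on_def)
    then show "N q i \<subseteq> fs.span (indicators K)" using supp_on_span[OF finK] by blast
    show "finite (indicators K)" by (rule finite_indicators[OF finK])
    show "y \<in> N q i" "?a y = 0" using Suc.prems(3) by (simp_all add: N less_Suc_eq)
    show "?b y = 0" by fact
  qed
  then obtain w where w: "w \<in> N q (Suc (Suc i))" "y = ?b (?a w)" by blast
  \<comment> \<open>The preimage under \<open>?b\<close> is \<open>?a w\<close>, two contractions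
    below \<open>y\<close>'s preimage \<open>w\<close>; being a contraction by covector
    \<open>q\<close>, it lies in the smaller joint kernel.\<close>
  have "?a w \<in> N q (Suc i)" using maps w(1) by blast
  moreover have "?a (?a w) = 0" by (rule ctr_square[OF W(1)])
  ultimately have "?a w \<in> N (Suc q) (Suc i)" by (simp add: N less_Suc_eq)
  then show ?case using w(2) by blast
qed

section \<open>Extending the faces of the shifted complex\<close>

lemma shift_family_peel_kernel:
  assumes "S \<in> shift_family W k \<xi>s V" "S \<inter> {k..<k + p} = {}" "p \<le> length \<xi>s"
  shows "S \<in> shift_family W (k + p) (drop p \<xi>s) (joint_kernel W (take p \<xi>s) V)"
  using assms
proof (induction p arbitrary: k \<xi>s V)
  case (Suc p)
  then obtain \<xi> \<zeta>s where \<xi>s: "\<xi>s = \<xi> # \<zeta>s" by (cases \<xi>s) auto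
  have "k \<notin> S" using Suc.prems(2) by auto
  then have "S \<in> shift_family W (Suc k) \<zeta>s (V \<inter> {y. ctr W \<xi> y = 0})"
    using Suc.prems(1) unfolding \<xi>s shift_family.simps by blast
  then have "S \<in> shift_family W (Suc k + p) (drop p \<zeta>s)
      (joint_kernel W (take p \<zeta>s) (V \<inter> {y. ctr W \<xi> y = 0}))"
    by (rule Suc.IH) (use Suc.prems \<xi>s in auto)
  then show ?case by (simp add: \<xi>s joint_kernel_Cons)
qed simp

text \<open>Following the image branch \<open>p\<close> times adds the whole segment. It is the
  counterpart of \<open>shift_family_peel_kernel\<close>, where a set avoiding the segment follows
  the kernel branch \<open>p\<close> times.\<close>

lemma shift_family_peel_image:
  assumes "S \<in> shift_family W (k + p) (drop p \<xi>s) (fold (\<lambda>\<xi> U. ctr W \<xi> ` U) (take p \<xi>s) V)"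
    "p \<le> length \<xi>s"
  shows "S \<union> {k..<k + p} \<in> shift_family W k \<xi>s V"
  using assms
proof (induction p arbitrary: k \<xi>s V)
  case (Suc p)
  then obtain \<xi> \<zeta>s where \<xi>s: "\<xi>s = \<xi> # \<zeta>s" by (cases \<xi>s) auto
  have "S \<union> {Suc k..<Suc k + p} \<in> shift_family W (Suc k) \<zeta>s (ctr W \<xi> ` V)"
    by (rule Suc.IH) (use Suc.prems \<xi>s in auto)
  then have "insert k (S \<union> {Suc k..<Suc k + p}) \<in> shift_family W k \<xi>s V"
    by (simp add: \<xi>s)
  moreover have "insert k (S \<union> {Suc k..<Suc k + p}) = S \<union> {k..<k + Suc p}" by auto
  ultimately show ?case by simp
qed simp

text \<open>The faces of the shifted complex extend to cardinality \<open>k\<close>: the part of a face outside a suitable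
  initial segment \<open>{..<p}\<close> has \<open>k - p\<close> elements, and joint kernel vectors of that degree are iterated
  contractions, so that the whole segment can be added.\<close>

lemma shift_family_extend:
  assumes C: "\<And>i. C i = supp_on {\<sigma> \<in> K. card \<sigma> = i}"
    and exact: "\<And>p i y. i + p < k \<Longrightarrow> y \<in> joint_kernel W (take p \<xi>s) (C i) \<Longrightarrow> ctr W (\<xi>s ! p) y = 0 \<Longrightarrow>
      \<exists>z\<in>joint_kernel W (take p \<xi>s) (C (Suc i)). ctr W (\<xi>s ! p) z = y"
    and k: "k \<le> length \<xi>s"
    and down: "\<And>i S T. S \<in> shift_family W 0 \<xi>s (C i) \<Longrightarrow> T \<subseteq> S \<Longrightarrow> T \<in> shift_family W 0 \<xi>s (C (card T))"
    and deg: "\<And>i S. S \<in> shift_family W 0 \<xi>s (C i) \<Longrightarrow> card S = i"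
    and S: "S \<in> shift_family W 0 \<xi>s (C i)" "i \<le> k"
  shows "\<exists>T \<in> shift_family W 0 \<xi>s (C k). S \<subseteq> T"
proof -
  \<comment> \<open>Each covector is undone by \<open>exact\<close> inside the kernel of its
    predecessors, raising the degree by one. The last use has degree plus covector index at most
    \<open>k - 1\<close>, just within range.\<close>
  have img: "joint_kernel W (take p \<xi>s) (C a) \<subseteq> fold (\<lambda>\<xi> U. ctr W \<xi> ` U) (take p \<xi>s) (C (a + p))"
    if "a + p \<le> k" for p a
    using that
  proof (induction p arbitrary: a)
    case (Suc p)
    have p: "p < length \<xi>s" using Suc.prems k by simp
    show ?case
    proof
      fix y assume y: "y \<in> joint_kernel W (take (Suc p) \<xi>s) (C a)"
      then have "y \<in> joint_kernel W (take p \<xi>s) (C a)" "ctr W (\<xi>s ! p) y = 0"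
        using p by (simp_all add: joint_kernel_def take_Suc_conv_app_nth)
      then obtain z where z: "z \<in> joint_kernel W (take p \<xi>s) (C (Suc a))" "ctr W (\<xi>s ! p) z = y"
        using exact[of a p y] Suc.prems by auto
      have "z \<in> fold (\<lambda>\<xi> U. ctr W \<xi> ` U) (take p \<xi>s) (C (Suc a + p))"
        using Suc.IH[of "Suc a"] Suc.prems z(1) by auto
      then have "y \<in> ctr W (\<xi>s ! p) ` fold (\<lambda>\<xi> U. ctr W \<xi> ` U) (take p \<xi>s) (C (a + Suc p))"
        using z(2) by auto
      then show "y \<in> fold (\<lambda>\<xi> U. ctr W \<xi> ` U) (take (Suc p) \<xi>s) (C (a + Suc p))"
        using p by (simp add: take_Suc_conv_app_nth)
    qed
  qed simp
  have fin: "finite S" using shift_family_bounds[OF S(1)] finite_subset by blast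
  have cS: "card S = i" by (rule deg[OF S(1)])
  \<comment> \<open>From \<open>p\<close> to \<open>p + 1\<close> this grows by 0 if
    \<open>p \<in> S\<close> and by 1 otherwise. Starting at \<open>card S \<le> k\<close>, it
    therefore takes the value \<open>k\<close> exactly.\<close>
  define g where "g p = card (S - {..<p}) + p" for p
  define p where "p = (LEAST p. k \<le> g p)"
  have "k \<le> g k" by (simp add: g_def)
  then have kp: "k \<le> g p" unfolding p_def by (rule LeastI)
  have "g p \<le> k"
  proof (cases p)
    case 0 then show ?thesis using S(2) cS by (simp add: g_def)
  next
    case (Suc q)
    then have "\<not> k \<le> g q" using not_less_Least[of q "\<lambda>p. k \<le> g p"] by (simp add: p_def)
    moreover have "card (S - {..<Suc q}) \<le> card (S - {..<q})"
      by (rule card_mono) (use fin in auto)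
    ultimately show ?thesis using Suc by (simp add: g_def)
  qed
  then have gp: "card (S - {..<p}) + p = k" using kp by (simp add: g_def)
  let ?I = "S - {..<p}"
  have pk: "p \<le> length \<xi>s" using gp k by simp
  have "?I \<in> shift_family W 0 \<xi>s (C (card ?I))" by (rule down[OF S(1)]) auto
  then have "?I \<in> shift_family W (0 + p) (drop p \<xi>s) (joint_kernel W (take p \<xi>s) (C (card ?I)))"
    by (rule shift_family_peel_kernel) (use pk in auto)
  then have "?I \<in> shift_family W (0 + p) (drop p \<xi>s) (fold (\<lambda>\<xi> U. ctr W \<xi> ` U) (take p \<xi>s) (C k))"
    using shift_family_mono[OF img[of "card ?I" p]] gp by auto
  then have "?I \<union> {0..<0 + p} \<in> shift_family W 0 \<xi>s (C k)"
    by (rule shift_family_peel_image) (rule pk)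
  moreover have "S \<subseteq> ?I \<union> {0..<0 + p}" by auto
  ultimately show ?thesis by blast
qed

text \<open>As many generic covectors as vertices span all covectors on \<open>W\<close>, since a
  functional vanishing on them would give a non-zero degree-one chain in a zero joint kernel. So
  \<open>y\<close> is killed by every coordinate covector, and these read off all its coefficients
  at non-empty sets.\<close>

lemma generic_list_spans:
  fixes \<xi>s :: "('a \<Rightarrow> 'g::field) list"
  assumes W: "finite W" and gen: "generic_list W \<V> \<xi>s" "supp_on (points W) \<in> \<V>"
    and len: "length \<xi>s = card W"
    and y: "y \<in> supp_on (Pow W)" "\<forall>\<xi>\<in>set \<xi>s. ctr W \<xi> y = 0" "\<sigma> \<noteq> {}"
  shows "y \<sigma> = 0"
proof -
  let ?F = "supp_on (points W) :: ('a set \<Rightarrow> 'g) set"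
  have "card (points W) = card W" unfolding points_def by (rule card_image) simp
  then have "fs.dim (joint_kernel W \<xi>s ?F) = 0"
    using dim_generic_joint_kernel[OF W gen subspace_supp_on order_refl, of "length \<xi>s"]
      dim_supp_on[of "points W", where 'g='g] W len by (simp add: points_def)
  moreover have "joint_kernel W \<xi>s ?F \<subseteq> fs.span (indicators (points W))"
    using supp_on_span[of "points W"] W by (auto simp: joint_kernel_def points_def)
  ultimately have jk: "joint_kernel W \<xi>s ?F \<subseteq> {0}"
    using fs.dim_eq_0_fin finite_indicators[of "points W"] W by (metis finite_imageI points_def)
  define res where "res \<xi> = (\<lambda>u. if u \<in> W then \<xi> u else 0)" for \<xi> :: "'a \<Rightarrow> 'g"
  define e where "e v = (\<lambda>u. if u = v then 1 else 0 :: 'g)" for v :: 'a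
  have span: "e v \<in> fs.span (res ` set \<xi>s)" if v: "v \<in> W" for v
  proof (rule ccontr)
    assume "e v \<notin> fs.span (res ` set \<xi>s)"
    then obtain \<phi> where \<phi>: "Vector_Spaces.linear scl (*) \<phi>" "\<forall>x\<in>fs.span (res ` set \<xi>s). \<phi> x = 0" "\<phi> (e v) = 1"
      using fs.separating_functional[OF fs.subspace_span] by metis
    interpret \<phi>: Vector_Spaces.linear scl "(*)" \<phi> by (rule \<phi>(1))
    \<comment> \<open>The functional \<open>\<phi>\<close> on covectors, rewritten as a vector: its
      coordinate at \<open>{u}\<close> is the value of \<open>\<phi>\<close> at the unit covector
      \<open>e u\<close>.\<close>
    define w where "w = (\<lambda>\<tau>. if \<tau> \<in> points W then \<phi> (e (the_elem \<tau>)) else 0)"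
    have wF: "w \<in> ?F" by (auto simp: w_def supp_on_def)
    have "ctr W \<xi> w = 0" if "\<xi> \<in> set \<xi>s" for \<xi>
    proof
      fix \<tau>
      show "ctr W \<xi> w \<tau> = 0 \<tau>"
      proof (cases "\<tau> = {}")
        case True
        have "ctr W \<xi> w \<tau> = (\<Sum>u\<in>W. \<xi> u * \<phi> (e u))"
          unfolding ctr_def True by (rule sum.cong) (auto simp: w_def points_def inv_sign_def)
        also have "\<dots> = \<phi> (\<Sum>u\<in>W. scl (\<xi> u) (e u))" by (simp add: \<phi>.sum \<phi>.scale)
        also have "(\<Sum>u\<in>W. scl (\<xi> u) (e u)) = res \<xi>"
        proof
          fix x
          have "(\<Sum>u\<in>W. scl (\<xi> u) (e u)) x = (\<Sum>u\<in>W. if x = u then \<xi> u else 0)"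
            unfolding sum_fun_apply by (rule sum.cong) (auto simp: scl_apply e_def)
          then show "(\<Sum>u\<in>W. scl (\<xi> u) (e u)) x = res \<xi> x" using W by (simp add: res_def)
        qed
        also have "\<phi> (res \<xi>) = 0" using \<phi>(2) that by (auto intro: fs.span_base)
        finally show ?thesis by simp
      next
        case False
        have "ctr W \<xi> w \<tau> = 0"
          by (rule ctr_eq_0I) (use False in \<open>auto simp: w_def points_def\<close>)
        then show ?thesis by simp
      qed
    qed
    then have "w \<in> joint_kernel W \<xi>s ?F" using wF by (simp add: joint_kernel_def)
    then have "w = 0" using jk by blast
    then have "w {v} = 0" by simp
    then show False using \<phi>(3) v by (auto simp: w_def points_def)
  qed
  show ?thesis
  proof (rule ccontr)
    assume s: "y \<sigma> \<noteq> 0"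
    then obtain v where v: "v \<in> \<sigma>" "v \<in> W" using y(1,3) by (auto simp: supp_on_def)
    have sub: "fs.subspace {\<eta>. ctr W \<eta> y = 0}"
      by (auto simp: fs.subspace_def fun_eq_iff ctr_def scl_apply algebra_simps sum.distrib sum_distrib_left[symmetric])
    have "res ` set \<xi>s \<subseteq> {\<eta>. ctr W \<eta> y = 0}"
    proof (rule image_subsetI, rule CollectI)
      fix \<xi> assume "\<xi> \<in> set \<xi>s"
      then have "ctr W \<xi> y = 0" using y(2) by blast
      moreover have "ctr W (res \<xi>) y = ctr W \<xi> y" by (rule ctr_param_cong) (simp add: res_def)
      ultimately show "ctr W (res \<xi>) y = 0" by (rule trans[rotated])
    qed
    then have "fs.span (res ` set \<xi>s) \<subseteq> {\<eta>. ctr W \<eta> y = 0}" using sub by (rule fs.span_minimal)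
    then have "ctr W (e v) y = 0" using span[OF v(2)] by blast
    then have "ctr W (e v) y (\<sigma> - {v}) = 0" by simp
    then show False using ctr_point[OF W v(2), of y "\<sigma> - {v}"] v s by (simp add: e_def insert_absorb)
  qed
qed

subsection \<open>The Erdos-Ko-Rado bound\<close>

text \<open>In a finite field, adding 1 to the product of \<open>X - a\<close> over all elements
  \<open>a\<close> gives a non-constant polynomial without a root.\<close>

lemma infinite_alg_closed: "infinite (UNIV :: 'g::alg_closed_field set)"
proof
  assume fin: "finite (UNIV :: 'g set)"
  define p where "p = (\<Prod>a\<in>(UNIV :: 'g set). [:- a, 1:])"
  have pp: "poly p x = 0" for x
    unfolding p_def poly_prod by (rule prod_zero[OF fin]) (auto intro: bexI[of _ x])
  have "p \<noteq> 0" using fin by (simp add: p_def)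
  have "Polynomial.degree (p + 1) > 0"
  proof (rule ccontr)
    assume "\<not> Polynomial.degree (p + 1) > 0"
    then obtain c where "p + 1 = [:c:]" using degree_eq_zeroE by blast
    then have "p = [:c - 1:]" by (metis add_diff_cancel_right' diff_pCons diff_zero one_pCons)
    then show False using pp[of 0] \<open>p \<noteq> 0\<close> by auto
  qed
  then obtain x where "poly (p + 1) x = 0" using alg_closed_imp_poly_has_root by blast
  then show False using pp[of x] by simp
qed

text \<open>The equation \<open>ctr W \<xi> y = 0\<close> at \<open>\<sigma> - {v}\<close> expresses
  the coefficient at a set \<open>\<sigma>\<close> containing \<open>v\<close> through coefficients
  at sets avoiding \<open>v\<close>. So forgetting the faces through \<open>v\<close> is injective
  on \<open>U\<close>.\<close>

lemma dim_contraction_le: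
  fixes \<xi> :: "'a \<Rightarrow> 'g::field"
  assumes W: "finite W" "K \<subseteq> Pow W" and v: "v \<in> W" "\<xi> v \<noteq> 0"
    and U: "fs.subspace U" "U \<subseteq> supp_on K" "\<And>y. y \<in> U \<Longrightarrow> ctr W \<xi> y = 0"
  shows "fs.dim U \<le> card {\<sigma> \<in> K. v \<notin> \<sigma>}"
proof -
  have finK: "finite K" using W finite_subset[of K "Pow W"] by simp
  define \<rho> where "\<rho> y = (\<lambda>\<sigma>. if v \<in> \<sigma> then 0 else y \<sigma>)" for y :: "'a set \<Rightarrow> 'g"
  have lin: "Vector_Spaces.linear scl scl \<rho>"
    by unfold_locales (auto simp: \<rho>_def fun_eq_iff scl_apply)
  have UB: "U \<subseteq> fs.span (indicators K)" using U(2) supp_on_span[OF finK] by blast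
  have "U \<inter> {y. \<rho> y = 0} \<subseteq> fs.span {}"
  proof
    fix y assume y: "y \<in> U \<inter> {y. \<rho> y = 0}"
    have y0: "y \<sigma> = 0" if "v \<notin> \<sigma>" for \<sigma>
    proof -
      have "\<rho> y \<sigma> = 0" using y by simp
      then show ?thesis using that by (simp add: \<rho>_def)
    qed
    have "y \<sigma> = 0" for \<sigma>
    proof (cases "v \<in> \<sigma>")
      case True
      let ?\<tau> = "\<sigma> - {v}"
      have "ctr W \<xi> y ?\<tau> = (\<Sum>u\<in>W - ?\<tau>. if u = v then \<xi> v * inv_sign W v ?\<tau> * y \<sigma> else 0)"
        unfolding ctr_def
      proof (rule sum.cong[OF refl])
        fix u assume "u \<in> W - ?\<tau>"
        show "\<xi> u * inv_sign W u ?\<tau> * y (insert u ?\<tau>) = (if u = v then \<xi> v * inv_sign W v ?\<tau> * y \<sigma> else 0)"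
        proof (cases "u = v")
          case True
          then show ?thesis using \<open>v \<in> \<sigma>\<close> by (simp add: insert_absorb)
        next
          case False
          then have "y (insert u ?\<tau>) = 0" by (intro y0) simp
          then show ?thesis using False by simp
        qed
      qed
      also have "\<dots> = \<xi> v * inv_sign W v ?\<tau> * y \<sigma>" using W(1) v(1) by (simp add: sum.delta)
      finally have "\<xi> v * inv_sign W v ?\<tau> * y \<sigma> = 0" using U(3) y by simp
      then show ?thesis using v(2) by simp
    qed (rule y0)
    then have "y = 0" by (simp add: fun_eq_iff)
    then show "y \<in> fs.span {}" by simp
  qed
  then have "fs.dim (U \<inter> {y. \<rho> y = 0}) \<le> card ({} :: ('a set \<Rightarrow> 'g) set)"
    by (rule fs.dim_le_card) simp
  then have "fs.dim (U \<inter> {y. \<rho> y = 0}) = 0" by simp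
  then have "fs.dim U = fs.dim (\<rho> ` U)"
    using fs.rank_nullity[OF lin U(1) UB finite_indicators[OF finK]] by simp
  also have "\<dots> \<le> fs.dim (supp_on {\<sigma> \<in> K. v \<notin> \<sigma>} :: ('a set \<Rightarrow> 'g) set)"
  proof (rule fs.dim_mono_fin)
    show "(supp_on {\<sigma> \<in> K. v \<notin> \<sigma>} :: ('a set \<Rightarrow> 'g) set) \<subseteq> fs.span (indicators {\<sigma> \<in> K. v \<notin> \<sigma>})"
      using finK by (intro supp_on_span) simp
    show "finite (indicators {\<sigma> \<in> K. v \<notin> \<sigma>} :: ('a set \<Rightarrow> 'g) set)"
      using finK by (intro finite_indicators) simp
    show "\<rho> ` U \<subseteq> supp_on {\<sigma> \<in> K. v \<notin> \<sigma>}"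
      using U(2) by (auto simp: supp_on_def \<rho>_def split: if_splits)
  qed
  also have "\<dots> = card {\<sigma> \<in> K. v \<notin> \<sigma>}" using finK by (intro dim_supp_on) simp
  finally show ?thesis .
qed

lemma exact_EKR:
  assumes W: "finite W" "K \<subseteq> Pow W" "v0 \<in> W"
    and down: "\<And>\<sigma> \<tau>. \<sigma> \<in> K \<Longrightarrow> \<tau> \<subseteq> \<sigma> \<Longrightarrow> \<tau> \<in> K"
    and zero_set: "\<And>(\<xi> :: 'a \<Rightarrow> 'g::alg_closed_field) i. i + card {v \<in> W. \<xi> v = 0} < k \<Longrightarrow>
      ctr_exact W \<xi> {\<sigma> \<in> K. card \<sigma> = i} {\<sigma> \<in> K. card \<sigma> = Suc i}"
    and A: "A \<subseteq> K" "\<And>\<sigma>. \<sigma> \<in> A \<Longrightarrow> card \<sigma> = r" "intersecting A"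
    and r: "r \<ge> 1" "2 * r \<le> k" and kW: "k \<le> card W"
  shows "card A \<le> card {\<sigma> \<in> K. card \<sigma> = r - 1 \<and> v0 \<notin> \<sigma>}"
proof -
  define C :: "nat \<Rightarrow> ('a set \<Rightarrow> 'g) set" where "C i = supp_on {\<sigma> \<in> K. card \<sigma> = i}" for i
  \<comment> \<open>The span of \<open>A\<close> and the chain spaces are made generic so that their
    shifted families are shifted; the spaces on \<open>points Z\<close> put the covectors in general
    position.\<close>
  define \<V> :: "('a set \<Rightarrow> 'g) set set" where
    "\<V> = {supp_on A} \<union> C ` {..card W} \<union> (\<lambda>Z. supp_on (points Z)) ` Pow W"
  have "\<exists>\<xi>s. length \<xi>s = card W \<and> generic_list W \<V> \<xi>s"
  proof (rule generic_list_exists[OF W(1) infinite_alg_closed])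
    show "finite \<V>" using W(1) by (simp add: \<V>_def)
    show "fs.subspace V" if "V \<in> \<V>" for V
      using that subspace_supp_on by (auto simp: \<V>_def C_def)
    show "V \<subseteq> supp_on (Pow W)" if "V \<in> \<V>" for V
      using that W(2) A(1) by (auto simp: \<V>_def C_def supp_on_def points_def)
  qed
  then obtain \<xi>s :: "('a \<Rightarrow> 'g) list" where len: "length \<xi>s = card W" and gen: "generic_list W \<V> \<xi>s" by blast
  have points: "supp_on (points Z) \<in> \<V>" if "Z \<subseteq> W" for Z using that by (auto simp: \<V>_def)
  have zeros: "card {v \<in> W. affine_comb \<xi>s 0 p l v = 0} \<le> p" if "p < card W" for p l
    by (rule card_zeros_affine_comb[OF W(1) gen points]) (use that len in auto)
  define N where "N q i = {y \<in> supp_on {\<sigma> \<in> K. card \<sigma> = i}. \<forall>j<q. ctr W (\<xi>s ! j) y = 0}" for q i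
  have jk: "joint_kernel W (take p \<xi>s) (C i) = N p i" if "p \<le> card W" for p i
  proof -
    have "set (take p \<xi>s) = (\<lambda>j. \<xi>s ! j) ` {0..<p}"
      using that len by (intro nth_image[symmetric]) simp
    then show ?thesis by (auto simp: joint_kernel_def C_def N_def)
  qed
  have exact: "\<exists>z\<in>joint_kernel W (take p \<xi>s) (C (Suc i)). ctr W (\<xi>s ! p) z = y"
    if i: "i + p < k" and y: "y \<in> joint_kernel W (take p \<xi>s) (C i)" "ctr W (\<xi>s ! p) y = 0" for p i y
  proof -
    have p: "p \<le> card W" using i kW by simp
    have aff: "affine_comb \<xi>s p p l = \<xi>s ! p" for l by (simp add: affine_comb_def)
    have "\<exists>z\<in>N p (Suc i). ctr W (affine_comb \<xi>s p p (\<lambda>_. 0)) z = y"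
    proof (rule iterated_exact[OF W(1,2) down zero_set _ N_def order_refl i])
      show "card {v \<in> W. affine_comb \<xi>s 0 p l v = 0} \<le> p" if "p < k" for p l
        using zeros that kW by simp
      show "y \<in> N p i" using y(1) jk[OF p] by simp
      show "ctr W (affine_comb \<xi>s p p (\<lambda>_. 0)) y = 0" unfolding aff by (rule y(2))
    qed
    then show ?thesis unfolding aff jk[OF p] .
  qed
  let ?S = "\<lambda>V. shift_family W 0 \<xi>s V"
  have hom: "homogeneous W i (C i)" for i
    using W(2) by (auto simp: homogeneous_def C_def supp_on_def)
  have deg: "card S = i" if "S \<in> ?S (C i)" for S i
    by (rule shift_family_degree[OF W(1) hom that])
  have fin: "finite S" if "S \<in> ?S V" for S V
    using shift_family_bounds[OF that] finite_subset by blast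
  have ctrC: "ctr W \<xi> ` C (Suc i) \<subseteq> C i" for \<xi> i
  proof (rule image_subsetI)
    fix y assume "y \<in> C (Suc i)"
    then have y: "y \<in> supp_on {\<sigma> \<in> K. card \<sigma> = Suc i}" by (simp add: C_def)
    show "ctr W \<xi> y \<in> C i"
      unfolding C_def
    proof (rule ctr_supp_on[OF y])
      fix v \<tau> assume v: "v \<notin> \<tau>" "insert v \<tau> \<in> {\<sigma> \<in> K. card \<sigma> = Suc i}"
      then have "insert v \<tau> \<subseteq> W" using W(2) by auto
      then have "finite (insert v \<tau>)" using W(1) by (rule finite_subset)
      then show "\<tau> \<in> {\<sigma> \<in> K. card \<sigma> = i}" using v down[of "insert v \<tau>" \<tau>] by auto
    qed
  qed
  have remove: "S - {x} \<in> ?S (C (card (S - {x})))" if S: "S \<in> ?S (C (card S))" for S x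
  proof (cases "x \<in> S")
    case True
    have "card S = Suc (card (S - {x}))" using fin[OF S] True by (rule card.remove)
    then have "ctr W \<xi> ` C (card S) \<subseteq> C (card (S - {x}))" for \<xi> using ctrC by simp
    then show ?thesis using S True by (rule shift_family_remove[OF W(1)])
  next
    case False then show ?thesis using S by simp
  qed
  have downS: "T \<in> ?S (C (card T))" if S: "S \<in> ?S (C i)" and T: "T \<subseteq> S" for S T i
  proof -
    have rem: "finite R \<Longrightarrow> S - R \<in> ?S (C (card (S - R)))" for R
    proof (induction R rule: finite_induct)
      case empty then show ?case using S deg[OF S] by simp
    next
      case (insert x R)
      have "S - insert x R = (S - R) - {x}" by auto
      then show ?case using remove[OF insert.IH, of x] by (simp only:)
    qed
    have "S - (S - T) \<in> ?S (C (card (S - (S - T))))"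
      by (rule rem) (use fin[OF S] in simp)
    moreover have "S - (S - T) = T" using T by auto
    ultimately show ?thesis by simp
  qed
  define D where "D = {S. S \<in> ?S (C (card S))}"
  have DI: "S \<in> D" if "S \<in> ?S (C i)" for S i using that deg[OF that] by (simp add: D_def)
  have Dn: "D \<subseteq> Pow {..<card W}"
    using shift_family_bounds[of _ W 0 \<xi>s] len by (fastforce simp: D_def)
  have shiftD: "shifted D"
    unfolding shifted_def
  proof (intro ballI allI impI)
    fix S i assume S: "S \<in> D" "Suc i \<in> S \<and> i \<notin> S"
    have "S \<subseteq> {..<card W}" using S(1) Dn by auto
    then have "card S \<le> card W" using card_mono[of "{..<card W}" S] by simp
    then have "C (card S) \<in> \<V>" by (simp add: \<V>_def)
    then have "insert i (S - {Suc i}) \<in> ?S (C (card S))"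
      using S by (intro shift_family_shifted[OF W(1) gen]) (auto simp: D_def)
    then show "insert i (S - {Suc i}) \<in> D" by (rule DI)
  qed
  have ext: "\<exists>T\<in>D. S \<subseteq> T \<and> card T = 2 * r" if S: "S \<in> D" "card S \<le> 2 * r" for S
  proof -
    have "\<exists>T\<in>?S (C k). S \<subseteq> T"
      by (rule shift_family_extend[where i="card S", OF C_def exact _ downS deg]) (use S r kW len in \<open>auto simp: D_def\<close>)
    then obtain T where T: "T \<in> ?S (C k)" "S \<subseteq> T" by blast
    obtain T' where T': "S \<subseteq> T'" "T' \<subseteq> T" "card T' = 2 * r"
      using exists_subset_between[of S "2 * r" T] S(2) T deg[OF T(1)] r(2) fin[OF T(1)] by auto
    have "T' \<in> D" using downS[OF T(1) T'(2)] by (rule DI)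
    then show ?thesis using T' by blast
  qed
  let ?V = "supp_on A :: ('a set \<Rightarrow> 'g) set"
  have AC: "?V \<subseteq> C r" unfolding C_def by (rule supp_on_mono) (use A in auto)
  have Vhom: "homogeneous W r ?V" by (rule homogeneous_subset[OF hom AC])
  have wdg0: "wdg W y z = 0" if "y \<in> ?V" "z \<in> ?V" for y z
  proof
    fix \<rho>
    have yz: "y \<sigma> * z (\<rho> - \<sigma>) = 0" for \<sigma>
    proof (rule ccontr)
      assume "y \<sigma> * z (\<rho> - \<sigma>) \<noteq> 0"
      then have "\<sigma> \<in> A" "\<rho> - \<sigma> \<in> A" using that by (auto simp: supp_on_def)
      then have "\<sigma> \<inter> (\<rho> - \<sigma>) \<noteq> {}" using A(3) by (auto simp: intersecting_def simp del: Diff_disjoint)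
      then show False by auto
    qed
    then have "wdg W y z \<rho> = 0" by (simp only: wdg_def mult.assoc yz mult_zero_right sum.neutral_const)
    then show "wdg W y z \<rho> = 0 \<rho>" by simp
  qed
  have finK: "finite K" using W(1,2) finite_subset[of K "Pow W"] by simp
  have finA: "finite A" using finK A(1) finite_subset by blast
  have Om: "(supp_on (Pow W) :: ('a set \<Rightarrow> 'g) set) \<subseteq> fs.span (indicators (Pow W))"
    "finite (indicators (Pow W) :: ('a set \<Rightarrow> 'g) set)"
    using W(1) by (simp_all add: supp_on_span finite_indicators)
  have OmC: "ctr W \<xi> y \<in> supp_on (Pow W)" if "y \<in> supp_on (Pow W)" for \<xi> and y :: "'a set \<Rightarrow> 'g"
    by (rule ctr_supp_on[OF that]) auto
  have spans: "y \<sigma> = 0" if "y \<in> supp_on (Pow W)" "\<forall>\<xi>\<in>set \<xi>s. ctr W \<xi> y = 0" "\<sigma> \<noteq> {}" for y \<sigma>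
    by (rule generic_list_spans[OF W(1) gen points[OF order_refl] len that])
  have VOm: "?V \<subseteq> supp_on (Pow W)" by (rule supp_on_mono) (use A(1) W(2) in auto)
  have "card A = fs.dim ?V" by (rule dim_supp_on[OF finA, symmetric])
  also have "\<dots> = card (?S ?V)"
  proof (rule shift_family_card[OF W(1) subspace_supp_on VOm Om, symmetric])
    show "ctr W \<xi> y \<in> supp_on (Pow W)" if "y \<in> supp_on (Pow W)" for \<xi> and y :: "'a set \<Rightarrow> 'g"
      by (rule OmC[OF that])
    show "y \<sigma> = 0" if "y \<in> supp_on (Pow W)" "\<forall>\<xi>\<in>set \<xi>s. ctr W \<xi> y = 0" "\<sigma> \<noteq> {}" for y \<sigma>
      by (rule spans[OF that])
  qed
  also have "\<dots> \<le> card {S\<in>D. card S = r \<and> 0 \<in> S}"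
  proof (rule shifted_EKR[OF Dn _ shiftD ext])
    show "T \<in> D" if "S \<in> D" "T \<subseteq> S" for S T using downS that by (auto simp: D_def)
    have sub: "?S ?V \<subseteq> ?S (C r)" by (rule shift_family_mono[OF AC])
    then show "?S ?V \<subseteq> D" using DI by blast
    show "card S = r" if "S \<in> ?S ?V" for S by (rule shift_family_degree[OF W(1) Vhom that])
    show "shifted (?S ?V)"
      unfolding shifted_def
    proof (intro ballI allI impI)
      fix S i assume S: "S \<in> ?S ?V" "Suc i \<in> S \<and> i \<notin> S"
      have "?V \<in> \<V>" by (simp add: \<V>_def)
      then show "insert i (S - {Suc i}) \<in> ?S ?V"
        using S by (intro shift_family_shifted[OF W(1) gen]) auto
    qed
    show "intersecting (?S ?V)"
      unfolding intersecting_def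
      by (intro ballI) (rule shift_family_meet[OF W(1) Vhom wdg0])
    show "1 \<le> r" by (rule r(1))
  qed
  also have "\<dots> \<le> card {\<sigma> \<in> K. card \<sigma> = r - 1 \<and> v0 \<notin> \<sigma>}"
  proof -
    have "card W \<noteq> 0" using W(1,3) by auto
    then obtain \<xi> \<zeta>s where \<xi>s: "\<xi>s = \<xi> # \<zeta>s" using len by (cases \<xi>s) auto
    \<comment> \<open>For \<open>p = 0\<close> the bound on zeros says that the first covector
      vanishes nowhere on \<open>W\<close>, in particular not at \<open>v0\<close>.\<close>
    have "card {v \<in> W. affine_comb \<xi>s 0 0 (\<lambda>_. 0) v = 0} \<le> 0"
      by (rule zeros) (use \<open>card W \<noteq> 0\<close> in simp)
    then have "{v \<in> W. \<xi> v = 0} = {}" using W(1) by (simp add: affine_comb_def \<xi>s)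
    then have v0: "\<xi> v0 \<noteq> 0" using W(3) by auto
    let ?U = "ctr W \<xi> ` C r"
    have "Suc (r - 1) = r" using r(1) by simp
    then have UC: "?U \<subseteq> C (r - 1)" using ctrC[of \<xi> "r - 1"] by simp
    have Uker: "ctr W \<xi> y = 0" if "y \<in> ?U" for y
      using that by (elim imageE) (simp only: ctr_square[OF W(1)])
    have Usub: "fs.subspace ?U" by (rule subspace_ctr_image) (simp add: C_def subspace_supp_on)
    let ?\<Omega> = "supp_on (Pow W) \<inter> {y. ctr W \<xi> y = 0}"
    have "C (r - 1) \<subseteq> supp_on (Pow W)" unfolding C_def by (rule supp_on_mono) (use W(2) in auto)
    then have "?U \<subseteq> ?\<Omega>" using UC Uker by blast
    \<comment> \<open>Sets through 0 come from the image branch of the first covector, so their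
      number is at most the rank of its contraction on \<open>C r\<close>.\<close>
    have "{S\<in>D. card S = r \<and> 0 \<in> S} \<subseteq> insert 0 ` shift_family W (Suc 0) \<zeta>s ?U"
    proof
      fix S assume "S \<in> {S\<in>D. card S = r \<and> 0 \<in> S}"
      then have "S \<in> shift_family W 0 (\<xi> # \<zeta>s) (C r)" "0 \<in> S" by (auto simp: D_def \<xi>s)
      then show "S \<in> insert 0 ` shift_family W (Suc 0) \<zeta>s ?U"
        unfolding shift_family.simps using shift_family_Suc_notin by blast
    qed
    then have "card {S\<in>D. card S = r \<and> 0 \<in> S} \<le> card (shift_family W (Suc 0) \<zeta>s ?U)"
      by (rule surj_card_le[OF finite_shift_family])
    also have "\<dots> = fs.dim ?U"
    proof (rule shift_family_card[where \<Omega>="?\<Omega>", OF W(1) Usub \<open>?U \<subseteq> ?\<Omega>\<close> le_infI1[OF Om(1)] Om(2)])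
      fix \<eta> y assume y: "y \<in> ?\<Omega>"
      have "ctr W \<xi> (ctr W \<eta> y) = - ctr W \<eta> (ctr W \<xi> y)" by (rule ctr_anticommute[OF W(1)])
      also have "ctr W \<xi> y = 0" using y by blast
      finally have "ctr W \<xi> (ctr W \<eta> y) = 0" by (simp only: ctr_0 minus_zero)
      then show "ctr W \<eta> y \<in> ?\<Omega>" using OmC y by blast
    next
      fix y :: "'a set \<Rightarrow> 'g" and \<sigma> :: "'a set"
      assume y: "y \<in> ?\<Omega>" "\<forall>\<xi>\<in>set \<zeta>s. ctr W \<xi> y = 0" "\<sigma> \<noteq> {}"
      have "\<forall>\<eta>\<in>set \<xi>s. ctr W \<eta> y = 0" unfolding \<xi>s list.set using y(1,2) by blast
      moreover have "y \<in> supp_on (Pow W)" using y(1) by blast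
      ultimately show "y \<sigma> = 0" using y(3) by (intro spans)
    qed
    also have "\<dots> \<le> card {\<sigma> \<in> {\<sigma> \<in> K. card \<sigma> = r - 1}. v0 \<notin> \<sigma>}"
      by (rule dim_contraction_le[OF W(1) _ W(3) v0 Usub _ Uker]) (use W(2) UC in \<open>auto simp: C_def\<close>)
    also have "{\<sigma> \<in> {\<sigma> \<in> K. card \<sigma> = r - 1}. v0 \<notin> \<sigma>} = {\<sigma> \<in> K. card \<sigma> = r - 1 \<and> v0 \<notin> \<sigma>}" by auto
    finally show ?thesis .
  qed
  finally show ?thesis .
qed

section \<open>From vanishing homology to exact contractions\<close>

lemma boundary_map_eq_ctr:
  fixes c :: "'a set \<Rightarrow> 'f::field"
  assumes W: "finite W" "L \<subseteq> Pow W" and c: "c \<in> supp_on L"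
  shows "boundary_map L c = ctr W (\<lambda>_. 1) c"
proof
  fix \<tau>
  have c0: "c (insert v \<tau>) = 0" if "v \<notin> vertices L" for v
    using c that by (auto simp: supp_on_def vertices_def)
  have LW: "vertices L \<subseteq> W" using W(2) by (auto simp: vertices_def)
  show "boundary_map L c \<tau> = ctr W (\<lambda>_. 1) c \<tau>"
  proof (cases "\<tau> \<subseteq> W")
    case True
    then have "\<tau> \<inter> W = \<tau>" by auto
    then have "boundary_map L c \<tau> = (\<Sum>v\<in>vertices L - \<tau>. 1 * inv_sign W v \<tau> * c (insert v \<tau>))"
      by (simp add: boundary_map_def inv_sign_def)
    also have "\<dots> = ctr W (\<lambda>_. 1) c \<tau>"
      unfolding ctr_def by (rule sum.mono_neutral_left) (use W(1) LW c0 in auto)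
    finally show ?thesis .
  next
    case False
    then have "c (insert v \<tau>) = 0" for v using c W(2) by (auto simp: supp_on_def)
    then show ?thesis by (simp add: boundary_map_def ctr_def)
  qed
qed

text \<open>Dimension \<open>int j - 1\<close> is cardinality \<open>j\<close>. The class of a cycle
  contains the cycle and is an element of the quotient, whose sole element is the set of
  boundaries.\<close>

lemma homology_vanishes_exact:
  assumes W: "finite W" "L \<subseteq> Pow W" and hv: "homology_vanishes TYPE('f::field) L (int j - 1)"
  shows "ctr_exact W (\<lambda>_. 1 :: 'f) {\<tau> \<in> L. card \<tau> = j} {\<tau> \<in> L. card \<tau> = Suc j}"
  unfolding ctr_exact_def
proof (intro ballI impI)
  fix c :: "'a set \<Rightarrow> 'f"
  assume c: "c \<in> supp_on {\<tau> \<in> L. card \<tau> = j}" "ctr W (\<lambda>_. 1) c = 0"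
  have chains: "simplicial_chains L (int i - 1) = (supp_on {\<tau> \<in> L. card \<tau> = i} :: ('a set \<Rightarrow> 'f) set)" for i
    by (auto simp: simplicial_chains_def supp_on_def face_dim_def)
  have sub: "supp_on {\<tau> \<in> L. card \<tau> = i} \<subseteq> supp_on L" for i by (rule supp_on_mono) auto
  have "boundary_map L c = 0" using boundary_map_eq_ctr[OF W subsetD[OF sub c(1)]] c(2) by simp
  then have cyc: "c \<in> cycles L (int j - 1)"
    using c(1) unfolding cycles_def chains by (simp add: zero_fun_def)
  have "(\<lambda>\<sigma>. c \<sigma> - c \<sigma>) \<in> boundaries L (int j - 1)"
  proof -
    have "(\<lambda>\<sigma>. c \<sigma> - c \<sigma>) = boundary_map L (\<lambda>_. 0)" by (simp add: boundary_map_def fun_eq_iff)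
    moreover have "(\<lambda>_. 0 :: 'f) \<in> simplicial_chains L (int j - 1 + 1)" by (simp add: simplicial_chains_def)
    ultimately show ?thesis unfolding boundaries_def by (rule image_eqI)
  qed
  then have refl: "c \<in> homologous L (int j - 1) `` {c}" using cyc by (simp add: homologous_def)
  have "homologous L (int j - 1) `` {c} \<in> reduced_homology L (int j - 1)"
    unfolding reduced_homology_def using cyc by (rule quotientI)
  then have "homologous L (int j - 1) `` {c} = boundaries L (int j - 1)"
    unfolding hv[unfolded homology_vanishes_def] by (rule singletonD)
  then have "c \<in> boundaries L (int j - 1)" using refl by simp
  moreover have "int j - 1 + 1 = int (Suc j) - 1" by simp
  ultimately have "c \<in> boundary_map L ` supp_on {\<tau> \<in> L. card \<tau> = Suc j}"
    unfolding boundaries_def by (simp only: chains)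
  then obtain z where z: "z \<in> supp_on {\<tau> \<in> L. card \<tau> = Suc j}" "c = boundary_map L z" by blast
  then have "ctr W (\<lambda>_. 1) z = c" using boundary_map_eq_ctr[OF W subsetD[OF sub z(1)]] by simp
  then show "\<exists>z\<in>supp_on {\<tau> \<in> L. card \<tau> = Suc j}. ctr W (\<lambda>_. 1) z = c"
    using z(1) by (rule bexI)
qed

text \<open>Up to cardinality \<open>k\<close> the pure skeleton of dimension \<open>k - 1\<close>
  has the same faces as \<open>K\<close>, by the extension property. The link of \<open>T\<close> in
  it has dimension at least \<open>k - card T - 1\<close>, so its homology vanishes at cardinality
  \<open>i - card T\<close>, the degree to which the strand shifts when \<open>T\<close> is
  deleted.\<close>

lemma cohen_macaulay_skeleton_link_exact:
  fixes \<xi> :: "'a \<Rightarrow> 'f::field alg_closure"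
  assumes W: "finite W" "K \<subseteq> Pow W" and down: "\<And>\<sigma> \<tau>. \<sigma> \<in> K \<Longrightarrow> \<tau> \<subseteq> \<sigma> \<Longrightarrow> \<tau> \<in> K"
    and k: "\<And>\<sigma>. \<sigma> \<in> K \<Longrightarrow> card \<sigma> \<le> k \<Longrightarrow> \<exists>\<rho>\<in>K. \<sigma> \<subseteq> \<rho> \<and> card \<rho> = k"
    and cm: "cohen_macaulay TYPE('f) (pure_skeleton (int k - 1) K)"
    and T: "T \<subseteq> W" and i: "i < k" and \<xi>: "\<And>v. v \<in> W \<Longrightarrow> \<xi> v = 0 \<longleftrightarrow> v \<in> T"
  shows "ctr_exact W \<xi> (strand K T {} i) (strand K T {} (Suc i))"
proof (cases "T \<in> K \<and> card T \<le> i")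
  case False
  \<comment> \<open>No face of cardinality \<open>i\<close> contains \<open>T\<close>, so zero is
    the only cycle.\<close>
  have "strand K T {} i = {}"
  proof (rule ccontr)
    assume "strand K T {} i \<noteq> {}"
    then obtain \<sigma> where \<sigma>: "\<sigma> \<in> K" "T \<subseteq> \<sigma>" "card \<sigma> = i" by (auto simp: strand_def)
    moreover have "finite \<sigma>" using \<sigma>(1) W finite_subset by blast
    ultimately show False using False down card_mono by blast
  qed
  then have "y = 0" if "y \<in> supp_on (strand K T {} i)" for y :: "'a set \<Rightarrow> 'f alg_closure"
    using that by (auto simp: supp_on_def fun_eq_iff)
  moreover have "\<exists>z\<in>supp_on (strand K T {} (Suc i)). ctr W \<xi> z = 0"
    by (rule bexI[of _ 0]) simp_all
  ultimately show ?thesis unfolding ctr_exact_def by blast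
next
  case TK: True
  define j where "j = i - card T"
  define K' where "K' = pure_skeleton (int k - 1) K"
  have finT: "finite T" using T W(1) finite_subset by blast
  have K': "\<sigma> \<in> K' \<longleftrightarrow> \<sigma> \<in> K" if "card \<sigma> \<le> k" for \<sigma>
    using k[OF _ that] down unfolding K'_def pure_skeleton_def face_dim_def by auto
  have K'le: "card \<sigma> \<le> k" "finite \<sigma>" "\<sigma> \<subseteq> W" if \<sigma>: "\<sigma> \<in> K'" for \<sigma>
  proof -
    obtain \<rho> where \<rho>: "\<rho> \<in> K" "card \<rho> = k" "\<sigma> \<subseteq> \<rho>"
      using \<sigma> unfolding K'_def pure_skeleton_def face_dim_def by auto
    have "finite \<rho>" using \<rho>(1) W finite_subset by blast
    then show "card \<sigma> \<le> k" "finite \<sigma>" using \<rho> card_mono finite_subset by blast+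
    show "\<sigma> \<subseteq> W" using \<rho> W(2) by blast
  qed
  let ?L = "link K' T"
  have TK': "T \<in> K'" using K' TK i by simp
  have LW: "?L \<subseteq> Pow W" using K'le(3) by (auto simp: link_def)
  have finL: "finite ?L" using LW W(1) finite_subset[of ?L "Pow W"] by simp
  obtain \<rho> where \<rho>: "\<rho> \<in> K" "T \<subseteq> \<rho>" "card \<rho> = k" using k[of T] TK i by auto
  have "\<rho> - T \<in> ?L" using \<rho> K'[of \<rho>] by (auto simp: link_def Un_absorb2)
  then have "face_dim (\<rho> - T) \<le> complex_dim ?L"
    unfolding complex_dim_def using finL by (intro Max_ge) auto
  moreover have "card (\<rho> - T) = k - card T" using \<rho> finT by (simp add: card_Diff_subset)
  ultimately have "int j - 1 < complex_dim ?L"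
    using TK i by (simp add: face_dim_def j_def)
  then have "homology_vanishes TYPE('f) ?L (int j - 1)"
    using cm TK' unfolding cohen_macaulay_def K'_def by blast
  then have "ctr_exact W (\<lambda>_. 1 :: 'f) {\<tau> \<in> ?L. card \<tau> = j} {\<tau> \<in> ?L. card \<tau> = Suc j}"
    by (rule homology_vanishes_exact[OF W(1) LW])
  then have ex: "ctr_exact W (\<lambda>_. 1 :: 'f alg_closure) {\<tau> \<in> ?L. card \<tau> = j} {\<tau> \<in> ?L. card \<tau> = Suc j}"
    by (rule exact_extend_scalars[rotated]) (use finL in simp)
  have strand: "{\<tau>. \<tau> \<inter> T = {} \<and> \<tau> \<union> T \<in> strand K T {} (card T + m)} = {\<tau> \<in> ?L. card \<tau> = m}"
    if m: "card T + m \<le> k" for m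
  proof (rule Set.set_eqI)
    fix \<tau>
    show "\<tau> \<in> {\<tau>. \<tau> \<inter> T = {} \<and> \<tau> \<union> T \<in> strand K T {} (card T + m)} \<longleftrightarrow> \<tau> \<in> {\<tau> \<in> ?L. card \<tau> = m}"
    proof (cases "\<tau> \<inter> T = {} \<and> finite \<tau>")
      case True
      then have "card (\<tau> \<union> T) = card \<tau> + card T" using finT by (intro card_Un_disjoint) auto
      then show ?thesis using True K'[of "\<tau> \<union> T"] m by (auto simp: strand_def link_def)
    next
      case False
      have "\<tau> \<union> T \<notin> K" "\<tau> \<union> T \<notin> K'" if "infinite \<tau>"
        using that W finite_subset[of "\<tau> \<union> T" W] K'le(2)[of "\<tau> \<union> T"] by auto
      then show ?thesis using False by (auto simp: strand_def link_def)
    qed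
  qed
  have ij: "i = card T + j" "Suc i = card T + Suc j" using TK by (simp_all add: j_def)
  show ?thesis
  proof (rule exact_link[OF W(1) T _ _ _ \<xi>])
    fix w :: "'a \<Rightarrow> 'f alg_closure" assume w: "\<And>v. v \<in> W \<Longrightarrow> w v \<noteq> 0"
    have "ctr_exact W w {\<tau> \<in> ?L. card \<tau> = j} {\<tau> \<in> ?L. card \<tau> = Suc j}"
      by (rule exact_reweight[OF W(1) _ _ ex w]) (use LW in auto)
    then show "ctr_exact W w {\<tau>. \<tau> \<inter> T = {} \<and> \<tau> \<union> T \<in> strand K T {} i}
        {\<tau>. \<tau> \<inter> T = {} \<and> \<tau> \<union> T \<in> strand K T {} (Suc i)}"
      unfolding ij using strand[of j] strand[of "Suc j"] i ij by simp
  qed (auto simp: strand_def)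
qed

theorem theorem4p1:
  fixes V :: "'a set" and E :: "'a set set" and r :: nat
  assumes "simple_graph V E"
    and "\<exists>v. isolated_vertex V E v"
    and "sequentially_cohen_macaulay TYPE('f::field) (independence_complex V E)"
    and "r > 0"
    and "real r \<le> real (min_facet_card (independence_complex V E)) / 2"
  shows "EKR r (independence_complex V E)"
proof -
  define K where "K = independence_complex V E"
  define k where "k = min_facet_card K"
  have finV: "finite V" and edges: "\<And>e. e \<in> E \<Longrightarrow> e \<subseteq> V \<and> card e = 2"
    using assms(1) by (auto simp: simple_graph_def)
  have KV: "K \<subseteq> Pow V" by (auto simp: K_def independence_complex_def)
  have finK: "finite K" using KV finV finite_subset[of K "Pow V"] by simp
  have down: "\<tau> \<in> K" if "\<sigma> \<in> K" "\<tau> \<subseteq> \<sigma>" for \<sigma> \<tau>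
    using that unfolding K_def independence_complex_def by blast
  obtain v0 where v0: "v0 \<in> V" "\<And>e. e \<in> E \<Longrightarrow> v0 \<notin> e"
    using assms(2) by (auto simp: isolated_vertex_def)
  \<comment> \<open>The isolated vertex is a cone point of the independence complex.\<close>
  have cone: "insert v0 \<sigma> \<in> K" if "\<sigma> \<in> K" for \<sigma>
    using that v0 unfolding K_def independence_complex_def by blast
  have empty: "{} \<in> K" by (simp add: K_def independence_complex_def)
  have facet: "\<exists>\<phi>\<in>facets K. \<sigma> \<subseteq> \<phi>" if \<sigma>: "\<sigma> \<in> K" for \<sigma>
  proof -
    obtain \<phi> where "\<phi> \<in> K" "\<sigma> \<subseteq> \<phi>" "\<forall>\<tau>\<in>K. \<phi> \<subseteq> \<tau> \<longrightarrow> \<phi> = \<tau>"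
      using finite_has_maximal2[OF finK \<sigma>] by blast
    then show ?thesis by (auto simp: facets_def)
  qed
  have finF: "finite (facets K)" using finK by (simp add: facets_def)
  have kle: "k \<le> card \<phi>" if "\<phi> \<in> facets K" for \<phi>
    unfolding k_def min_facet_card_def using finF that by (intro Min_le) auto
  have ext: "\<exists>\<rho>\<in>K. \<sigma> \<subseteq> \<rho> \<and> card \<rho> = k" if \<sigma>: "\<sigma> \<in> K" "card \<sigma> \<le> k" for \<sigma>
  proof -
    obtain \<phi> where \<phi>: "\<phi> \<in> facets K" "\<sigma> \<subseteq> \<phi>" using facet \<sigma>(1) by blast
    then have "\<phi> \<in> K" by (simp add: facets_def)
    then have "finite \<phi>" using KV finV finite_subset by blast
    then obtain \<rho> where "\<sigma> \<subseteq> \<rho>" "\<rho> \<subseteq> \<phi>" "card \<rho> = k"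
      using exists_subset_between[OF \<sigma>(2) kle[OF \<phi>(1)] \<phi>(2)] by blast
    then show ?thesis using down[OF \<open>\<phi> \<in> K\<close>] by blast
  qed
  have r: "r \<ge> 1" "2 * r \<le> k" using assms(4,5) by (simp_all add: k_def K_def)
  obtain \<rho> where \<rho>: "\<rho> \<in> K" "card \<rho> = k" using ext[OF empty] by auto
  have kV: "k \<le> card V" using \<rho> KV card_mono[OF finV] by blast
  have "face_dim \<rho> \<le> complex_dim K"
    unfolding complex_dim_def using finK \<rho>(1) by (intro Max_ge) auto
  \<comment> \<open>The relevant skeleton has dimension \<open>k - 1\<close>, the dimension of the
    face \<open>\<rho>\<close>, hence at most that of \<open>K\<close>.\<close>
  then have cm: "cohen_macaulay TYPE('f) (pure_skeleton (int k - 1) K)"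
    using assms(3) \<rho>(2) unfolding sequentially_cohen_macaulay_def K_def[symmetric] by (simp add: face_dim_def)
  have zero_set: "ctr_exact V \<xi> {\<sigma> \<in> K. card \<sigma> = i} {\<sigma> \<in> K. card \<sigma> = Suc i}"
    if "i + card {v \<in> V. \<xi> v = 0} < k" for \<xi> :: "'a \<Rightarrow> 'f alg_closure" and i
    using that
  proof (rule zero_set_exact[OF finV KV _ down, rotated -1])
    show "ctr_exact V \<xi> (strand K T {} i) (strand K T {} (Suc i))"
      if "T \<subseteq> V" "i < k" "\<And>v. v \<in> V \<Longrightarrow> \<xi> v = 0 \<longleftrightarrow> v \<in> T" for T and \<xi> :: "'a \<Rightarrow> 'f alg_closure" and i
      by (rule cohen_macaulay_skeleton_link_exact[OF finV KV down ext cm that])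
  qed
  show ?thesis
    unfolding EKR_def K_def[symmetric]
  proof (intro allI impI)
    fix A assume A: "A \<subseteq> K \<and> (\<forall>\<sigma>\<in>A. card \<sigma> = r) \<and> intersecting A"
    have "card A \<le> card {\<sigma> \<in> K. card \<sigma> = r - 1 \<and> v0 \<notin> \<sigma>}"
      by (rule exact_EKR[OF finV KV v0(1) down zero_set _ _ _ r kV]) (use A in auto)
    \<comment> \<open>By the cone property, every face avoiding \<open>v0\<close> lies in the link
      of \<open>v0\<close>.\<close>
    also have "\<dots> \<le> face_number (r - 1) (link K {v0})"
    proof -
      have "finite (link K {v0})"
        by (rule finite_subset[of _ "Pow V"]) (use KV finV in \<open>auto simp: link_def\<close>)
      then show ?thesis
        unfolding face_number_def
      proof (intro card_mono)
        show "finite {\<sigma> \<in> link K {v0}. card \<sigma> = r - 1}" using \<open>finite (link K {v0})\<close> by simp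
      qed (use cone in \<open>auto simp: link_def\<close>)
    qed
    also have "\<dots> \<le> Max ((\<lambda>v. face_number (r - 1) (link K {v})) ` vertices K)"
    proof (rule Max_ge)
      have "finite (vertices K)"
        by (rule finite_subset[OF _ finV]) (use KV in \<open>auto simp: vertices_def\<close>)
      then show "finite ((\<lambda>v. face_number (r - 1) (link K {v})) ` vertices K)" by simp
      have "v0 \<in> vertices K" using cone[OF empty] by (auto simp: vertices_def)
      then show "face_number (r - 1) (link K {v0}) \<in> (\<lambda>v. face_number (r - 1) (link K {v})) ` vertices K"
        by simp
    qed
    finally show "card A \<le> Max ((\<lambda>v. face_number (r - 1) (link K {v})) ` vertices K)" .
  qed
qed

end
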